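(* Let $\Omega\subset\mathbb{R}^n$ be convex, $p\in(0,1]$, $\alpha>0$, $\beta>0$ and $2\alpha-\beta>0$. Then the set of extremal points of the ball $\{\mu\in\mathcal{M}(\Omega)\,:\,\|\mu\|_{\mathrm{KR}_p^{\alpha,\beta}}\le 1\}$ is precisely $$\left\{\pm\frac1\alpha\delta_x \,:\, x\in\Omega\right\}\cup\left\{\frac{1}{\beta+|x-y|^p}(\delta_x-\delta_y)\,:\, x,y\in\Omega,\ 0<|x-y|^p<2\alpha-\beta\right\}.$$
   Context: $\mathcal{M}(\Omega)=(\mathcal{C}_0(\Omega))^*$ is the space of finite signed Radon measures on $\Omega$; $\nu_+=\nu^+$ and $\nu_-=\nu^-$ denote the positive and negative parts (Hahn--Jordan decomposition) of $\nu$, and $|\nu|$ its total variation measure. For nonnegative finite measures $\mu,\nu$ on $\Omega$, $W_p(\mu,\nu):=\inf\{\int_{\Omega\times\Omega}|x-y|^p\,d\gamma(x,y):\gamma\in\Pi(\mu,\nu)\}$ (no $1/p$-th power is taken), where $\Pi(\mu,\nu)$ is the set of nonnegative measures on $\Omega\times\Omega$ with first marginal $\mu$ and second marginal $\nu$ (the infimum over the empty set is $+\infty$). The generalized Kantorovich--Rubinstein norm is $$\|\mu\|_{\mathrm{KR}_p^{\alpha,\beta}}:=\inf_{\nu\in\mathcal{M}(\Omega)} W_p(\nu_+,\nu_-)+\frac\beta2|\nu|(\Omega)+\mathbf{1}_{\nu(\Omega)=0}+\alpha|\mu-\nu|(\Omega),$$ where $\mathbf{1}_{\nu(\Omega)=0}$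 equals $0$ if $\nu(\Omega)=0$ and $+\infty$ otherwise. A point $u$ of a convex set $C$ is extremal if $u=\lambda v_1+(1-\lambda)v_2$ with $\lambda\in(0,1)$, $v_1,v_2\in C$ implies $u=v_1=v_2$. *)

theory Defs
  imports "HOL-Probability.Probability"
begin

text \<open>
  A finite signed measure on \<open>\<Omega>\<close> is represented by a real-valued function on sets, normalised to
  be 0 off the Borel sets of \<open>\<Omega>\<close>, so that equality of signed measures is equality of functions.
  The set \<open>\<Omega>\<close> need not be a Borel subset of the ambient space; its Borel sets are those of the
  subspace topology.
\<close>

abbreviation borel_on :: "'a::topological_space set \<Rightarrow> 'a measure" where
  "borel_on \<Omega> \<equiv> restrict_space borel \<Omega>"

definition signed_measures :: "'a::topological_space set \<Rightarrow> ('a set \<Rightarrow> real) set" where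
  "signed_measures \<Omega> = {\<nu>.
     (\<forall>A. A \<notin> sets (borel_on \<Omega>) \<longrightarrow> \<nu> A = 0) \<and>
     (\<forall>A::nat \<Rightarrow> 'a set. range A \<subseteq> sets (borel_on \<Omega>) \<longrightarrow> disjoint_family A \<longrightarrow>
        (\<lambda>i. \<nu> (A i)) sums \<nu> (\<Union>i. A i))}"

definition is_jordan_decomposition ::
    "'a::topological_space set \<Rightarrow> ('a set \<Rightarrow> real) \<Rightarrow> 'a measure \<Rightarrow> 'a measure \<Rightarrow> bool" where
  "is_jordan_decomposition \<Omega> \<nu> \<mu>1 \<mu>2 \<longleftrightarrow>
     finite_measure \<mu>1 \<and> finite_measure \<mu>2 \<and>
     sets \<mu>1 = sets (borel_on \<Omega>) \<and> sets \<mu>2 = sets (borel_on \<Omega>) \<and>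
     (\<forall>A\<in>sets (borel_on \<Omega>). \<nu> A = measure \<mu>1 A - measure \<mu>2 A) \<and>
     (\<exists>P\<in>sets (borel_on \<Omega>). emeasure \<mu>1 (\<Omega> - P) = 0 \<and> emeasure \<mu>2 P = 0)"

text \<open>By the Jordan decomposition theorem the following pair exists and is unique for every
  \<open>\<nu> \<in> signed_measures \<Omega>\<close>.\<close>

definition jordan_parts ::
    "'a::topological_space set \<Rightarrow> ('a set \<Rightarrow> real) \<Rightarrow> 'a measure \<times> 'a measure" where
  "jordan_parts \<Omega> \<nu> = (THE m. is_jordan_decomposition \<Omega> \<nu> (fst m) (snd m))"

definition pos_part :: "'a::topological_space set \<Rightarrow> ('a set \<Rightarrow> real) \<Rightarrow> 'a measure" where
  "pos_part \<Omega> \<nu> = fst (jordan_parts \<Omega> \<nu>)"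

definition neg_part :: "'a::topological_space set \<Rightarrow> ('a set \<Rightarrow> real) \<Rightarrow> 'a measure" where
  "neg_part \<Omega> \<nu> = snd (jordan_parts \<Omega> \<nu>)"

definition total_variation ::
    "'a::topological_space set \<Rightarrow> ('a set \<Rightarrow> real) \<Rightarrow> 'a set \<Rightarrow> ennreal" where
  "total_variation \<Omega> \<nu> A = emeasure (pos_part \<Omega> \<nu>) A + emeasure (neg_part \<Omega> \<nu>) A"

text \<open>
  Radon means that the total variation is inner regular with respect to compact sets. If \<open>\<Omega>\<close> is
  locally compact, every finite signed Borel measure is Radon and, by Riesz representation, this
  space is the dual of \<open>C\<^sub>0(\<Omega>)\<close>.
\<close>

definition radon_measures :: "'a::topological_space set \<Rightarrow> ('a set \<Rightarrow> real) set" where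
  "radon_measures \<Omega> = {\<nu> \<in> signed_measures \<Omega>.
     \<forall>A\<in>sets (borel_on \<Omega>). \<forall>\<epsilon>>0. \<exists>K. compact K \<and> K \<subseteq> A \<and>
       total_variation \<Omega> \<nu> (A - K) \<le> ennreal \<epsilon>}"

definition couplings :: "'a measure \<Rightarrow> 'a measure \<Rightarrow> ('a \<times> 'a) measure set" where
  "couplings \<mu> \<nu> = {\<gamma>. sets \<gamma> = sets (\<mu> \<Otimes>\<^sub>M \<nu>) \<and> distr \<gamma> \<mu> fst = \<mu> \<and> distr \<gamma> \<nu> snd = \<nu>}"

text \<open>No \<open>1/p\<close>-th power is taken; the infimum over the empty set is \<open>\<infinity>\<close>.\<close>

definition W :: "real \<Rightarrow> 'a::real_normed_vector measure \<Rightarrow> 'a measure \<Rightarrow> ennreal" where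
  "W p \<mu> \<nu> = (INF \<gamma>\<in>couplings \<mu> \<nu>. \<integral>\<^sup>+ z. ennreal (norm (fst z - snd z) powr p) \<partial>\<gamma>)"

text \<open>Meant for \<open>\<alpha>, \<beta> \<ge> 0\<close>: \<open>ennreal\<close> sends negative reals to 0.\<close>

definition KR_norm ::
    "'a::real_normed_vector set \<Rightarrow> real \<Rightarrow> real \<Rightarrow> real \<Rightarrow> ('a set \<Rightarrow> real) \<Rightarrow> ennreal" where
  "KR_norm \<Omega> p \<alpha> \<beta> \<mu> =
     (INF \<nu>\<in>radon_measures \<Omega>.
        W p (pos_part \<Omega> \<nu>) (neg_part \<Omega> \<nu>)
        + ennreal (\<beta> / 2) * total_variation \<Omega> \<nu> \<Omega>
        + (if \<nu> \<Omega> = 0 then 0 else \<infinity>)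
        + ennreal \<alpha> * total_variation \<Omega> (\<lambda>A. \<mu> A - \<nu> A) \<Omega>)"

definition KR_ball ::
    "'a::real_normed_vector set \<Rightarrow> real \<Rightarrow> real \<Rightarrow> real \<Rightarrow> ('a set \<Rightarrow> real) set" where
  "KR_ball \<Omega> p \<alpha> \<beta> = {\<mu> \<in> radon_measures \<Omega>. KR_norm \<Omega> p \<alpha> \<beta> \<mu> \<le> 1}"

text \<open>Pointwise version of \<^const>\<open>extreme_point_of\<close>, which needs a type of class
  \<^class>\<open>real_vector\<close> and so does not apply to set functions.\<close>

definition extremal_points :: "('b \<Rightarrow> real) set \<Rightarrow> ('b \<Rightarrow> real) set" where
  "extremal_points C = {u \<in> C. \<forall>v1\<in>C. \<forall>v2\<in>C. \<forall>t::real.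
     0 < t \<longrightarrow> t < 1 \<longrightarrow> u = (\<lambda>A. t * v1 A + (1 - t) * v2 A) \<longrightarrow> u = v1 \<and> u = v2}"

definition dirac :: "'a::topological_space set \<Rightarrow> 'a \<Rightarrow> 'a set \<Rightarrow> real" where
  "dirac \<Omega> x = measure (return (borel_on \<Omega>) x)"

end

theory Submission
  imports Defs
begin

text \<open>
  Put \<open>d(x,y) = |x - y|^p\<close>, a metric because \<open>0 < p \<le> 1\<close>. The norm is a transport cost: moving a unit of mass from \<open>x\<close>
  to \<open>y \<noteq> x\<close> costs \<open>\<beta> + d(x,y)\<close>, and creating or deleting a unit costs \<open>\<alpha>\<close>. The point masses \<open>\<plusminus>\<delta>\<^sub>x/\<alpha>\<close> and
  the normalised dipoles \<open>(\<delta>\<^sub>x - \<delta>\<^sub>y)/(\<beta> + d(x,y))\<close> are what a unit of cost buys, and a dipole with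
  \<open>\<beta> + d(x,y) \<ge> 2 \<alpha>\<close> is no cheaper than deleting mass at one end and creating it at the other.

  These points are extremal by duality. If \<open>|f| \<le> \<alpha>\<close> and \<open>f x - f y \<le> \<beta> + d(x,y)\<close> on \<open>\<Omega>\<close>, then the integral of
  \<open>f\<close> against \<open>\<mu>\<close> is at most the norm of \<open>\<mu>\<close> (\<open>KR_norm_dual\<close>). For each listed point there is such an \<open>f\<close> with integral
  \<open>1\<close> that remains admissible under all small perturbations vanishing on the support of the point; here the fixed fee
  \<open>\<beta> > 0\<close> is essential. So any measure in the ball against which \<open>f\<close> has integral \<open>1\<close> lives on the same one or two
  points (\<open>ball_exposed\<close>), and it must be the given one (\<open>point_mass_extremal\<close>, \<open>dipole_extremal\<close>).

  For the converse let \<open>\<mu>\<close> be extremal with Jordan parts \<open>a\<close> and \<open>b\<close>. First, the norm may be computed with plans whose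
  marginals stay below \<open>a\<close> and \<open>b\<close>, the untransported rest being paid at rate \<open>\<alpha>\<close>
  (\<open>KR_norm_le_plan_cost\<close>, \<open>ex_dominated_subplan\<close>). Such a plan can be cut along any Borel set \<open>A\<close> of starting points, which
  splits \<open>\<mu>\<close> as \<open>(1\<^sub>A a - g b) + (1\<^bsub>\<Omega>-A\<^esub> a - (1 - g) b)\<close> and distributes the cost of the plan among the two
  summands. Instead of an optimal plan, whose existence would require weak compactness of plans, the proof produces
  an optimal weight \<open>g\<close>: the weights coming from nearly optimal plans form convex sets, and those of nearly minimal
  \<open>L\<^sup>2\<close> norm converge in \<open>L\<^sup>1\<close> (\<open>midpoint_convex_L1_limit\<close>), while the norm is continuous for the total variation. Thus
  \<open>\<mu>\<close> splits into two pieces whose norms add up to at most \<open>1\<close> (\<open>ex_optimal_split\<close>). By extremality the first piece is a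
  multiple of \<open>\<mu>\<close>, which is only possible if \<open>a\<close> vanishes on \<open>A\<close> or on its complement (\<open>extremal_zero_one\<close>).
  As \<open>A\<close> is arbitrary, \<open>a\<close> is concentrated at one point, and so is \<open>b\<close> because the ball is symmetric. It remains to
  consider \<open>a \<delta>\<^sub>x - b \<delta>\<^sub>y\<close>, whose norm is found from an explicit test function; unless it is one of the listed
  points, it decomposes (\<open>extremal_one_point\<close>, \<open>extremal_two_point\<close>).
\<close>

section \<open>Jordan decomposition of real set functions\<close>

lemma space_borel_on [simp]: "space (borel_on \<Omega>) = \<Omega>"
  by (simp add: space_restrict_space)

definition real_cadd :: "'a measure \<Rightarrow> ('a set \<Rightarrow> real) \<Rightarrow> bool" where
  "real_cadd M \<nu> \<longleftrightarrow> (\<forall>A::nat \<Rightarrow> 'a set. range A \<subseteq> sets M \<longrightarrow> disjoint_family A \<longrightarrow>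
        (\<lambda>i. \<nu> (A i)) sums \<nu> (\<Union>i. A i))"

lemma real_caddD:
  "real_cadd M \<nu> \<Longrightarrow> range A \<subseteq> sets M \<Longrightarrow> disjoint_family A \<Longrightarrow> (\<lambda>i. \<nu> (A i)) sums \<nu> (\<Union>i::nat. A i)"
  by (auto simp: real_cadd_def)

lemma real_cadd_empty: assumes "real_cadd M \<nu>" shows "\<nu> {} = 0"
proof -
  have "(\<lambda>i::nat. \<nu> {}) sums \<nu> (\<Union>i::nat. {})"
    using assms by (intro real_caddD[where A = "\<lambda>_. {}"]) (auto simp: disjoint_family_on_def)
  then show ?thesis using sums_summable summable_const_iff by blast
qed

lemma real_cadd_Un:
  assumes "real_cadd M \<nu>" "A \<in> sets M" "B \<in> sets M" "A \<inter> B = {}"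
  shows "\<nu> (A \<union> B) = \<nu> A + \<nu> B"
proof -
  have "(\<lambda>i. \<nu> (binaryset A B i)) sums \<nu> (\<Union>i. binaryset A B i)"
    using assms by (intro real_caddD) (auto simp: disjoint_family_on_def binaryset_def range_binaryset_eq)
  moreover have "(\<lambda>i. \<nu> (binaryset A B i)) sums (\<nu> A + \<nu> B)"
    using real_cadd_empty[OF assms(1)] by (rule binaryset_sums)
  ultimately show ?thesis by (simp add: UN_binaryset_eq sums_unique2)
qed

lemma real_cadd_Diff:
  assumes "real_cadd M \<nu>" "A \<in> sets M" "B \<in> sets M" "B \<subseteq> A"
  shows "\<nu> A = \<nu> B + \<nu> (A - B)"
  using real_cadd_Un[OF assms(1,3), of "A - B"] assms by (auto simp: Un_absorb1)

lemma real_cadd_split: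
  assumes "real_cadd M \<nu>" "A \<in> sets M" "B \<in> sets M"
  shows "\<nu> A = \<nu> (A \<inter> B) + \<nu> (A - B)"
proof -
  have "A - A \<inter> B = A - B" by auto
  then show ?thesis using real_cadd_Diff[OF assms(1,2), of "A \<inter> B"] assms by auto
qed

text \<open>
  The supremum of \<open>\<nu>\<close> over subsets of \<open>D\<close> might a priori be infinite, and truncating at \<open>1\<close> keeps it finite. The
  set \<open>B\<close> collects at least half of this truncated supremum.
\<close>

lemma greedy_subset:
  assumes nu: "real_cadd M \<nu>" and D: "D \<in> sets M"
  shows "\<exists>B\<in>sets M. B \<subseteq> D \<and> 0 \<le> \<nu> B \<and> (\<forall>C\<in>sets M. C \<subseteq> D \<longrightarrow> min (\<nu> C) 1 \<le> 2 * \<nu> B)"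
proof -
  define S where "S = (\<lambda>C. min (\<nu> C) 1) ` {C\<in>sets M. C \<subseteq> D}"
  have bdd: "bdd_above S" by (rule bdd_aboveI[of _ 1]) (auto simp: S_def)
  have z: "0 \<in> S" using real_cadd_empty[OF nu] by (force simp: S_def intro!: image_eqI[of _ _ "{}"])
  have le: "min (\<nu> C) 1 \<le> Sup S" if "C \<in> sets M" "C \<subseteq> D" for C
    using that bdd by (intro cSup_upper) (auto simp: S_def)
  have s0: "0 \<le> Sup S" using z bdd by (rule cSup_upper)
  show ?thesis
  proof (cases "Sup S = 0")
    case True
    then show ?thesis using le real_cadd_empty[OF nu] by (intro bexI[of _ "{}"]) auto
  next
    case False
    then have "Sup S / 2 < Sup S" using s0 by simp
    moreover have "S \<noteq> {}" using z by blast
    ultimately obtain y where "y \<in> S" "Sup S / 2 < y" using less_cSup_iff[OF _ bdd] by blast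
    then obtain C where C: "C \<in> sets M" "C \<subseteq> D" "Sup S / 2 < min (\<nu> C) 1"
      unfolding S_def by blast
    have S2: "Sup S \<le> 2 * \<nu> C" and C0: "0 \<le> \<nu> C" using C(3) s0 by linarith+
    have "min (\<nu> B) 1 \<le> 2 * \<nu> C" if "B \<in> sets M" "B \<subseteq> D" for B
      using le[OF that] S2 by (rule order_trans)
    then show ?thesis using C(1,2) C0 by blast
  qed
qed

definition neg_set :: "'a measure \<Rightarrow> ('a set \<Rightarrow> real) \<Rightarrow> 'a set \<Rightarrow> bool" where
  "neg_set M \<nu> A \<longleftrightarrow> A \<in> sets M \<and> (\<forall>B\<in>sets M. B \<subseteq> A \<longrightarrow> \<nu> B \<le> 0)"

text \<open>
  Removing greedily chosen positive pieces from \<open>D\<close> can only lower the value. The pieces are disjoint, so their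
  values are summable and tend to \<open>0\<close>; hence no subset of what remains can have positive value.
\<close>

lemma ex_neg_subset:
  assumes nu: "real_cadd M \<nu>" and D: "D \<in> sets M"
  shows "\<exists>A. A \<subseteq> D \<and> neg_set M \<nu> A \<and> \<nu> A \<le> \<nu> D"
proof -
  obtain f where f: "\<And>D. D \<in> sets M \<Longrightarrow> f D \<in> sets M \<and> f D \<subseteq> D \<and> 0 \<le> \<nu> (f D) \<and>
      (\<forall>C\<in>sets M. C \<subseteq> D \<longrightarrow> min (\<nu> C) 1 \<le> 2 * \<nu> (f D))"
    using greedy_subset[OF nu] by metis
  define E where "E = rec_nat D (\<lambda>_ X. X - f X)"
  have E0: "E 0 = D" and ES: "E (Suc n) = E n - f (E n)" for n by (simp_all add: E_def)
  have Es: "E n \<in> sets M" for n by (induction n) (use D f in \<open>auto simp: E0 ES\<close>)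
  have fs: "f (E n) \<in> sets M" and f0: "0 \<le> \<nu> (f (E n))" for n using f[OF Es] by blast+
  have dec: "E m \<subseteq> E n" if "n \<le> m" for n m
    using that by (rule lift_Suc_antimono_le[rotated]) (auto simp: ES)
  have sub: "f (E m) \<subseteq> E m" for m using f Es by blast
  have disj: "disjoint_family (\<lambda>n. f (E n))"
  proof -
    have *: "f (E m) \<inter> f (E n) = {}" if "m < n" for m n
      using dec[of "Suc m" n] that sub[of n] by (auto simp: ES)
    show ?thesis unfolding disjoint_family_on_def
      by (metis * Int_commute linorder_neqE_nat)
  qed
  let ?U = "\<Union>n. f (E n)"
  have U: "?U \<in> sets M" using fs by auto
  have sums: "(\<lambda>n. \<nu> (f (E n))) sums \<nu> ?U"
    using disj fs by (intro real_caddD[OF nu]) auto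
  have U0: "0 \<le> \<nu> ?U" using sums_le[OF _ sums_zero sums] f0 by blast
  have to0: "(\<lambda>n. \<nu> (f (E n))) \<longlonglongrightarrow> 0"
    using sums summable_LIMSEQ_zero sums_summable by blast
  have UD: "?U \<subseteq> D" using sub dec[of 0] by (fastforce simp: E0)
  have inE: "D - ?U \<subseteq> E n" for n by (induction n) (auto simp: E0 ES)
  have "\<nu> C \<le> 0" if C: "C \<in> sets M" "C \<subseteq> D - ?U" for C
  proof -
    have "min (\<nu> C) 1 \<le> 2 * \<nu> (f (E n))" for n
      using f[OF Es[of n]] C(1) subset_trans[OF C(2) inE[of n]] by simp
    then have "min (\<nu> C) 1 \<le> 2 * 0"
      using tendsto_mult_left[OF to0, of 2] by (intro LIMSEQ_le_const[where X = "\<lambda>n. 2 * \<nu> (f (E n))"]) auto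
    then show ?thesis by linarith
  qed
  moreover have "\<nu> (D - ?U) \<le> \<nu> D" using real_cadd_Diff[OF nu D U UD] U0 by linarith
  ultimately show ?thesis using D U by (intro exI[of _ "D - ?U"]) (auto simp: neg_set_def)
qed

lemma neg_set_UN:
  assumes nu: "real_cadd M \<nu>" and A: "\<And>n::nat. neg_set M \<nu> (A n)"
  shows "neg_set M \<nu> (\<Union>n. A n)"
  unfolding neg_set_def
proof (intro conjI ballI impI)
  have As: "range A \<subseteq> sets M" using A by (auto simp: neg_set_def)
  then show "(\<Union>n. A n) \<in> sets M" by auto
  fix B assume B: "B \<in> sets M" "B \<subseteq> (\<Union>n. A n)"
  have dj: "range (disjointed A) \<subseteq> sets M" using As by (rule sets.range_disjointed_sets)
  have "(\<lambda>n. \<nu> (B \<inter> disjointed A n)) sums \<nu> (\<Union>n. B \<inter> disjointed A n)"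
    using dj B disjoint_family_disjointed[of A]
    by (intro real_caddD[OF nu]) (blast, unfold disjoint_family_on_def, blast)
  moreover have "(\<Union>n. B \<inter> disjointed A n) = B" using B UN_disjointed_eq[of A] by auto
  moreover have "\<nu> (B \<inter> disjointed A n) \<le> 0" for n
  proof -
    have "B \<inter> disjointed A n \<in> sets M" "B \<inter> disjointed A n \<subseteq> A n"
      using dj B(1) disjointed_subset[of A n] by auto
    then show ?thesis using A[of n] unfolding neg_set_def by simp
  qed
  ultimately show "\<nu> B \<le> 0" using sums_le[OF _ _ sums_zero] by metis
qed

text \<open>
  A negative set of least value exists, since countable unions of negative sets are negative. Its complement
  contains no set of negative value, for otherwise a negative subset of that set could be added.
\<close>

lemma Hahn_decomposition:
  assumes nu: "real_cadd M \<nu>"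
  shows "\<exists>P\<in>sets M. (\<forall>B\<in>sets M. B \<subseteq> P \<longrightarrow> 0 \<le> \<nu> B) \<and> (\<forall>B\<in>sets M. B \<inter> P = {} \<longrightarrow> \<nu> B \<le> 0)"
proof -
  \<comment> \<open>The values on negative sets are not yet known to be bounded below, but their arctangents are.\<close>
  define S where "S = (\<lambda>A. arctan (\<nu> A)) ` {A. neg_set M \<nu> A}"
  have bdd: "bdd_below S"
    by (rule bdd_belowI[of _ "-(pi/2)"]) (auto simp: S_def intro: less_imp_le arctan_lbound)
  have "neg_set M \<nu> {}" using real_cadd_empty[OF nu] by (auto simp: neg_set_def)
  then have ne: "S \<noteq> {}" by (auto simp: S_def)
  have "\<exists>A. neg_set M \<nu> A \<and> arctan (\<nu> A) < Inf S + 1 / real (Suc n)" for n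
    using cInf_lessD[OF ne, of "Inf S + 1 / real (Suc n)"] by (auto simp: S_def)
  then obtain A where A: "\<And>n. neg_set M \<nu> (A n)" "\<And>n. arctan (\<nu> (A n)) < Inf S + 1 / real (Suc n)"
    by metis
  let ?N = "\<Union>n. A n"
  have N: "neg_set M \<nu> ?N" using neg_set_UN[OF nu A(1)] .
  have Ns: "?N \<in> sets M" using N by (simp add: neg_set_def)
  have As: "A n \<in> sets M" for n using A(1)[of n] by (simp add: neg_set_def)
  have "arctan (\<nu> ?N) \<le> Inf S + 1 / real (Suc n)" for n
  proof -
    have "\<nu> ?N = \<nu> (A n) + \<nu> (?N - A n)"
      by (rule real_cadd_Diff[OF nu Ns As]) blast
    moreover have "?N - A n \<in> sets M" using Ns As by (rule sets.Diff)
    then have "\<nu> (?N - A n) \<le> 0" using N unfolding neg_set_def by (simp add: Diff_subset)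
    ultimately have "\<nu> ?N \<le> \<nu> (A n)" by linarith
    then show ?thesis using A(2)[of n] arctan_le_iff by (meson dual_order.trans less_imp_le)
  qed
  then have "arctan (\<nu> ?N) \<le> Inf S"
    by (intro LIMSEQ_le_const[where X = "\<lambda>n. Inf S + 1 / real (Suc n)"])
       (use LIMSEQ_inverse_real_of_nat_add[of "Inf S"] in \<open>auto simp: divide_inverse\<close>)
  then have min: "\<nu> ?N \<le> \<nu> B" if "neg_set M \<nu> B" for B
  proof -
    have "arctan (\<nu> B) \<in> S" using that by (auto simp: S_def)
    then have "Inf S \<le> arctan (\<nu> B)" using bdd by (rule cInf_lower)
    with \<open>arctan (\<nu> ?N) \<le> Inf S\<close> have "arctan (\<nu> ?N) \<le> arctan (\<nu> B)" by linarith
    then show ?thesis by (simp add: arctan_le_iff)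
  qed
  show ?thesis
  proof (intro bexI[of _ "space M - ?N"] conjI ballI impI)
    show "space M - ?N \<in> sets M" using N by (auto simp: neg_set_def)
    fix B assume B: "B \<in> sets M"
    show "\<nu> B \<le> 0" if "B \<inter> (space M - ?N) = {}"
    proof -
      have "B \<subseteq> ?N" using that sets.sets_into_space[OF B] by blast
      then show ?thesis using N B unfolding neg_set_def by blast
    qed
    show "0 \<le> \<nu> B" if "B \<subseteq> space M - ?N"
    proof (rule ccontr)
      assume neg: "\<not> 0 \<le> \<nu> B"
      obtain C where C: "C \<subseteq> B" "neg_set M \<nu> C" "\<nu> C \<le> \<nu> B" using ex_neg_subset[OF nu B] by blast
      have "neg_set M \<nu> (\<Union>n. case n of 0 \<Rightarrow> ?N | Suc _ \<Rightarrow> C)"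
        using N C by (intro neg_set_UN[OF nu]) (auto split: nat.split)
      moreover have "(\<Union>n. case n of 0 \<Rightarrow> ?N | Suc _ \<Rightarrow> C) = ?N \<union> C"
      proof (intro set_eqI iffI)
        fix x assume "x \<in> ?N \<union> C"
        then show "x \<in> (\<Union>n. case n of 0 \<Rightarrow> ?N | Suc _ \<Rightarrow> C)"
          using UN_I[of 0 UNIV x "\<lambda>n. case n of 0 \<Rightarrow> ?N | Suc _ \<Rightarrow> C"]
            UN_I[of "Suc 0" UNIV x "\<lambda>n. case n of 0 \<Rightarrow> ?N | Suc _ \<Rightarrow> C"] by auto
      next
        fix x assume "x \<in> (\<Union>n. case n of 0 \<Rightarrow> ?N | Suc _ \<Rightarrow> C)"
        then obtain n :: nat where "x \<in> (case n of 0 \<Rightarrow> ?N | Suc _ \<Rightarrow> C)" by blast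
        then show "x \<in> ?N \<union> C" by (cases n) auto
      qed
      ultimately have "\<nu> ?N \<le> \<nu> (?N \<union> C)" using min by simp
      also have "\<dots> = \<nu> ?N + \<nu> C"
        using N C that by (intro real_cadd_Un[OF nu]) (auto simp: neg_set_def)
      finally show False using neg C by linarith
    qed
  qed
qed

lemma ex_finite_measure:
  assumes nu: "real_cadd M \<nu>" and pos: "\<And>A. A \<in> sets M \<Longrightarrow> 0 \<le> \<nu> A"
  shows "\<exists>m. finite_measure m \<and> sets m = sets M \<and> (\<forall>A\<in>sets M. emeasure m A = ennreal (\<nu> A))"
proof -
  define m where "m = measure_of (space M) (sets M) (\<lambda>A. ennreal (\<nu> A))"
  have sm: "sets m = sets M" and sp: "space m = space M" by (simp_all add: m_def)
  have em: "emeasure m A = ennreal (\<nu> A)" if "A \<in> sets M" for A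
    unfolding m_def
  proof (rule emeasure_measure_of_sigma)
    show "sigma_algebra (space M) (sets M)" by (rule sets.sigma_algebra_axioms)
    show "positive (sets M) (\<lambda>A. ennreal (\<nu> A))"
      using real_cadd_empty[OF nu] by (simp add: positive_def)
    show "countably_additive (sets M) (\<lambda>A. ennreal (\<nu> A))"
    proof (rule countably_additiveI)
      fix A :: "nat \<Rightarrow> 'a set"
      assume A: "range A \<subseteq> sets M" "disjoint_family A"
      have "(\<lambda>i. ennreal (\<nu> (A i))) sums ennreal (\<nu> (\<Union>i. A i))"
        using real_caddD[OF nu A] A(1) pos by (subst sums_ennreal) auto
      then show "(\<Sum>i. ennreal (\<nu> (A i))) = ennreal (\<nu> (\<Union>i. A i))" by (simp add: sums_iff)
    qed
  qed (use that in auto)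
  have "finite_measure m" by (rule finite_measureI) (auto simp: sp em)
  then show ?thesis using sm em by blast
qed

lemma Jordan_exists:
  assumes nu: "\<nu> \<in> signed_measures \<Omega>"
  shows "\<exists>m1 m2. is_jordan_decomposition \<Omega> \<nu> m1 m2"
proof -
  let ?M = "borel_on \<Omega>"
  have ca: "real_cadd ?M \<nu>" using nu by (auto simp: signed_measures_def real_cadd_def)
  from Hahn_decomposition[OF ca] obtain P where P1: "P \<in> sets ?M"
    "\<forall>B\<in>sets ?M. B \<subseteq> P \<longrightarrow> 0 \<le> \<nu> B" "\<forall>B\<in>sets ?M. B \<inter> P = {} \<longrightarrow> \<nu> B \<le> 0"
    by (elim bexE conjE)
  have P: "P \<in> sets ?M" "\<And>B. B \<in> sets ?M \<Longrightarrow> B \<subseteq> P \<Longrightarrow> 0 \<le> \<nu> B"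
     "\<And>B. B \<in> sets ?M \<Longrightarrow> B \<inter> P = {} \<Longrightarrow> \<nu> B \<le> 0"
    using P1 by simp_all
  have ca1: "real_cadd ?M (\<lambda>A. \<nu> (A \<inter> P))" unfolding real_cadd_def
  proof (intro allI impI)
    fix A :: "nat \<Rightarrow> 'a set" assume "range A \<subseteq> sets ?M" "disjoint_family A"
    then have "(\<lambda>i. \<nu> (A i \<inter> P)) sums \<nu> (\<Union>i. A i \<inter> P)"
      using P(1) by (intro real_caddD[OF ca]) (auto simp: disjoint_family_on_def)
    then show "(\<lambda>i. \<nu> (A i \<inter> P)) sums \<nu> (\<Union> (range A) \<inter> P)" by simp
  qed
  have ca2: "real_cadd ?M (\<lambda>A. - \<nu> (A - P))" unfolding real_cadd_def
  proof (intro allI impI)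
    fix A :: "nat \<Rightarrow> 'a set" assume "range A \<subseteq> sets ?M" "disjoint_family A"
    then have "(\<lambda>i. \<nu> (A i - P)) sums \<nu> (\<Union>i. A i - P)"
      using P(1) by (intro real_caddD[OF ca]) (auto simp: disjoint_family_on_def)
    then show "(\<lambda>i. - \<nu> (A i - P)) sums - \<nu> (\<Union> (range A) - P)" by (simp add: sums_minus)
  qed
  obtain m1 where m1: "finite_measure m1" "sets m1 = sets ?M" "\<And>A. A \<in> sets ?M \<Longrightarrow> emeasure m1 A = ennreal (\<nu> (A \<inter> P))"
    using ex_finite_measure[OF ca1] P by auto
  have p2: "0 \<le> - \<nu> (A - P)" if "A \<in> sets ?M" for A
    using P(3)[of "A - P"] P(1) that by auto
  obtain m2 where m2: "finite_measure m2" "sets m2 = sets ?M" "\<And>A. A \<in> sets ?M \<Longrightarrow> emeasure m2 A = ennreal (- \<nu> (A - P))"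
    using ex_finite_measure[OF ca2 p2] by auto
  have "\<nu> A = measure m1 A - measure m2 A" if A: "A \<in> sets ?M" for A
    using m1(3)[OF A] m2(3)[OF A] p2[OF A] P(2)[of "A \<inter> P"] P(1) A real_cadd_split[OF ca A P(1)]
    by (simp add: measure_def)
  moreover have "emeasure m1 (\<Omega> - P) = 0" "emeasure m2 P = 0"
  proof -
    have "\<Omega> - P \<in> sets ?M" using sets.compl_sets[OF P(1)] by simp
    moreover have "(\<Omega> - P) \<inter> P = {}" "P - P = {}" by auto
    ultimately show "emeasure m1 (\<Omega> - P) = 0" "emeasure m2 P = 0"
      using m1(3)[of "\<Omega> - P"] m2(3)[OF P(1)] real_cadd_empty[OF ca] by simp_all
  qed
  ultimately show ?thesis using m1 m2 P(1)
    by (intro exI[of _ m1] exI[of _ m2]) (auto simp: is_jordan_decomposition_def)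
qed

text \<open>
  Each part is a value of \<open>\<nu>\<close> on a subset of \<open>A\<close>. Together with the bounds of the next lemma it is the largest
  such value, which determines the decomposition and gives the total variation as a maximum.
\<close>

lemma Jordan_pos_upper:
  assumes J: "is_jordan_decomposition \<Omega> \<nu> m1 m2" and A: "A \<in> sets (borel_on \<Omega>)"
  shows "\<exists>B\<in>sets (borel_on \<Omega>). B \<subseteq> A \<and> measure m1 A = \<nu> B \<and> measure m2 A = - \<nu> (A - B)"
proof -
  interpret m1: finite_measure m1 using J by (simp add: is_jordan_decomposition_def)
  interpret m2: finite_measure m2 using J by (simp add: is_jordan_decomposition_def)
  obtain P where P: "P \<in> sets (borel_on \<Omega>)" "emeasure m1 (\<Omega> - P) = 0" "emeasure m2 P = 0"
    using J by (auto simp: is_jordan_decomposition_def)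
  have s: "sets m1 = sets (borel_on \<Omega>)" "sets m2 = sets (borel_on \<Omega>)"
    "\<And>A. A \<in> sets (borel_on \<Omega>) \<Longrightarrow> \<nu> A = measure m1 A - measure m2 A"
    using J by (auto simp: is_jordan_decomposition_def)
  have OP: "\<Omega> - P \<in> sets (borel_on \<Omega>)" using sets.compl_sets[OF P(1)] by simp
  have AO: "A \<subseteq> \<Omega>" using sets.sets_into_space[OF A] by simp
  have z: "measure m1 (A - P) = 0" "measure m2 (A \<inter> P) = 0"
  proof -
    have "emeasure m1 (A - P) = 0" by (rule emeasure_eq_0[OF _ P(2)]) (use AO OP s in auto)
    moreover have "emeasure m2 (A \<inter> P) = 0" by (rule emeasure_eq_0[OF _ P(3)]) (use P s in auto)
    ultimately show "measure m1 (A - P) = 0" "measure m2 (A \<inter> P) = 0" by (simp_all add: measure_def)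
  qed
  have e1: "measure m1 A = measure m1 (A \<inter> P) + measure m1 (A - P)"
    using m1.finite_measure_Diff'[of A P] A P s by auto
  have e2: "measure m2 A = measure m2 (A \<inter> P) + measure m2 (A - P)"
    using m2.finite_measure_Diff'[of A P] A P s by auto
  have x: "A - A \<inter> P = A - P" by auto
  have "measure m1 A = \<nu> (A \<inter> P)" "measure m2 A = - \<nu> (A - A \<inter> P)"
    unfolding x using e1 e2 z s(3)[of "A \<inter> P"] s(3)[of "A - P"] A P by auto
  then show ?thesis using A P by (intro bexI[of _ "A \<inter> P"]) auto
qed

lemma Jordan_bounds:
  assumes J: "is_jordan_decomposition \<Omega> \<nu> m1 m2" and A: "A \<in> sets (borel_on \<Omega>)"
    and B: "B \<in> sets (borel_on \<Omega>)" "B \<subseteq> A"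
  shows "\<nu> B \<le> measure m1 A" "- \<nu> B \<le> measure m2 A"
proof -
  interpret m1: finite_measure m1 using J by (simp add: is_jordan_decomposition_def)
  interpret m2: finite_measure m2 using J by (simp add: is_jordan_decomposition_def)
  have s: "sets m1 = sets (borel_on \<Omega>)" "sets m2 = sets (borel_on \<Omega>)"
    "\<And>A. A \<in> sets (borel_on \<Omega>) \<Longrightarrow> \<nu> A = measure m1 A - measure m2 A"
    using J by (auto simp: is_jordan_decomposition_def)
  have "measure m1 B \<le> measure m1 A" "measure m2 B \<le> measure m2 A"
    using A B s by (auto intro: m1.finite_measure_mono m2.finite_measure_mono)
  then show "\<nu> B \<le> measure m1 A" "- \<nu> B \<le> measure m2 A"
    using s(3)[OF B(1)] measure_nonneg[of m1 B] measure_nonneg[of m2 B] by linarith+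
qed

lemma Jordan_unique:
  assumes "is_jordan_decomposition \<Omega> \<nu> m1 m2" "is_jordan_decomposition \<Omega> \<nu> n1 n2"
  shows "m1 = n1 \<and> m2 = n2"
proof -
  have le: "measure m1 A \<le> measure n1 A \<and> measure m2 A \<le> measure n2 A"
    if J: "is_jordan_decomposition \<Omega> \<nu> m1 m2" "is_jordan_decomposition \<Omega> \<nu> n1 n2"
      "A \<in> sets (borel_on \<Omega>)" for m1 m2 n1 n2 A
  proof -
    obtain B where B: "B \<in> sets (borel_on \<Omega>)" "B \<subseteq> A" "measure m1 A = \<nu> B" "measure m2 A = - \<nu> (A - B)"
      using Jordan_pos_upper[OF J(1,3)] by blast
    show ?thesis using Jordan_bounds[OF J(2,3) B(1,2)] Jordan_bounds[OF J(2,3), of "A - B"] B J(3) by auto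
  qed
  have s: "finite_measure m1" "finite_measure m2" "finite_measure n1" "finite_measure n2"
    "sets m1 = sets (borel_on \<Omega>)" "sets m2 = sets (borel_on \<Omega>)"
    "sets n1 = sets (borel_on \<Omega>)" "sets n2 = sets (borel_on \<Omega>)"
    using assms by (auto simp: is_jordan_decomposition_def)
  have "m1 = n1"
    by (rule measure_eqI) (use s le[OF assms] le[OF assms(2,1)] in \<open>auto simp: finite_measure.emeasure_eq_measure intro!: antisym\<close>)
  moreover have "m2 = n2"
    by (rule measure_eqI) (use s le[OF assms] le[OF assms(2,1)] in \<open>auto simp: finite_measure.emeasure_eq_measure intro!: antisym\<close>)
  ultimately show ?thesis ..
qed

lemma jordan_parts_eq:
  assumes "is_jordan_decomposition \<Omega> \<nu> m1 m2"
  shows "pos_part \<Omega> \<nu> = m1" "neg_part \<Omega> \<nu> = m2"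
proof -
  have "jordan_parts \<Omega> \<nu> = (m1, m2)"
    unfolding jordan_parts_def
  proof (rule the_equality)
    fix m assume "is_jordan_decomposition \<Omega> \<nu> (fst m) (snd m)"
    from Jordan_unique[OF assms this] show "m = (m1, m2)" by (metis prod.collapse)
  qed (simp add: assms)
  then show "pos_part \<Omega> \<nu> = m1" "neg_part \<Omega> \<nu> = m2" by (simp_all add: pos_part_def neg_part_def)
qed

lemma Jordan_parts:
  assumes "\<nu> \<in> signed_measures \<Omega>"
  shows "is_jordan_decomposition \<Omega> \<nu> (pos_part \<Omega> \<nu>) (neg_part \<Omega> \<nu>)"
  using Jordan_exists[OF assms] jordan_parts_eq by metis


lemma signed_measures_real_cadd: "\<nu> \<in> signed_measures \<Omega> \<Longrightarrow> real_cadd (borel_on \<Omega>) \<nu>"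
  by (auto simp: signed_measures_def real_cadd_def)

lemma signed_measures_outside: "\<nu> \<in> signed_measures \<Omega> \<Longrightarrow> A \<notin> sets (borel_on \<Omega>) \<Longrightarrow> \<nu> A = 0"
  by (simp add: signed_measures_def)

lemma signed_measures_eqI:
  assumes "\<nu>1 \<in> signed_measures \<Omega>" "\<nu>2 \<in> signed_measures \<Omega>"
    and "\<And>A. A \<in> sets (borel_on \<Omega>) \<Longrightarrow> \<nu>1 A = \<nu>2 A"
  shows "\<nu>1 = \<nu>2"
  using assms signed_measures_outside by (metis ext)

lemma signed_measures_lincomb:
  assumes "\<nu>1 \<in> signed_measures \<Omega>" "\<nu>2 \<in> signed_measures \<Omega>"
  shows "(\<lambda>A. c1 * \<nu>1 A + c2 * \<nu>2 A) \<in> signed_measures \<Omega>"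
  using assms unfolding signed_measures_def by (auto intro!: sums_add sums_mult)

lemma signed_measures_scale:
  assumes "\<nu> \<in> signed_measures \<Omega>" shows "(\<lambda>A. c * \<nu> A) \<in> signed_measures \<Omega>"
  using signed_measures_lincomb[OF assms assms, of c 0] by simp

lemma signed_measures_add:
  assumes "\<nu>1 \<in> signed_measures \<Omega>" "\<nu>2 \<in> signed_measures \<Omega>"
  shows "(\<lambda>A. \<nu>1 A + \<nu>2 A) \<in> signed_measures \<Omega>"
  using signed_measures_lincomb[OF assms, of 1 1] by simp

lemma signed_measures_diff:
  assumes "\<nu>1 \<in> signed_measures \<Omega>" "\<nu>2 \<in> signed_measures \<Omega>"
  shows "(\<lambda>A. \<nu>1 A - \<nu>2 A) \<in> signed_measures \<Omega>"
  using signed_measures_lincomb[OF assms, of 1 "-1"] by simp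

definition fin_meas :: "'a::topological_space set \<Rightarrow> 'a measure \<Rightarrow> bool" where
  "fin_meas \<Omega> m \<longleftrightarrow> finite_measure m \<and> sets m = sets (borel_on \<Omega>)"

lemma fin_measD:
  assumes "fin_meas \<Omega> m"
  shows "finite_measure m" "sets m = sets (borel_on \<Omega>)" "space m = \<Omega>"
  using assms sets_eq_imp_space_eq[of m "borel_on \<Omega>"] by (simp_all add: fin_meas_def)

lemma fin_meas_signed:
  assumes "fin_meas \<Omega> m" shows "measure m \<in> signed_measures \<Omega>"
proof -
  interpret finite_measure m using assms by (rule fin_measD)
  show ?thesis unfolding signed_measures_def
    using fin_measD[OF assms] finite_measure_UNION by (auto simp: measure_notin_sets)
qed

lemma fin_meas_diff_signed:
  assumes "fin_meas \<Omega> m1" "fin_meas \<Omega> m2"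
  shows "(\<lambda>A. measure m1 A - measure m2 A) \<in> signed_measures \<Omega>"
  using assms by (intro signed_measures_diff fin_meas_signed)

lemma fin_meas_parts:
  assumes "\<nu> \<in> signed_measures \<Omega>"
  shows "fin_meas \<Omega> (pos_part \<Omega> \<nu>)" "fin_meas \<Omega> (neg_part \<Omega> \<nu>)"
  using Jordan_parts[OF assms] by (simp_all add: is_jordan_decomposition_def fin_meas_def)

lemma parts_eq:
  assumes "\<nu> \<in> signed_measures \<Omega>"
  shows "\<nu> A = measure (pos_part \<Omega> \<nu>) A - measure (neg_part \<Omega> \<nu>) A"
proof (cases "A \<in> sets (borel_on \<Omega>)")
  case True then show ?thesis using Jordan_parts[OF assms] by (simp add: is_jordan_decomposition_def)
next
  case False then show ?thesis
    using fin_meas_parts[OF assms] signed_measures_outside[OF assms]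
    by (simp add: fin_meas_def measure_notin_sets)
qed

section \<open>Total variation\<close>

definition tv :: "'a::topological_space set \<Rightarrow> ('a set \<Rightarrow> real) \<Rightarrow> 'a set \<Rightarrow> real" where
  "tv \<Omega> \<nu> A = measure (pos_part \<Omega> \<nu>) A + measure (neg_part \<Omega> \<nu>) A"

lemma tv_nonneg: "0 \<le> tv \<Omega> \<nu> A" by (simp add: tv_def)

lemma total_variation_eq_tv:
  assumes "\<nu> \<in> signed_measures \<Omega>" shows "total_variation \<Omega> \<nu> A = ennreal (tv \<Omega> \<nu> A)"
  using fin_meas_parts[OF assms]
  by (simp add: total_variation_def tv_def fin_meas_def finite_measure.emeasure_eq_measure)

text \<open>
  Upper and lower estimates of the total variation all go through the extremal set \<open>E\<close>: it suffices to control
  \<open>\<nu> E - \<nu> (A - E)\<close> for Borel \<open>E\<close>.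
\<close>

lemma tv_attained:
  assumes nu: "\<nu> \<in> signed_measures \<Omega>" and A: "A \<in> sets (borel_on \<Omega>)"
  obtains E where "E \<in> sets (borel_on \<Omega>)" "E \<subseteq> A" "tv \<Omega> \<nu> A = \<nu> E - \<nu> (A - E)"
  using Jordan_pos_upper[OF Jordan_parts[OF nu] A] unfolding tv_def by fastforce

lemma tv_le:
  assumes nu: "\<nu> \<in> signed_measures \<Omega>" and A: "A \<in> sets (borel_on \<Omega>)"
    and "\<And>E. E \<in> sets (borel_on \<Omega>) \<Longrightarrow> E \<subseteq> A \<Longrightarrow> \<nu> E - \<nu> (A - E) \<le> c"
  shows "tv \<Omega> \<nu> A \<le> c"
  using tv_attained[OF nu A] assms(3) by metis

lemma tv_ge:
  assumes nu: "\<nu> \<in> signed_measures \<Omega>" and A: "A \<in> sets (borel_on \<Omega>)"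
    and E: "E \<in> sets (borel_on \<Omega>)" "E \<subseteq> A"
  shows "\<nu> E - \<nu> (A - E) \<le> tv \<Omega> \<nu> A"
proof -
  have AE: "A - E \<in> sets (borel_on \<Omega>)" "A - E \<subseteq> A" using A E by auto
  show ?thesis
    using Jordan_bounds(1)[OF Jordan_parts[OF nu] A E] Jordan_bounds(2)[OF Jordan_parts[OF nu] A AE]
    by (simp add: tv_def)
qed

lemma tv_lincomb_le:
  assumes nu: "\<nu>1 \<in> signed_measures \<Omega>" "\<nu>2 \<in> signed_measures \<Omega>" and A: "A \<in> sets (borel_on \<Omega>)"
  shows "tv \<Omega> (\<lambda>A. c1 * \<nu>1 A + c2 * \<nu>2 A) A \<le> \<bar>c1\<bar> * tv \<Omega> \<nu>1 A + \<bar>c2\<bar> * tv \<Omega> \<nu>2 A"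
proof (rule tv_le[OF signed_measures_lincomb[OF nu] A])
  have b: "c * (\<nu> E - \<nu> (A - E)) \<le> \<bar>c\<bar> * tv \<Omega> \<nu> A"
    if "E \<in> sets (borel_on \<Omega>)" "E \<subseteq> A" "\<nu> \<in> signed_measures \<Omega>" for c \<nu> E
  proof -
    have "A - (A - E) = E" "A - E \<in> sets (borel_on \<Omega>)" using that A by auto
    then have "\<bar>\<nu> E - \<nu> (A - E)\<bar> \<le> tv \<Omega> \<nu> A"
      using tv_ge[OF that(3) A that(1,2)] tv_ge[OF that(3) A, of "A - E"] by auto
    then have "\<bar>c\<bar> * \<bar>\<nu> E - \<nu> (A - E)\<bar> \<le> \<bar>c\<bar> * tv \<Omega> \<nu> A" by (simp add: mult_left_mono)
    then show ?thesis by (metis abs_ge_self abs_mult order_trans)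
  qed
  fix E assume E: "E \<in> sets (borel_on \<Omega>)" "E \<subseteq> A"
  show "c1 * \<nu>1 E + c2 * \<nu>2 E - (c1 * \<nu>1 (A - E) + c2 * \<nu>2 (A - E)) \<le> \<bar>c1\<bar> * tv \<Omega> \<nu>1 A + \<bar>c2\<bar> * tv \<Omega> \<nu>2 A"
    using b[OF E nu(1), of c1] b[OF E nu(2), of c2] by (simp add: algebra_simps)
qed

lemma compact_in_borel_on:
  fixes K :: "'a::t2_space set"
  assumes "compact K" "K \<subseteq> \<Omega>" shows "K \<in> sets (borel_on \<Omega>)"
proof -
  have "K = \<Omega> \<inter> K" using assms by auto
  then show ?thesis using compact_imp_closed[OF assms(1)] by (auto simp: sets_restrict_space)
qed

lemma radon_signed: "\<nu> \<in> radon_measures \<Omega> \<Longrightarrow> \<nu> \<in> signed_measures \<Omega>"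
  by (simp add: radon_measures_def)

lemma radon_tv_dominated:
  fixes \<Omega> :: "'a::t2_space set"
  assumes mu: "\<mu> \<in> radon_measures \<Omega>" and nu: "\<nu> \<in> signed_measures \<Omega>"
    and le: "\<And>A. A \<in> sets (borel_on \<Omega>) \<Longrightarrow> tv \<Omega> \<nu> A \<le> C * tv \<Omega> \<mu> A"
  shows "\<nu> \<in> radon_measures \<Omega>"
  unfolding radon_measures_def
proof (safe intro!: nu)
  fix A e assume A: "A \<in> sets (borel_on \<Omega>)" and e: "(0::real) < e"
  have "0 < e / (\<bar>C\<bar> + 1)" using e by simp
  then obtain K where K: "compact K" "K \<subseteq> A" "total_variation \<Omega> \<mu> (A - K) \<le> ennreal (e / (\<bar>C\<bar> + 1))"
    using mu A unfolding radon_measures_def by blast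
  have "K \<subseteq> \<Omega>" using K(2) sets.sets_into_space[OF A] by simp
  then have AK: "A - K \<in> sets (borel_on \<Omega>)" using A compact_in_borel_on[OF K(1)] by auto
  have "tv \<Omega> \<mu> (A - K) \<le> e / (\<bar>C\<bar> + 1)"
    using K(3) e by (simp add: total_variation_eq_tv[OF radon_signed[OF mu]])
  then have "(\<bar>C\<bar> + 1) * tv \<Omega> \<mu> (A - K) \<le> e" by (simp add: field_simps add_pos_nonneg)
  moreover have "C * tv \<Omega> \<mu> (A - K) \<le> (\<bar>C\<bar> + 1) * tv \<Omega> \<mu> (A - K)"
    by (intro mult_right_mono tv_nonneg) linarith
  ultimately have "tv \<Omega> \<nu> (A - K) \<le> e" using le[OF AK] by linarith
  then have "total_variation \<Omega> \<nu> (A - K) \<le> ennreal e"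
    by (simp add: total_variation_eq_tv[OF nu] ennreal_leI)
  then show "\<exists>K. compact K \<and> K \<subseteq> A \<and> total_variation \<Omega> \<nu> (A - K) \<le> ennreal e"
    using K by blast
qed

lemma radon_scale:
  fixes \<Omega> :: "'a::t2_space set"
  assumes mu: "\<mu> \<in> radon_measures \<Omega>" shows "(\<lambda>A. c * \<mu> A) \<in> radon_measures \<Omega>"
  using tv_lincomb_le[OF radon_signed[OF mu] radon_signed[OF mu], of _ c 0]
  by (intro radon_tv_dominated[OF mu signed_measures_scale[OF radon_signed[OF mu]], of c "\<bar>c\<bar>"]) simp

lemma finite_support_radon:
  fixes \<Omega> :: "'a::t2_space set"
  assumes nu: "\<nu> \<in> signed_measures \<Omega>" and F: "finite F"
    and z: "\<And>E. E \<in> sets (borel_on \<Omega>) \<Longrightarrow> E \<inter> F = {} \<Longrightarrow> \<nu> E = 0"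
  shows "\<nu> \<in> radon_measures \<Omega>"
  unfolding radon_measures_def
proof (safe intro!: nu)
  fix A e assume A: "A \<in> sets (borel_on \<Omega>)" and e: "(0::real) < e"
  have K: "compact (A \<inter> F)" using F by (simp add: finite_imp_compact)
  have "A \<inter> F \<subseteq> \<Omega>" using sets.sets_into_space[OF A] by auto
  then have AK: "A - A \<inter> F \<in> sets (borel_on \<Omega>)" using A compact_in_borel_on[OF K] by auto
  have "tv \<Omega> \<nu> (A - A \<inter> F) \<le> 0"
  proof (rule tv_le[OF nu AK])
    fix E assume E: "E \<in> sets (borel_on \<Omega>)" "E \<subseteq> A - A \<inter> F"
    have "\<nu> E = 0" using E by (intro z) auto
    moreover have "\<nu> (A - A \<inter> F - E) = 0" using E AK by (intro z) auto
    ultimately show "\<nu> E - \<nu> (A - A \<inter> F - E) \<le> 0" by simp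
  qed
  then have "total_variation \<Omega> \<nu> (A - A \<inter> F) \<le> ennreal e"
    using e by (auto simp: total_variation_eq_tv[OF nu] intro: ennreal_leI)
  then show "\<exists>K. compact K \<and> K \<subseteq> A \<and> total_variation \<Omega> \<nu> (A - K) \<le> ennreal e"
    using K by (intro exI[of _ "A \<inter> F"]) auto
qed

section \<open>Sums of measures and integration against a signed measure\<close>

definition add_measure :: "'a measure \<Rightarrow> 'a measure \<Rightarrow> 'a measure" where
  "add_measure M N = measure_of (space M) (sets M) (\<lambda>A. emeasure M A + emeasure N A)"

lemma sets_add_measure [simp]: "sets (add_measure M N) = sets M"
  and space_add_measure [simp]: "space (add_measure M N) = space M"
  by (simp_all add: add_measure_def)

lemma emeasure_add_measure:
  assumes s: "sets N = sets M"
  shows "emeasure (add_measure M N) A = emeasure M A + emeasure N A"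
proof (cases "A \<in> sets M")
  case True
  have "countably_additive (sets M) (\<lambda>A. emeasure M A + emeasure N A)"
  proof (rule countably_additiveI)
    fix A :: "nat \<Rightarrow> 'a set" assume "range A \<subseteq> sets M" "disjoint_family A"
    then show "(\<Sum>i. emeasure M (A i) + emeasure N (A i)) = emeasure M (\<Union> (range A)) + emeasure N (\<Union> (range A))"
      using suminf_emeasure[of A M] suminf_emeasure[of A N] by (simp add: suminf_add[symmetric] s)
  qed
  then show ?thesis using True
    unfolding add_measure_def
    by (intro emeasure_measure_of_sigma) (auto simp: positive_def sets.sigma_algebra_axioms)
next
  case False then show ?thesis by (simp add: emeasure_notin_sets s)
qed

lemma borel_measurable_sets_cong:
  "f \<in> measurable M L \<Longrightarrow> sets N = sets M \<Longrightarrow> f \<in> measurable N L"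
  using measurable_cong_sets[of N M L L] by blast

lemma nn_integral_add_measure:
  assumes s: "sets N = sets M" and f: "f \<in> borel_measurable M"
  shows "(\<integral>\<^sup>+x. f x \<partial>add_measure M N) = (\<integral>\<^sup>+x. f x \<partial>M) + (\<integral>\<^sup>+x. f x \<partial>N)"
  using f
proof (induction rule: borel_measurable_induct)
  case (cong f g)
  have "space N = space M" using s by (rule sets_eq_imp_space_eq)
  then show ?case using cong
      nn_integral_cong[of "add_measure M N" f g] nn_integral_cong[of M f g] nn_integral_cong[of N f g]
    by simp
next
  case (set A)
  then show ?case by (simp add: emeasure_add_measure s)
next
  case (mult u c)
  have "u \<in> borel_measurable (add_measure M N)" "u \<in> borel_measurable N"
    using borel_measurable_sets_cong[OF mult(2)] s by simp_all
  then show ?case using mult by (simp add: nn_integral_cmult distrib_left)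
next
  case (add u v)
  have "u \<in> borel_measurable (add_measure M N)" "u \<in> borel_measurable N"
    "v \<in> borel_measurable (add_measure M N)" "v \<in> borel_measurable N"
    by (rule borel_measurable_sets_cong[where M = M], use add s in simp_all)+
  then show ?case using add by (simp add: nn_integral_add ac_simps)
next
  case (seq U)
  have m: "U i \<in> borel_measurable (add_measure M N)" "U i \<in> borel_measurable N" for i
    using borel_measurable_sets_cong[OF seq(1)] s by simp_all
  have inc: "incseq (\<lambda>i. \<integral>\<^sup>+x. U i x \<partial>M)" "incseq (\<lambda>i. \<integral>\<^sup>+x. U i x \<partial>N)"
    using \<open>incseq U\<close> by (auto simp: incseq_def le_fun_def intro!: nn_integral_mono)
  have S: "(SUP i. U i) = (\<lambda>x. SUP i. U i x)" by (auto simp: fun_eq_iff image_comp)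
  show ?case
    unfolding S
    using m seq(1) \<open>incseq U\<close> seq inc
    by (simp add: nn_integral_monotone_convergence_SUP ennreal_SUP_add[symmetric])
qed

lemma integral_add_measure:
  fixes f :: "'a \<Rightarrow> real"
  assumes s: "sets N = sets M" and f: "integrable M f" "integrable N f"
  shows "integrable (add_measure M N) f"
    "(\<integral>x. f x \<partial>add_measure M N) = (\<integral>x. f x \<partial>M) + (\<integral>x. f x \<partial>N)"
proof -
  have m: "f \<in> borel_measurable M" using f by auto
  then have m': "f \<in> borel_measurable (add_measure M N)"
    by (rule borel_measurable_sets_cong) simp
  have fin: "(\<integral>\<^sup>+x. ennreal (norm (f x)) \<partial>M) < \<infinity>" "(\<integral>\<^sup>+x. ennreal (norm (f x)) \<partial>N) < \<infinity>"
    using f by (auto simp: integrable_iff_bounded)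
  show i: "integrable (add_measure M N) f"
    unfolding integrable_iff_bounded using m m' fin by (simp add: nn_integral_add_measure[OF s])
  have fp: "(\<integral>\<^sup>+x. ennreal (f x) \<partial>M) < \<infinity>" "(\<integral>\<^sup>+x. ennreal (f x) \<partial>N) < \<infinity>"
    "(\<integral>\<^sup>+x. ennreal (- f x) \<partial>M) < \<infinity>" "(\<integral>\<^sup>+x. ennreal (- f x) \<partial>N) < \<infinity>"
    by (rule le_less_trans[OF nn_integral_mono fin(1)] le_less_trans[OF nn_integral_mono fin(2)];
        simp add: ennreal_leI)+
  show "(\<integral>x. f x \<partial>add_measure M N) = (\<integral>x. f x \<partial>M) + (\<integral>x. f x \<partial>N)"
    unfolding real_lebesgue_integral_def[OF i] real_lebesgue_integral_def[OF f(1)] real_lebesgue_integral_def[OF f(2)]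
    using m fp by (simp add: nn_integral_add_measure[OF s] enn2real_plus less_top)
qed

lemma fin_meas_add: assumes "fin_meas \<Omega> m1" "fin_meas \<Omega> m2" shows "fin_meas \<Omega> (add_measure m1 m2)"
proof -
  interpret m1: finite_measure m1 using assms by (simp add: fin_meas_def)
  interpret m2: finite_measure m2 using assms by (simp add: fin_meas_def)
  show ?thesis
    unfolding fin_meas_def using assms
    by (auto simp: fin_meas_def emeasure_add_measure m1.emeasure_eq_measure m2.emeasure_eq_measure
        ennreal_plus[symmetric] simp del: ennreal_plus intro!: finite_measureI)
qed

lemma measure_add_measure:
  assumes "fin_meas \<Omega> m1" "fin_meas \<Omega> m2"
  shows "measure (add_measure m1 m2) A = measure m1 A + measure m2 A"
proof -
  interpret m1: finite_measure m1 using assms by (simp add: fin_meas_def)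
  interpret m2: finite_measure m2 using assms by (simp add: fin_meas_def)
  have "emeasure (add_measure m1 m2) A = ennreal (measure m1 A + measure m2 A)"
    using assms by (simp add: fin_meas_def emeasure_add_measure m1.emeasure_eq_measure m2.emeasure_eq_measure)
  then show ?thesis by (intro measure_eq_emeasure_eq_ennreal add_nonneg_nonneg measure_nonneg)
qed

lemma fin_meas_null: "fin_meas \<Omega> (null_measure (borel_on \<Omega>))"
  by (auto simp: fin_meas_def intro: finite_measureI)

definition sint :: "'a::topological_space set \<Rightarrow> ('a set \<Rightarrow> real) \<Rightarrow> ('a \<Rightarrow> real) \<Rightarrow> real" where
  "sint \<Omega> \<nu> f = (\<integral>x. f x \<partial>pos_part \<Omega> \<nu>) - (\<integral>x. f x \<partial>neg_part \<Omega> \<nu>)"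

definition bdd_meas :: "'a::topological_space set \<Rightarrow> ('a \<Rightarrow> real) \<Rightarrow> bool" where
  "bdd_meas \<Omega> f \<longleftrightarrow> f \<in> borel_measurable (borel_on \<Omega>) \<and> (\<exists>C. \<forall>x\<in>\<Omega>. \<bar>f x\<bar> \<le> C)"

lemma bdd_meas_integrable:
  assumes "fin_meas \<Omega> m" "bdd_meas \<Omega> f" shows "integrable m f"
proof -
  interpret finite_measure m using assms by (simp add: fin_meas_def)
  obtain C where C: "\<forall>x\<in>\<Omega>. \<bar>f x\<bar> \<le> C" using assms by (auto simp: bdd_meas_def)
  show ?thesis
    using assms C fin_measD(3)[OF assms(1)]
    by (intro integrable_const_bound[where B = C] AE_I2)
       (auto simp: bdd_meas_def fin_meas_def cong: measurable_cong_sets)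
qed

text \<open>
  The integral does not depend on the representation as a difference of two positive measures, because moving the
  subtracted measures to the other side yields the same sum of measures. Linearity in the measure is a special case.
\<close>

lemma sint_eq:
  assumes nu: "\<nu> \<in> signed_measures \<Omega>" and m: "fin_meas \<Omega> m1" "fin_meas \<Omega> m2"
    and eq: "\<And>A. A \<in> sets (borel_on \<Omega>) \<Longrightarrow> \<nu> A = measure m1 A - measure m2 A"
    and f: "bdd_meas \<Omega> f"
  shows "sint \<Omega> \<nu> f = (\<integral>x. f x \<partial>m1) - (\<integral>x. f x \<partial>m2)"
proof -
  let ?p = "pos_part \<Omega> \<nu>" and ?n = "neg_part \<Omega> \<nu>"
  note pn = fin_meas_parts[OF nu]
  have "add_measure ?p m2 = add_measure ?n m1"
  proof (rule measure_eqI)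
    show "sets (add_measure ?p m2) = sets (add_measure ?n m1)" using pn by (simp add: fin_meas_def)
    fix A assume "A \<in> sets (add_measure ?p m2)"
    then have A: "A \<in> sets (borel_on \<Omega>)" using pn by (simp add: fin_meas_def)
    have "measure (add_measure ?p m2) A = measure (add_measure ?n m1) A"
      using eq[OF A] parts_eq[OF nu, of A] by (simp add: measure_add_measure[of \<Omega>] pn m)
    then show "emeasure (add_measure ?p m2) A = emeasure (add_measure ?n m1) A"
      using fin_meas_add[OF pn(1) m(2)] fin_meas_add[OF pn(2) m(1)]
      by (simp add: fin_meas_def finite_measure.emeasure_eq_measure)
  qed
  then have "(\<integral>x. f x \<partial>?p) + (\<integral>x. f x \<partial>m2) = (\<integral>x. f x \<partial>?n) + (\<integral>x. f x \<partial>m1)"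
    using integral_add_measure(2)[OF _ bdd_meas_integrable[OF pn(1) f] bdd_meas_integrable[OF m(2) f]]
      integral_add_measure(2)[OF _ bdd_meas_integrable[OF pn(2) f] bdd_meas_integrable[OF m(1) f]] pn m
    by (simp add: fin_meas_def)
  then show ?thesis by (simp add: sint_def)
qed

lemma sint_add:
  assumes nu: "\<nu>1 \<in> signed_measures \<Omega>" "\<nu>2 \<in> signed_measures \<Omega>" and f: "bdd_meas \<Omega> f"
  shows "sint \<Omega> (\<lambda>A. \<nu>1 A + \<nu>2 A) f = sint \<Omega> \<nu>1 f + sint \<Omega> \<nu>2 f"
proof -
  let ?p = "add_measure (pos_part \<Omega> \<nu>1) (pos_part \<Omega> \<nu>2)"
  let ?n = "add_measure (neg_part \<Omega> \<nu>1) (neg_part \<Omega> \<nu>2)"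
  note pn = fin_meas_parts[OF nu(1)] fin_meas_parts[OF nu(2)]
  have "sint \<Omega> (\<lambda>A. \<nu>1 A + \<nu>2 A) f = (\<integral>x. f x \<partial>?p) - (\<integral>x. f x \<partial>?n)"
    by (rule sint_eq[OF signed_measures_add[OF nu] fin_meas_add fin_meas_add _ f])
       (simp_all add: pn measure_add_measure[of \<Omega>] parts_eq[OF nu(1)] parts_eq[OF nu(2)])
  then show ?thesis
    using integral_add_measure(2)[OF _ bdd_meas_integrable[OF pn(1) f] bdd_meas_integrable[OF pn(3) f]]
      integral_add_measure(2)[OF _ bdd_meas_integrable[OF pn(2) f] bdd_meas_integrable[OF pn(4) f]] pn
    by (simp add: sint_def fin_meas_def)
qed

lemma fin_meas_density_const:
  assumes "fin_meas \<Omega> m" shows "fin_meas \<Omega> (density m (\<lambda>_. ennreal c))"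
proof -
  interpret m: finite_measure m using assms by (simp add: fin_meas_def)
  show ?thesis
    using assms by (auto simp: fin_meas_def emeasure_density_const m.emeasure_eq_measure ennreal_mult_eq_top_iff intro!: finite_measureI)
qed

lemma measure_density_const':
  assumes "fin_meas \<Omega> m" "0 \<le> c" "A \<in> sets (borel_on \<Omega>)"
  shows "measure (density m (\<lambda>_. ennreal c)) A = c * measure m A"
proof -
  interpret m: finite_measure m using assms by (simp add: fin_meas_def)
  have "emeasure (density m (\<lambda>_. ennreal c)) A = ennreal (c * measure m A)"
    using assms by (simp add: emeasure_density_const fin_meas_def m.emeasure_eq_measure ennreal_mult)
  then show ?thesis using assms by (simp add: measure_def)
qed

lemma sint_minus:
  assumes nu: "\<nu> \<in> signed_measures \<Omega>" and f: "bdd_meas \<Omega> f"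
  shows "sint \<Omega> (\<lambda>A. - \<nu> A) f = - sint \<Omega> \<nu> f"
proof -
  have "(\<lambda>A. - \<nu> A) \<in> signed_measures \<Omega>" using signed_measures_scale[OF nu, of "-1"] by simp
  then have "sint \<Omega> (\<lambda>A. - \<nu> A) f = (\<integral>x. f x \<partial>neg_part \<Omega> \<nu>) - (\<integral>x. f x \<partial>pos_part \<Omega> \<nu>)"
    by (rule sint_eq[OF _ fin_meas_parts(2)[OF nu] fin_meas_parts(1)[OF nu] _ f]) (simp add: parts_eq[OF nu])
  then show ?thesis by (simp add: sint_def)
qed

lemma sint_scale_pos:
  assumes nu: "\<nu> \<in> signed_measures \<Omega>" and f: "bdd_meas \<Omega> f" and c: "0 \<le> c"
  shows "sint \<Omega> (\<lambda>A. c * \<nu> A) f = c * sint \<Omega> \<nu> f"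
proof -
  note pn = fin_meas_parts[OF nu]
  have "sint \<Omega> (\<lambda>A. c * \<nu> A) f = (\<integral>x. f x \<partial>density (pos_part \<Omega> \<nu>) (\<lambda>_. ennreal c)) - (\<integral>x. f x \<partial>density (neg_part \<Omega> \<nu>) (\<lambda>_. ennreal c))"
    by (rule sint_eq[OF signed_measures_scale[OF nu] fin_meas_density_const[OF pn(1)] fin_meas_density_const[OF pn(2)] _ f])
       (simp add: measure_density_const'[OF pn(1) c] measure_density_const'[OF pn(2) c] parts_eq[OF nu] algebra_simps)
  also have "\<dots> = c * sint \<Omega> \<nu> f"
    using pn f c by (subst (1 2) integral_density)
      (auto simp: fin_meas_def bdd_meas_def sint_def algebra_simps cong: measurable_cong_sets)
  finally show ?thesis .
qed

lemma sint_scale: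
  assumes nu: "\<nu> \<in> signed_measures \<Omega>" and f: "bdd_meas \<Omega> f"
  shows "sint \<Omega> (\<lambda>A. c * \<nu> A) f = c * sint \<Omega> \<nu> f"
proof (cases "0 \<le> c")
  case True then show ?thesis using sint_scale_pos[OF nu f] by simp
next
  case False
  have "sint \<Omega> (\<lambda>A. - ((- c) * \<nu> A)) f = - sint \<Omega> (\<lambda>A. (- c) * \<nu> A) f"
    by (rule sint_minus[OF signed_measures_scale[OF nu] f])
  then show ?thesis using sint_scale_pos[OF nu f, of "-c"] False by simp
qed

lemma sint_lincomb:
  assumes nu: "\<nu>1 \<in> signed_measures \<Omega>" "\<nu>2 \<in> signed_measures \<Omega>" and f: "bdd_meas \<Omega> f"
  shows "sint \<Omega> (\<lambda>A. c1 * \<nu>1 A + c2 * \<nu>2 A) f = c1 * sint \<Omega> \<nu>1 f + c2 * sint \<Omega> \<nu>2 f"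
  using sint_add[OF signed_measures_scale[OF nu(1)] signed_measures_scale[OF nu(2)] f]
  by (simp add: sint_scale[OF nu(1) f] sint_scale[OF nu(2) f])

lemma sint_abs_le:
  assumes nu: "\<nu> \<in> signed_measures \<Omega>" and f: "bdd_meas \<Omega> f" and C: "\<And>x. x \<in> \<Omega> \<Longrightarrow> \<bar>f x\<bar> \<le> C"
  shows "sint \<Omega> \<nu> f \<le> C * tv \<Omega> \<nu> \<Omega>"
proof -
  have b: "\<bar>\<integral>x. f x \<partial>m\<bar> \<le> C * measure m \<Omega>" if m: "fin_meas \<Omega> m" for m
  proof -
    interpret finite_measure m using m by (simp add: fin_meas_def)
    have "\<bar>\<integral>x. f x \<partial>m\<bar> \<le> (\<integral>x. \<bar>f x\<bar> \<partial>m)" by (rule integral_abs_bound)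
    also have "\<dots> \<le> (\<integral>x. C \<partial>m)"
      using bdd_meas_integrable[OF m f] C fin_measD(3)[OF m] by (intro integral_mono) auto
    finally show ?thesis using fin_measD(3)[OF m] by (simp add: mult.commute)
  qed
  show ?thesis
    using b[OF fin_meas_parts(1)[OF nu]] b[OF fin_meas_parts(2)[OF nu]]
    unfolding sint_def tv_def distrib_left by linarith
qed

lemma sint_indicator:
  assumes nu: "\<nu> \<in> signed_measures \<Omega>" and B: "B \<in> sets (borel_on \<Omega>)"
  shows "sint \<Omega> \<nu> (indicator B) = \<nu> B"
proof -
  have "(\<integral>x. indicator B x \<partial>m) = measure m B" if "fin_meas \<Omega> m" for m
    using that B sets.sets_into_space[OF B] by (simp add: fin_meas_def fin_measD(3)[OF that] Int_absorb2)
  then show ?thesis using fin_meas_parts[OF nu] by (simp add: sint_def parts_eq[OF nu, of B])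
qed

lemma sint_fun_add:
  assumes nu: "\<nu> \<in> signed_measures \<Omega>" and f: "bdd_meas \<Omega> f" "bdd_meas \<Omega> g"
  shows "sint \<Omega> \<nu> (\<lambda>x. f x + c * g x) = sint \<Omega> \<nu> f + c * sint \<Omega> \<nu> g"
  using bdd_meas_integrable[OF fin_meas_parts(1)[OF nu]] bdd_meas_integrable[OF fin_meas_parts(2)[OF nu]] f
  by (simp add: sint_def algebra_simps)


section \<open>Couplings and the dual inequality\<close>

lemma sets_pair_borel_on:
  assumes "fin_meas \<Omega> m1" "fin_meas \<Omega> m2"
  shows "sets (m1 \<Otimes>\<^sub>M m2) = sets (borel_on \<Omega> \<Otimes>\<^sub>M borel_on \<Omega>)"
  using assms by (intro sets_pair_measure_cong) (simp_all add: fin_meas_def)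

lemma pair_space:
  assumes "sets \<gamma> = sets (borel_on \<Omega> \<Otimes>\<^sub>M borel_on \<Omega>)" shows "space \<gamma> = \<Omega> \<times> \<Omega>"
  using sets_eq_imp_space_eq[OF assms] by (simp add: space_pair_measure)

lemma pair_fst_snd:
  assumes "sets \<gamma> = sets (borel_on \<Omega> \<Otimes>\<^sub>M borel_on \<Omega>)"
  shows "fst \<in> measurable \<gamma> (borel_on \<Omega>)" "snd \<in> measurable \<gamma> (borel_on \<Omega>)"
  using assms by (auto intro: borel_measurable_sets_cong)

lemma pair_fst_snd':
  assumes "sets \<gamma> = sets (borel_on \<Omega> \<Otimes>\<^sub>M borel_on \<Omega>)" "fin_meas \<Omega> m"
  shows "fst \<in> measurable \<gamma> m" "snd \<in> measurable \<gamma> m"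
  using pair_fst_snd[OF assms(1)] assms(2) measurable_cong_sets[of \<gamma> \<gamma> m "borel_on \<Omega>"]
  by (auto simp: fin_meas_def)

lemma cost_measurable:
  fixes \<Omega> :: "'a::euclidean_space set"
  assumes "sets \<gamma> = sets (borel_on \<Omega> \<Otimes>\<^sub>M borel_on \<Omega>)"
  shows "(\<lambda>z. norm (fst z - snd z) powr p) \<in> borel_measurable \<gamma>"
proof -
  have id: "(\<lambda>x. x) \<in> measurable (borel_on \<Omega>) borel" by (rule measurable_restrict_space1) simp
  have "(\<lambda>z. fst z) \<in> borel_measurable \<gamma>" "(\<lambda>z. snd z) \<in> borel_measurable \<gamma>"
    using measurable_compose[OF pair_fst_snd(1)[OF assms] id] measurable_compose[OF pair_fst_snd(2)[OF assms] id]
    by simp_all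
  then show ?thesis by measurable
qed

lemma couplingsD:
  assumes g: "\<gamma> \<in> couplings m1 m2" and m: "fin_meas \<Omega> m1" "fin_meas \<Omega> m2"
  shows "sets \<gamma> = sets (borel_on \<Omega> \<Otimes>\<^sub>M borel_on \<Omega>)" "distr \<gamma> m1 fst = m1" "distr \<gamma> m2 snd = m2"
  using g sets_pair_borel_on[OF m] by (simp_all add: couplings_def)

lemma coupling_mass:
  assumes g: "\<gamma> \<in> couplings m1 m2" and m: "fin_meas \<Omega> m1" "fin_meas \<Omega> m2"
  shows "finite_measure \<gamma>" "measure \<gamma> (\<Omega> \<times> \<Omega>) = measure m1 \<Omega>"
proof -
  note gD = couplingsD[OF g m]
  note f = pair_fst_snd'(1)[OF gD(1) m(1)]
  have "emeasure m1 \<Omega> = emeasure (distr \<gamma> m1 fst) \<Omega>" by (simp add: gD(2))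
  also have "\<dots> = emeasure \<gamma> (fst -` \<Omega> \<inter> space \<gamma>)"
    using fin_measD[OF m(1)] by (intro emeasure_distr f) (metis sets.top)
  also have "fst -` \<Omega> \<inter> space \<gamma> = \<Omega> \<times> \<Omega>" using pair_space[OF gD(1)] by auto
  finally have e: "emeasure m1 \<Omega> = emeasure \<gamma> (\<Omega> \<times> \<Omega>)" .
  show "finite_measure \<gamma>"
    using pair_space[OF gD(1)] e[symmetric] fin_measD(1)[OF m(1)]
    by (intro finite_measureI) (simp add: finite_measure.emeasure_finite)
  show "measure \<gamma> (\<Omega> \<times> \<Omega>) = measure m1 \<Omega>" using e by (simp add: measure_def)
qed

text \<open>
  The functions whose integral against any admissible move of mass is at most the cost of the move: \<open>\<alpha>\<close> for creating
  or deleting a unit of mass, \<open>\<beta> + |x - y|^p\<close> for transporting it from \<open>y\<close> to \<open>x\<close>.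
\<close>

definition test_fun :: "'a::euclidean_space set \<Rightarrow> real \<Rightarrow> real \<Rightarrow> real \<Rightarrow> ('a \<Rightarrow> real) \<Rightarrow> bool" where
  "test_fun \<Omega> p \<alpha> \<beta> f \<longleftrightarrow> f \<in> borel_measurable (borel_on \<Omega>) \<and> (\<forall>x\<in>\<Omega>. \<bar>f x\<bar> \<le> \<alpha>) \<and>
     (\<forall>x\<in>\<Omega>. \<forall>y\<in>\<Omega>. f x - f y \<le> \<beta> + norm (x - y) powr p)"

lemma test_fun_bdd_meas: "test_fun \<Omega> p \<alpha> \<beta> f \<Longrightarrow> bdd_meas \<Omega> f"
  by (auto simp: test_fun_def bdd_meas_def)

lemma sint_le_transport:
  fixes \<Omega> :: "'a::euclidean_space set"
  assumes nu: "\<nu> \<in> signed_measures \<Omega>" and g: "\<gamma> \<in> couplings (pos_part \<Omega> \<nu>) (neg_part \<Omega> \<nu>)"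
    and int: "integrable \<gamma> (\<lambda>z. norm (fst z - snd z) powr p)" and f: "test_fun \<Omega> p \<alpha> \<beta> f"
  shows "sint \<Omega> \<nu> f \<le> (\<integral>z. norm (fst z - snd z) powr p \<partial>\<gamma>) + \<beta> * measure \<gamma> (\<Omega> \<times> \<Omega>)"
proof -
  let ?m1 = "pos_part \<Omega> \<nu>" and ?m2 = "neg_part \<Omega> \<nu>"
  note m = fin_meas_parts[OF nu]
  note gD = couplingsD[OF g m]
  interpret finite_measure \<gamma> by (rule coupling_mass[OF g m])
  note fb = test_fun_bdd_meas[OF f]
  have fm: "f \<in> borel_measurable ?m1" "f \<in> borel_measurable ?m2"
    using f m by (auto simp: test_fun_def fin_meas_def intro: borel_measurable_sets_cong)
  have e1: "(\<integral>x. f x \<partial>?m1) = (\<integral>z. f (fst z) \<partial>\<gamma>)" and i1: "integrable \<gamma> (\<lambda>z. f (fst z))"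
    using integral_distr[OF pair_fst_snd'(1)[OF gD(1) m(1)] fm(1)] bdd_meas_integrable[OF m(1) fb]
      integrable_distr_eq[OF pair_fst_snd'(1)[OF gD(1) m(1)] fm(1)] by (simp_all add: gD(2))
  have e2: "(\<integral>x. f x \<partial>?m2) = (\<integral>z. f (snd z) \<partial>\<gamma>)" and i2: "integrable \<gamma> (\<lambda>z. f (snd z))"
    using integral_distr[OF pair_fst_snd'(2)[OF gD(1) m(2)] fm(2)] bdd_meas_integrable[OF m(2) fb]
      integrable_distr_eq[OF pair_fst_snd'(2)[OF gD(1) m(2)] fm(2)] by (simp_all add: gD(3))
  have "sint \<Omega> \<nu> f = (\<integral>z. f (fst z) - f (snd z) \<partial>\<gamma>)"
    using i1 i2 by (simp add: sint_def e1 e2)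
  also have "\<dots> \<le> (\<integral>z. norm (fst z - snd z) powr p + \<beta> \<partial>\<gamma>)"
    using f i1 i2 int pair_space[OF gD(1)]
    by (intro integral_mono) (auto simp: test_fun_def add.commute)
  also have "\<dots> = (\<integral>z. norm (fst z - snd z) powr p \<partial>\<gamma>) + \<beta> * measure \<gamma> (\<Omega> \<times> \<Omega>)"
    using int pair_space[OF gD(1)] by simp
  finally show ?thesis .
qed

lemma KR_term_real:
  fixes \<Omega> :: "'a::euclidean_space set"
  assumes nu: "\<nu> \<in> signed_measures \<Omega>" and mu: "\<mu> \<in> signed_measures \<Omega>"
    and g: "\<gamma> \<in> couplings (pos_part \<Omega> \<nu>) (neg_part \<Omega> \<nu>)" and n0: "\<nu> \<Omega> = 0"
    and ab: "0 \<le> \<alpha>" "0 \<le> \<beta>"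
    and int: "integrable \<gamma> (\<lambda>z. norm (fst z - snd z) powr p)"
  shows "(\<integral>\<^sup>+z. ennreal (norm (fst z - snd z) powr p) \<partial>\<gamma>) +
        ennreal (\<beta> / 2) * total_variation \<Omega> \<nu> \<Omega>
        + ennreal \<alpha> * total_variation \<Omega> (\<lambda>A. \<mu> A - \<nu> A) \<Omega>
     = ennreal ((\<integral>z. norm (fst z - snd z) powr p \<partial>\<gamma>) + \<beta> * measure \<gamma> (\<Omega> \<times> \<Omega>) + \<alpha> * tv \<Omega> (\<lambda>A. \<mu> A - \<nu> A) \<Omega>)"
proof -
  note m = fin_meas_parts[OF nu]
  have "measure (pos_part \<Omega> \<nu>) \<Omega> = measure (neg_part \<Omega> \<nu>) \<Omega>" using n0 parts_eq[OF nu, of \<Omega>] by simp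
  then have tv: "tv \<Omega> \<nu> \<Omega> = 2 * measure \<gamma> (\<Omega> \<times> \<Omega>)"
    using coupling_mass(2)[OF g m] by (simp add: tv_def)
  have i: "(\<integral>\<^sup>+z. ennreal (norm (fst z - snd z) powr p) \<partial>\<gamma>) = ennreal (\<integral>z. norm (fst z - snd z) powr p \<partial>\<gamma>)"
    using int by (intro nn_integral_eq_integral) auto
  have i0: "0 \<le> (\<integral>z. norm (fst z - snd z) powr p \<partial>\<gamma>)" by simp
  show ?thesis
    unfolding i total_variation_eq_tv[OF nu] total_variation_eq_tv[OF signed_measures_diff[OF mu nu]] tv
    using ab i0 tv_nonneg[of \<Omega> "\<lambda>A. \<mu> A - \<nu> A"]
    by (simp add: ennreal_plus[symmetric] ennreal_mult[symmetric] del: ennreal_plus)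
qed

lemma ennreal_le_INF_add:
  fixes f :: "'b \<Rightarrow> ennreal"
  assumes "\<And>i. i \<in> I \<Longrightarrow> X \<le> f i + R" shows "X \<le> (INF i\<in>I. f i) + R"
proof (cases "R = \<top>")
  case False
  then have "X - R \<le> f i" if "i \<in> I" for i
    using assms[OF that] by (simp add: ennreal_minus_le_iff add.commute)
  then have "X - R \<le> (INF i\<in>I. f i)" by (rule INF_greatest)
  then show ?thesis using False by (simp add: ennreal_minus_le_iff add.commute)
qed simp

text \<open>
  Turns the infimum over measures and couplings, taken in the extended half line, into an estimate between real
  numbers; couplings of infinite cost and measures of nonzero total mass are discarded here once and for all.
\<close>

lemma KR_norm_geI:
  fixes \<Omega> :: "'a::euclidean_space set"
  assumes mu: "\<mu> \<in> signed_measures \<Omega>" and ab: "0 \<le> \<alpha>" "0 \<le> \<beta>"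
    and le: "\<And>\<nu> \<gamma>. \<nu> \<in> radon_measures \<Omega> \<Longrightarrow> \<nu> \<Omega> = 0 \<Longrightarrow> \<gamma> \<in> couplings (pos_part \<Omega> \<nu>) (neg_part \<Omega> \<nu>) \<Longrightarrow>
      integrable \<gamma> (\<lambda>z. norm (fst z - snd z) powr p) \<Longrightarrow>
      X \<le> (\<integral>z. norm (fst z - snd z) powr p \<partial>\<gamma>) + \<beta> * measure \<gamma> (\<Omega> \<times> \<Omega>) + \<alpha> * tv \<Omega> (\<lambda>A. \<mu> A - \<nu> A) \<Omega>"
  shows "ennreal X \<le> KR_norm \<Omega> p \<alpha> \<beta> \<mu>"
  unfolding KR_norm_def
proof (rule INF_greatest)
  fix \<nu> assume r: "\<nu> \<in> radon_measures \<Omega>"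
  note nu = radon_signed[OF r]
  note m = fin_meas_parts[OF nu]
  show "ennreal X \<le> W p (pos_part \<Omega> \<nu>) (neg_part \<Omega> \<nu>) + ennreal (\<beta> / 2) * total_variation \<Omega> \<nu> \<Omega> +
           (if \<nu> \<Omega> = 0 then 0 else \<infinity>) + ennreal \<alpha> * total_variation \<Omega> (\<lambda>A. \<mu> A - \<nu> A) \<Omega>"
  proof (cases "\<nu> \<Omega> = 0")
    case True
    have "ennreal X \<le> (\<integral>\<^sup>+z. ennreal (norm (fst z - snd z) powr p) \<partial>\<gamma>) +
        (ennreal (\<beta> / 2) * total_variation \<Omega> \<nu> \<Omega> + ennreal \<alpha> * total_variation \<Omega> (\<lambda>A. \<mu> A - \<nu> A) \<Omega>)"
      if g: "\<gamma> \<in> couplings (pos_part \<Omega> \<nu>) (neg_part \<Omega> \<nu>)" for \<gamma>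
    proof (cases "(\<integral>\<^sup>+z. ennreal (norm (fst z - snd z) powr p) \<partial>\<gamma>) = \<infinity>")
      case False
      have int: "integrable \<gamma> (\<lambda>z. norm (fst z - snd z) powr p)"
        using False cost_measurable[OF couplingsD(1)[OF g m]]
        by (simp add: integrable_iff_bounded less_top)
      show ?thesis
        using KR_term_real[OF nu mu g True ab int] le[OF r True g int]
        by (simp add: add.assoc[symmetric] ennreal_leI)
    qed simp
    from ennreal_le_INF_add[OF this] show ?thesis
      using True by (simp add: W_def add.assoc)
  qed simp
qed

text \<open>
  Weak duality. Only this direction is used, with explicit test functions.
\<close>

lemma KR_norm_dual:
  fixes \<Omega> :: "'a::euclidean_space set"
  assumes mu: "\<mu> \<in> signed_measures \<Omega>" and ab: "0 \<le> \<alpha>" "0 \<le> \<beta>" and f: "test_fun \<Omega> p \<alpha> \<beta> f"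
  shows "ennreal (sint \<Omega> \<mu> f) \<le> KR_norm \<Omega> p \<alpha> \<beta> \<mu>"
proof (rule KR_norm_geI[OF mu ab])
  fix \<nu> \<gamma>
  assume r: "\<nu> \<in> radon_measures \<Omega>" and g: "\<gamma> \<in> couplings (pos_part \<Omega> \<nu>) (neg_part \<Omega> \<nu>)"
    and int: "integrable \<gamma> (\<lambda>z. norm (fst z - snd z) powr p)"
  note nu = radon_signed[OF r]
  note d = signed_measures_diff[OF mu nu]
  have "sint \<Omega> \<mu> f = sint \<Omega> \<nu> f + sint \<Omega> (\<lambda>A. \<mu> A - \<nu> A) f"
    using sint_add[OF nu d test_fun_bdd_meas[OF f]] by simp
  moreover have "sint \<Omega> (\<lambda>A. \<mu> A - \<nu> A) f \<le> \<alpha> * tv \<Omega> (\<lambda>A. \<mu> A - \<nu> A) \<Omega>"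
    using f by (intro sint_abs_le[OF d test_fun_bdd_meas[OF f]]) (auto simp: test_fun_def)
  ultimately show "sint \<Omega> \<mu> f \<le> (\<integral>z. norm (fst z - snd z) powr p \<partial>\<gamma>) + \<beta> * measure \<gamma> (\<Omega> \<times> \<Omega>) + \<alpha> * tv \<Omega> (\<lambda>A. \<mu> A - \<nu> A) \<Omega>"
    using sint_le_transport[OF nu g int f] by linarith
qed

section \<open>Partial transport plans\<close>

text \<open>
  Only a part of \<open>a\<close> is transported onto a part of \<open>b\<close>. The untransported rest of both is paid for in the last
  summand of the cost below.
\<close>

definition subplan :: "'a::euclidean_space set \<Rightarrow> real \<Rightarrow> 'a measure \<Rightarrow> 'a measure \<Rightarrow> ('a \<times> 'a) measure \<Rightarrow> bool" where
  "subplan \<Omega> p a b \<gamma> \<longleftrightarrow> sets \<gamma> = sets (borel_on \<Omega> \<Otimes>\<^sub>M borel_on \<Omega>) \<and>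
     integrable \<gamma> (\<lambda>z. norm (fst z - snd z) powr p) \<and>
     (\<forall>B\<in>sets (borel_on \<Omega>). emeasure \<gamma> (B \<times> \<Omega>) \<le> emeasure a B \<and> emeasure \<gamma> (\<Omega> \<times> B) \<le> emeasure b B)"

definition plan_cost :: "'a::euclidean_space set \<Rightarrow> real \<Rightarrow> real \<Rightarrow> real \<Rightarrow> 'a measure \<Rightarrow> 'a measure \<Rightarrow> ('a \<times> 'a) measure \<Rightarrow> real" where
  "plan_cost \<Omega> p \<alpha> \<beta> a b \<gamma> = (\<integral>z. norm (fst z - snd z) powr p \<partial>\<gamma>) + \<beta> * measure \<gamma> (\<Omega> \<times> \<Omega>)
     + \<alpha> * (measure a \<Omega> + measure b \<Omega> - 2 * measure \<gamma> (\<Omega> \<times> \<Omega>))"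

lemma Omega_sets: "\<Omega> \<in> sets (borel_on \<Omega>)"
  using sets.top[of "borel_on \<Omega>"] by simp

lemma subplan_finite:
  assumes a: "fin_meas \<Omega> a" and s: "subplan \<Omega> p a b \<gamma>" shows "finite_measure \<gamma>"
proof (rule finite_measureI)
  have "emeasure \<gamma> (\<Omega> \<times> \<Omega>) \<le> emeasure a \<Omega>" using s Omega_sets[of \<Omega>] by (auto simp: subplan_def)
  also have "\<dots> < \<infinity>" using fin_measD(1)[OF a] by (simp add: finite_measure.emeasure_finite less_top[symmetric])
  finally show "emeasure \<gamma> (space \<gamma>) \<noteq> \<infinity>" using pair_space[of \<gamma> \<Omega>] s by (simp add: subplan_def)
qed

lemma vimage_rect:
  assumes "B \<in> sets (borel_on \<Omega>)"
  shows "fst -` B \<inter> (\<Omega> \<times> \<Omega>) = B \<times> \<Omega>" "snd -` B \<inter> (\<Omega> \<times> \<Omega>) = \<Omega> \<times> B"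
  using sets.sets_into_space[OF assms] by auto

lemma marginal_emeasure:
  assumes s: "sets \<gamma> = sets (borel_on \<Omega> \<Otimes>\<^sub>M borel_on \<Omega>)" and B: "B \<in> sets (borel_on \<Omega>)"
  shows "emeasure (distr \<gamma> (borel_on \<Omega>) fst) B = emeasure \<gamma> (B \<times> \<Omega>)"
    "emeasure (distr \<gamma> (borel_on \<Omega>) snd) B = emeasure \<gamma> (\<Omega> \<times> B)"
  using emeasure_distr[OF pair_fst_snd(1)[OF s] B] emeasure_distr[OF pair_fst_snd(2)[OF s] B]
  by (simp_all add: vimage_rect[OF B] pair_space[OF s])

lemma marginal_fin_meas:
  assumes s: "sets \<gamma> = sets (borel_on \<Omega> \<Otimes>\<^sub>M borel_on \<Omega>)" and f: "finite_measure \<gamma>"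
  shows "fin_meas \<Omega> (distr \<gamma> (borel_on \<Omega>) fst)" "fin_meas \<Omega> (distr \<gamma> (borel_on \<Omega>) snd)"
  using finite_measure.finite_measure_distr[OF f pair_fst_snd(1)[OF s]]
    finite_measure.finite_measure_distr[OF f pair_fst_snd(2)[OF s]] by (simp_all add: fin_meas_def)

text \<open>
  The marginals of the plan inherit mutual singularity from \<open>a\<close> and \<open>b\<close>. They are therefore the Jordan parts of
  their difference, and the plan couples exactly these parts.
\<close>

lemma KR_norm_le_plan_cost:
  fixes \<Omega> :: "'a::euclidean_space set"
  assumes mu: "\<mu> \<in> radon_measures \<Omega>" and J: "is_jordan_decomposition \<Omega> \<mu> a b"
    and s: "subplan \<Omega> p a b \<gamma>" and ab: "0 \<le> \<alpha>" "0 \<le> \<beta>"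
  shows "KR_norm \<Omega> p \<alpha> \<beta> \<mu> \<le> ennreal (plan_cost \<Omega> p \<alpha> \<beta> a b \<gamma>)"
proof -
  let ?M = "borel_on \<Omega>"
  define n1 where "n1 = distr \<gamma> ?M fst"
  define n2 where "n2 = distr \<gamma> ?M snd"
  note mus = radon_signed[OF mu]
  have pe: "pos_part \<Omega> \<mu> = a" "neg_part \<Omega> \<mu> = b" using jordan_parts_eq[OF J] by simp_all
  have fa: "fin_meas \<Omega> a" "fin_meas \<Omega> b" using fin_meas_parts[OF mus] by (simp_all add: pe)
  interpret a: finite_measure a using fa by (simp add: fin_meas_def)
  interpret b: finite_measure b using fa by (simp add: fin_meas_def)
  interpret g: finite_measure \<gamma> by (rule subplan_finite[OF fa(1) s])
  have sg: "sets \<gamma> = sets (?M \<Otimes>\<^sub>M ?M)" and int: "integrable \<gamma> (\<lambda>z. norm (fst z - snd z) powr p)"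
    using s by (simp_all add: subplan_def)
  have fn: "fin_meas \<Omega> n1" "fin_meas \<Omega> n2"
    unfolding n1_def n2_def by (rule marginal_fin_meas[OF sg g.finite_measure_axioms])+
  interpret n1: finite_measure n1 using fn by (simp add: fin_meas_def)
  interpret n2: finite_measure n2 using fn by (simp add: fin_meas_def)
  have em: "emeasure n1 B \<le> emeasure a B" "emeasure n2 B \<le> emeasure b B" if "B \<in> sets ?M" for B
    using s that marginal_emeasure[OF sg that] by (simp_all add: subplan_def n1_def n2_def)
  have me: "measure n1 B \<le> measure a B" "measure n2 B \<le> measure b B" if "B \<in> sets ?M" for B
    using em[OF that] by (simp_all add: a.emeasure_eq_measure b.emeasure_eq_measure n1.emeasure_eq_measure n2.emeasure_eq_measure)
  have mass: "measure n1 \<Omega> = measure \<gamma> (\<Omega> \<times> \<Omega>)" "measure n2 \<Omega> = measure \<gamma> (\<Omega> \<times> \<Omega>)"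
    using marginal_emeasure[OF sg Omega_sets] by (simp_all add: measure_def n1_def n2_def)
  define \<nu> where "\<nu> = (\<lambda>A. measure n1 A - measure n2 A)"
  have nu: "\<nu> \<in> signed_measures \<Omega>" unfolding \<nu>_def by (rule fin_meas_diff_signed[OF fn])
  obtain P where P: "P \<in> sets ?M" "emeasure a (\<Omega> - P) = 0" "emeasure b P = 0"
    using J by (auto simp: is_jordan_decomposition_def)
  have OP: "\<Omega> - P \<in> sets ?M" using P(1) Omega_sets by auto
  have "emeasure n1 (\<Omega> - P) = 0" "emeasure n2 P = 0" using em(1)[OF OP] em(2)[OF P(1)] P by auto
  then have Jn: "is_jordan_decomposition \<Omega> \<nu> n1 n2"
    using fn P(1) by (auto simp: is_jordan_decomposition_def \<nu>_def fin_meas_def)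
  have pn: "pos_part \<Omega> \<nu> = n1" "neg_part \<Omega> \<nu> = n2" using jordan_parts_eq[OF Jn] by simp_all
  have rad: "\<nu> \<in> radon_measures \<Omega>"
  proof (rule radon_tv_dominated[OF mu nu, of 1])
    fix A assume "A \<in> sets ?M"
    then show "tv \<Omega> \<nu> A \<le> 1 * tv \<Omega> \<mu> A" using me[of A] by (simp add: tv_def pn pe)
  qed
  have cpl: "\<gamma> \<in> couplings n1 n2"
    unfolding couplings_def
  proof (safe)
    show "\<And>x. x \<in> sets \<gamma> \<Longrightarrow> x \<in> sets (n1 \<Otimes>\<^sub>M n2)" "\<And>x. x \<in> sets (n1 \<Otimes>\<^sub>M n2) \<Longrightarrow> x \<in> sets \<gamma>"
      using sg sets_pair_borel_on[OF fn] by simp_all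
    show "distr \<gamma> n1 fst = n1" "distr \<gamma> n2 snd = n2"
      unfolding n1_def n2_def by (rule distr_cong; simp)+
  qed
  have n0: "\<nu> \<Omega> = 0" by (simp add: \<nu>_def mass)
  have d: "tv \<Omega> (\<lambda>A. \<mu> A - \<nu> A) \<Omega> \<le> measure a \<Omega> + measure b \<Omega> - 2 * measure \<gamma> (\<Omega> \<times> \<Omega>)"
  proof (rule tv_le[OF signed_measures_diff[OF mus nu] Omega_sets])
    fix E assume E: "E \<in> sets ?M" "E \<subseteq> \<Omega>"
    have OE: "\<Omega> - E \<in> sets ?M" using E Omega_sets by auto
    have sp: "measure m \<Omega> = measure m E + measure m (\<Omega> - E)" if m: "fin_meas \<Omega> m" for m
    proof -
      interpret finite_measure m using m by (simp add: fin_meas_def)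
      show ?thesis using finite_measure_compl[of E] E m fin_measD(3)[OF m] by (simp add: fin_meas_def)
    qed
    have "\<mu> E = measure a E - measure b E" "\<mu> (\<Omega> - E) = measure a (\<Omega> - E) - measure b (\<Omega> - E)"
      using parts_eq[OF mus] by (simp_all add: pe)
    then show "\<mu> E - \<nu> E - (\<mu> (\<Omega> - E) - \<nu> (\<Omega> - E)) \<le> measure a \<Omega> + measure b \<Omega> - 2 * measure \<gamma> (\<Omega> \<times> \<Omega>)"
      using me[OF E(1)] me[OF OE] sp[OF fa(1)] sp[OF fa(2)] sp[OF fn(1)] sp[OF fn(2)] mass
      unfolding \<nu>_def by linarith
  qed
  have "KR_norm \<Omega> p \<alpha> \<beta> \<mu> \<le> W p n1 n2 + ennreal (\<beta> / 2) * total_variation \<Omega> \<nu> \<Omega>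
      + ennreal \<alpha> * total_variation \<Omega> (\<lambda>A. \<mu> A - \<nu> A) \<Omega>"
    unfolding KR_norm_def by (rule INF_lower2[OF rad]) (simp add: pn n0)
  also have "\<dots> \<le> (\<integral>\<^sup>+z. ennreal (norm (fst z - snd z) powr p) \<partial>\<gamma>) + ennreal (\<beta> / 2) * total_variation \<Omega> \<nu> \<Omega>
      + ennreal \<alpha> * total_variation \<Omega> (\<lambda>A. \<mu> A - \<nu> A) \<Omega>"
    unfolding W_def by (intro add_right_mono INF_lower cpl)
  also have "\<dots> = ennreal ((\<integral>z. norm (fst z - snd z) powr p \<partial>\<gamma>) + \<beta> * measure \<gamma> (\<Omega> \<times> \<Omega>) + \<alpha> * tv \<Omega> (\<lambda>A. \<mu> A - \<nu> A) \<Omega>)"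
    using KR_term_real[OF nu mus _ n0 ab int] cpl by (simp add: pn)
  also have "\<dots> \<le> ennreal (plan_cost \<Omega> p \<alpha> \<beta> a b \<gamma>)"
    unfolding plan_cost_def using d ab by (intro ennreal_leI add_left_mono mult_left_mono) auto
  finally show ?thesis .
qed


section \<open>Thinning a plan down to the Jordan parts\<close>

definition dens :: "'a measure \<Rightarrow> ('a \<Rightarrow> real) \<Rightarrow> 'a measure" where
  "dens m f = density m (\<lambda>x. ennreal (f x))"

text \<open>
  The bounds are required on the whole type, so that weights may be compared and combined pointwise.
\<close>

definition weight :: "'a::topological_space set \<Rightarrow> ('a \<Rightarrow> real) \<Rightarrow> bool" where
  "weight \<Omega> f \<longleftrightarrow> f \<in> borel_measurable (borel_on \<Omega>) \<and> (\<forall>x. 0 \<le> f x \<and> f x \<le> 1)"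

lemma weightD: "weight \<Omega> f \<Longrightarrow> 0 \<le> f x" "weight \<Omega> f \<Longrightarrow> f x \<le> 1"
  "weight \<Omega> f \<Longrightarrow> f \<in> borel_measurable (borel_on \<Omega>)"
  by (simp_all add: weight_def)

lemma weight_bdd_meas: "weight \<Omega> f \<Longrightarrow> bdd_meas \<Omega> f"
  by (auto simp: weight_def bdd_meas_def intro!: exI[of _ 1])

lemma weight_borel: "fin_meas \<Omega> m \<Longrightarrow> weight \<Omega> f \<Longrightarrow> f \<in> borel_measurable m"
  by (auto simp: weight_def fin_meas_def intro: borel_measurable_sets_cong)

lemma weight_mult_indicator: "weight \<Omega> f \<Longrightarrow> B \<in> sets (borel_on \<Omega>) \<Longrightarrow> weight \<Omega> (\<lambda>x. f x * indicator B x)"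
  by (auto simp: weight_def indicator_def)

lemma weight_indicator: "B \<in> sets (borel_on \<Omega>) \<Longrightarrow> weight \<Omega> (indicator B)"
  by (auto simp: weight_def indicator_def)

lemma sets_dens [simp]: "sets (dens m f) = sets m" by (simp add: dens_def)

lemma emeasure_dens:
  assumes "fin_meas \<Omega> m" "weight \<Omega> f" "B \<in> sets (borel_on \<Omega>)"
  shows "emeasure (dens m f) B = (\<integral>\<^sup>+x. ennreal (f x) * indicator B x \<partial>m)"
  unfolding dens_def using assms weight_borel[OF assms(1,2)]
  by (intro emeasure_density) (auto simp: fin_meas_def)

lemma emeasure_dens_le:
  assumes m: "fin_meas \<Omega> m" "weight \<Omega> f" and B: "B \<in> sets (borel_on \<Omega>)"
  shows "emeasure (dens m f) B \<le> emeasure m B"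
proof -
  have "emeasure (dens m f) B \<le> (\<integral>\<^sup>+x. indicator B x \<partial>m)"
    unfolding emeasure_dens[OF m B] using weightD(2)[OF m(2)]
    by (intro nn_integral_mono) (auto simp: indicator_def)
  then show ?thesis using m(1) B by (simp add: fin_meas_def)
qed

lemma fin_meas_dens:
  assumes "fin_meas \<Omega> m" "weight \<Omega> f" shows "fin_meas \<Omega> (dens m f)"
proof -
  have "emeasure (dens m f) \<Omega> \<le> emeasure m \<Omega>" by (rule emeasure_dens_le[OF assms Omega_sets])
  also have "\<dots> < \<infinity>" using fin_measD(1)[OF assms(1)] by (simp add: finite_measure.emeasure_finite less_top[symmetric])
  finally have "finite_measure (dens m f)" using fin_measD(3)[OF assms(1)] by (intro finite_measureI) (simp add: dens_def)
  then show ?thesis using assms(1) by (simp add: fin_meas_def)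
qed

lemma integral_dens:
  fixes g :: "'a::topological_space \<Rightarrow> real"
  assumes "fin_meas \<Omega> m" "weight \<Omega> f" "g \<in> borel_measurable m"
  shows "(\<integral>x. g x \<partial>dens m f) = (\<integral>x. f x * g x \<partial>m)"
  unfolding dens_def using assms weight_borel[OF assms(1,2)] weightD(1)[OF assms(2)]
  by (subst integral_density) auto

lemma measure_dens:
  assumes "fin_meas \<Omega> m" "weight \<Omega> f" "B \<in> sets (borel_on \<Omega>)"
  shows "measure (dens m f) B = (\<integral>x. f x * indicator B x \<partial>m)"
proof -
  have "measure (dens m f) B = (\<integral>x. indicator B x \<partial>dens m f)"
    using assms sets.sets_into_space[OF assms(3)] fin_measD(3)[OF fin_meas_dens[OF assms(1,2)]]
    by (simp add: fin_meas_def Int_absorb2)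
  also have "\<dots> = (\<integral>x. f x * indicator B x \<partial>m)"
    using assms by (intro integral_dens) (auto simp: fin_meas_def)
  finally show ?thesis .
qed

text \<open>
  A measure dominated by \<open>l\<close> has a Radon-Nikodym density with values in \<open>[0,1]\<close>, which can be made to vanish off
  a carrier \<open>P\<close> everywhere and not only almost everywhere. Mutual singularity then becomes a pointwise statement.
\<close>

lemma ex_dens:
  assumes l: "fin_meas \<Omega> l" and t: "fin_meas \<Omega> t" and le: "\<And>B. B \<in> sets (borel_on \<Omega>) \<Longrightarrow> emeasure t B \<le> emeasure l B"
    and P: "P \<in> sets (borel_on \<Omega>)" "emeasure t (\<Omega> - P) = 0"
  shows "\<exists>f. weight \<Omega> f \<and> (\<forall>x. x \<notin> P \<longrightarrow> f x = 0) \<and> t = dens l f"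
proof -
  interpret l: finite_measure l using l by (simp add: fin_meas_def)
  have sl: "sets l = sets (borel_on \<Omega>)" "space l = \<Omega>" and st: "sets t = sets (borel_on \<Omega>)" "space t = \<Omega>"
    using fin_measD[OF l] fin_measD[OF t] by simp_all
  have "absolutely_continuous l t"
    unfolding absolutely_continuous_def
  proof
    fix N assume "N \<in> null_sets l"
    then have "N \<in> sets (borel_on \<Omega>)" "emeasure l N = 0" using sl by auto
    then show "N \<in> null_sets t" using le[of N] st by (auto simp: null_sets_def)
  qed
  then obtain h where h: "h \<in> borel_measurable l" "density l h = t"
    using l.Radon_Nikodym[of t] sl st by auto
  define E where "E = {x \<in> space l. 1 < h x}"
  have E: "E \<in> sets l" unfolding E_def using h(1) by measurable
  have OP: "\<Omega> - P \<in> sets l" using P(1) Omega_sets[of \<Omega>] sl by auto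
  have "AE x in l. h x * indicator E x \<le> indicator E x"
  proof (rule ccontr)
    assume n: "\<not> ?thesis"
    have "(\<integral>\<^sup>+x. indicator E x \<partial>l) < (\<integral>\<^sup>+x. h x * indicator E x \<partial>l)"
    proof (rule nn_integral_less)
      show "(\<integral>\<^sup>+x. indicator E x \<partial>l) \<noteq> \<infinity>" using E l.emeasure_finite[of E] by simp
      show "AE x in l. indicator E x \<le> h x * indicator E x"
        by (rule AE_I2) (auto simp: E_def indicator_def)
      show "(\<lambda>x. h x * indicator E x) \<in> borel_measurable l" "indicator E \<in> borel_measurable l"
        using h(1) E by simp_all
    qed (rule n)
    also have "(\<integral>\<^sup>+x. h x * indicator E x \<partial>l) = emeasure t E"
      using emeasure_density[OF h(1) E] h(2) by simp
    also have "\<dots> \<le> emeasure l E" using le E sl by auto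
    finally show False using E by simp
  qed
  then have AE1: "AE x in l. h x \<le> 1"
    by (rule AE_mp) (auto intro!: AE_I2 simp: E_def indicator_def split: if_splits)
  have "(\<integral>\<^sup>+x. h x * indicator (\<Omega> - P) x \<partial>l) = 0"
    using emeasure_density[OF h(1) OP] h(2) P(2) by simp
  then have AE0: "AE x in l. h x * indicator (\<Omega> - P) x = 0"
    using h(1) OP by (subst (asm) nn_integral_0_iff_AE) auto
  define f where "f = (\<lambda>x. if x \<in> \<Omega> then enn2real (min 1 (h x)) * indicator P x else 0)"
  have hm: "h \<in> borel_measurable (borel_on \<Omega>)" using h(1) sl by (auto intro: borel_measurable_sets_cong)
  have b1: "enn2real (min 1 (h x)) \<le> 1" for x
    by (rule enn2real_leI) auto
  have "(\<lambda>x. enn2real (min 1 (h x)) * indicator P x) \<in> borel_measurable (borel_on \<Omega>)"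
    using hm P(1) by simp
  then have "f \<in> borel_measurable (borel_on \<Omega>)"
    by (rule measurable_cong[THEN iffD1, rotated]) (simp add: f_def)
  then have w: "weight \<Omega> f" using b1 by (auto simp: weight_def f_def indicator_def)
  have "dens l f = density l h"
    unfolding dens_def
  proof (rule density_cong)
    show "(\<lambda>x. ennreal (f x)) \<in> borel_measurable l" using weight_borel[OF l w] by simp
    show "AE x in l. ennreal (f x) = h x"
      using AE1 AE0
    proof (rule AE_mp[OF _ AE_mp[OF _ AE_I2]], intro impI)
      fix x assume x: "x \<in> space l" "h x * indicator (\<Omega> - P) x = 0" "h x \<le> 1"
      have "ennreal (enn2real (h x)) = h x" using x(3) by (intro ennreal_enn2real) (auto intro: le_less_trans)
      then show "ennreal (f x) = h x" using x sl
        by (auto simp: f_def indicator_def min_absorb2 split: if_splits)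
    qed
  qed (rule h(1))
  then have "t = dens l f" using h(2) by simp
  moreover have "\<forall>x. x \<notin> P \<longrightarrow> f x = 0" by (simp add: f_def)
  ultimately show ?thesis using w by blast
qed

lemma emeasure_add_le:
  assumes "sets N = sets M"
  shows "emeasure M A \<le> emeasure (add_measure M N) A" "emeasure N A \<le> emeasure (add_measure M N) A"
  using emeasure_add_measure[OF assms, of A] by simp_all

lemma coupling_nn_integral:
  assumes g: "\<gamma> \<in> couplings m1 m2" and m: "fin_meas \<Omega> m1" "fin_meas \<Omega> m2"
    and f: "f \<in> borel_measurable (borel_on \<Omega>)"
  shows "(\<integral>\<^sup>+z. f (fst z) \<partial>\<gamma>) = (\<integral>\<^sup>+x. f x \<partial>m1)" "(\<integral>\<^sup>+z. f (snd z) \<partial>\<gamma>) = (\<integral>\<^sup>+x. f x \<partial>m2)"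
proof -
  note gD = couplingsD[OF g m]
  have fm: "f \<in> borel_measurable m1" "f \<in> borel_measurable m2"
    using f m by (auto simp: fin_meas_def intro: borel_measurable_sets_cong)
  show "(\<integral>\<^sup>+z. f (fst z) \<partial>\<gamma>) = (\<integral>\<^sup>+x. f x \<partial>m1)"
    using nn_integral_distr[OF pair_fst_snd'(1)[OF gD(1) m(1)], of f] fm(1) by (simp add: gD(2))
  show "(\<integral>\<^sup>+z. f (snd z) \<partial>\<gamma>) = (\<integral>\<^sup>+x. f x \<partial>m2)"
    using nn_integral_distr[OF pair_fst_snd'(2)[OF gD(1) m(2)], of f] fm(2) by (simp add: gD(3))
qed

lemma coupling_integral:
  fixes f :: "'a::topological_space \<Rightarrow> real"
  assumes g: "\<gamma> \<in> couplings m1 m2" and m: "fin_meas \<Omega> m1" "fin_meas \<Omega> m2"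
    and f: "f \<in> borel_measurable (borel_on \<Omega>)"
  shows "(\<integral>z. f (fst z) \<partial>\<gamma>) = (\<integral>x. f x \<partial>m1)" "(\<integral>z. f (snd z) \<partial>\<gamma>) = (\<integral>x. f x \<partial>m2)"
proof -
  note gD = couplingsD[OF g m]
  have fm: "f \<in> borel_measurable m1" "f \<in> borel_measurable m2"
    using f m by (auto simp: fin_meas_def intro: borel_measurable_sets_cong)
  show "(\<integral>z. f (fst z) \<partial>\<gamma>) = (\<integral>x. f x \<partial>m1)"
    using integral_distr[OF pair_fst_snd'(1)[OF gD(1) m(1)] fm(1)] by (simp add: gD(2))
  show "(\<integral>z. f (snd z) \<partial>\<gamma>) = (\<integral>x. f x \<partial>m2)"
    using integral_distr[OF pair_fst_snd'(2)[OF gD(1) m(2)] fm(2)] by (simp add: gD(3))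
qed

text \<open>
  The factor \<open>k\<close> cuts the density \<open>f'\<close> down to \<open>min f f'\<close>; it is how a marginal is brought below a Jordan part.
\<close>

lemma thinned_dens_le:
  assumes l: "fin_meas \<Omega> l" and f: "weight \<Omega> f" "weight \<Omega> f'" and k: "weight \<Omega> k"
    and km: "\<And>x. f' x * k x = min (f x) (f' x)" and B: "B \<in> sets (borel_on \<Omega>)"
  shows "(\<integral>\<^sup>+x. ennreal (k x) * indicator B x \<partial>dens l f') \<le> emeasure (dens l f) B"
proof -
  have "(\<integral>\<^sup>+x. ennreal (k x) * indicator B x \<partial>dens l f') = (\<integral>\<^sup>+x. ennreal (f' x) * (ennreal (k x) * indicator B x) \<partial>l)"
    unfolding dens_def using weight_borel[OF l f(2)] weight_borel[OF l k] B l
    by (intro nn_integral_density) (auto simp: fin_meas_def)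
  also have "\<dots> \<le> (\<integral>\<^sup>+x. ennreal (f x) * indicator B x \<partial>l)"
  proof (intro nn_integral_mono)
    fix x
    have "ennreal (f' x) * ennreal (k x) = ennreal (min (f x) (f' x))"
      using weightD(1)[OF f(2)] weightD(1)[OF k] by (simp add: ennreal_mult[symmetric] km)
    also have "\<dots> \<le> ennreal (f x)" by (intro ennreal_leI) simp
    finally show "ennreal (f' x) * (ennreal (k x) * indicator B x) \<le> ennreal (f x) * indicator B x"
      by (simp add: mult.assoc[symmetric] mult_right_mono)
  qed
  also have "\<dots> = emeasure (dens l f) B" by (rule emeasure_dens[OF l f(1) B, symmetric])
  finally show ?thesis .
qed

text \<open>
  Mass of \<open>\<nu>\<^sub>+\<close> exceeding \<open>\<mu>\<^sub>+\<close> was created at one point only to be moved away, so it is no more expensive to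
  drop its transport and create it at the target instead; the same holds for \<open>\<nu>\<^sub>-\<close> and \<open>\<mu>\<^sub>-\<close>. The plan is
  multiplied by \<open>k\<^sub>1(x) k\<^sub>2(y)\<close>, where \<open>k\<^sub>1\<close> and \<open>k\<^sub>2\<close> cut the marginals down to \<open>min \<mu>\<^sub>+ \<nu>\<^sub>+\<close> and
  \<open>min \<mu>\<^sub>- \<nu>\<^sub>-\<close>. With respect to a common reference measure, mutual singularity gives
  \<open>\<bar>f\<^sub>a - f\<^sub>b - f\<^sub>1 + f\<^sub>2\<bar> \<ge> f\<^sub>a + f\<^sub>b + f\<^sub>1 + f\<^sub>2 - 2 min f\<^sub>a f\<^sub>1 - 2 min f\<^sub>b f\<^sub>2\<close> for the densities \<open>f\<^sub>a\<close>, \<open>f\<^sub>b\<close> of \<open>\<mu>\<^sub>+\<close>, \<open>\<mu>\<^sub>-\<close>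
  and \<open>f\<^sub>1\<close>, \<open>f\<^sub>2\<close> of \<open>\<nu>\<^sub>+\<close>, \<open>\<nu>\<^sub>-\<close>,
  and the comparison of costs reduces to \<open>(1 - k\<^sub>1)(1 - k\<^sub>2) \<ge> 0\<close>.
\<close>

lemma ex_dominated_subplan:
  fixes \<Omega> :: "'a::euclidean_space set"
  assumes mu: "\<mu> \<in> signed_measures \<Omega>" and nu: "\<nu> \<in> signed_measures \<Omega>"
    and g: "\<gamma> \<in> couplings (pos_part \<Omega> \<nu>) (neg_part \<Omega> \<nu>)"
    and int: "integrable \<gamma> (\<lambda>z. norm (fst z - snd z) powr p)" and ab: "0 \<le> \<alpha>" "0 \<le> \<beta>"
  shows "\<exists>\<gamma>'. subplan \<Omega> p (pos_part \<Omega> \<mu>) (neg_part \<Omega> \<mu>) \<gamma>' \<and>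
     plan_cost \<Omega> p \<alpha> \<beta> (pos_part \<Omega> \<mu>) (neg_part \<Omega> \<mu>) \<gamma>'
       \<le> (\<integral>z. norm (fst z - snd z) powr p \<partial>\<gamma>) + \<beta> * measure \<gamma> (\<Omega> \<times> \<Omega>) + \<alpha> * tv \<Omega> (\<lambda>A. \<mu> A - \<nu> A) \<Omega>"
proof -
  let ?M = "borel_on \<Omega>"
  define a where "a = pos_part \<Omega> \<mu>"
  define b where "b = neg_part \<Omega> \<mu>"
  define n1 where "n1 = pos_part \<Omega> \<nu>"
  define n2 where "n2 = neg_part \<Omega> \<nu>"
  \<comment> \<open>A reference measure with respect to which all four parts have densities.\<close>
  define l where "l = add_measure (add_measure a b) (add_measure n1 n2)"
  note g' = g[folded n1_def n2_def]
  have m: "fin_meas \<Omega> a" "fin_meas \<Omega> b" "fin_meas \<Omega> n1" "fin_meas \<Omega> n2"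
    using fin_meas_parts mu nu by (simp_all add: a_def b_def n1_def n2_def)
  have fl: "fin_meas \<Omega> l" unfolding l_def by (intro fin_meas_add m)
  have sm: "sets a = sets ?M" "sets b = sets ?M" "sets n1 = sets ?M" "sets n2 = sets ?M"
    using m by (simp_all add: fin_meas_def)
  have le: "emeasure a B \<le> emeasure l B" "emeasure b B \<le> emeasure l B"
    "emeasure n1 B \<le> emeasure l B" "emeasure n2 B \<le> emeasure l B" for B
  proof -
    have 1: "emeasure (add_measure a b) B \<le> emeasure l B" "emeasure (add_measure n1 n2) B \<le> emeasure l B"
      unfolding l_def by (intro emeasure_add_le; simp add: sm)+
    show "emeasure a B \<le> emeasure l B" "emeasure b B \<le> emeasure l B"
      using emeasure_add_le[of b a B] 1 sm by (auto intro: order_trans)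
    show "emeasure n1 B \<le> emeasure l B" "emeasure n2 B \<le> emeasure l B"
      using emeasure_add_le[of n2 n1 B] 1 sm by (auto intro: order_trans)
  qed
  obtain P where P: "P \<in> sets ?M" "emeasure a (\<Omega> - P) = 0" "emeasure b P = 0"
    using Jordan_parts[OF mu] by (auto simp: is_jordan_decomposition_def a_def b_def)
  obtain Q where Q: "Q \<in> sets ?M" "emeasure n1 (\<Omega> - Q) = 0" "emeasure n2 Q = 0"
    using Jordan_parts[OF nu] by (auto simp: is_jordan_decomposition_def n1_def n2_def)
  have PO: "P \<subseteq> \<Omega>" "Q \<subseteq> \<Omega>" using sets.sets_into_space[OF P(1)] sets.sets_into_space[OF Q(1)] by simp_all
  have C: "\<Omega> - P \<in> sets ?M" "\<Omega> - Q \<in> sets ?M" using P(1) Q(1) Omega_sets by auto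
  have DD: "\<Omega> - (\<Omega> - P) = P" "\<Omega> - (\<Omega> - Q) = Q" using PO by auto
  obtain fa where fa: "weight \<Omega> fa" "\<And>x. x \<notin> P \<Longrightarrow> fa x = 0" "a = dens l fa"
    using ex_dens[OF fl m(1) le(1) P(1,2)] by blast
  obtain fb where fb: "weight \<Omega> fb" "\<And>x. x \<notin> \<Omega> - P \<Longrightarrow> fb x = 0" "b = dens l fb"
    using ex_dens[OF fl m(2) le(2) C(1)] P(3) unfolding DD by blast
  obtain f1 where f1: "weight \<Omega> f1" "\<And>x. x \<notin> Q \<Longrightarrow> f1 x = 0" "n1 = dens l f1"
    using ex_dens[OF fl m(3) le(3) Q(1,2)] by blast
  obtain f2 where f2: "weight \<Omega> f2" "\<And>x. x \<notin> \<Omega> - Q \<Longrightarrow> f2 x = 0" "n2 = dens l f2"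
    using ex_dens[OF fl m(4) le(4) C(2)] Q(3) unfolding DD by blast
  \<comment> \<open>Where \<open>f1\<close> vanishes the quotient is \<open>0\<close>, which agrees with \<open>f1 * k1 = min fa f1\<close>.\<close>
  define k1 where "k1 = (\<lambda>x. min (fa x) (f1 x) / f1 x)"
  define k2 where "k2 = (\<lambda>x. min (fb x) (f2 x) / f2 x)"
  have kw: "weight \<Omega> (\<lambda>x. min (f x) (f' x) / f' x)" and km: "f' x * (min (f x) (f' x) / f' x) = min (f x) (f' x)"
    if "weight \<Omega> f" "weight \<Omega> f'" for f f' x
  proof -
    have "0 \<le> min (f y) (f' y) / f' y \<and> min (f y) (f' y) / f' y \<le> 1" for y
      using weightD(1)[OF that(1), of y] weightD(1)[OF that(2), of y] by (auto simp: divide_le_eq_1 order_less_le)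
    then show "weight \<Omega> (\<lambda>x. min (f x) (f' x) / f' x)"
      using weightD(3)[OF that(1)] weightD(3)[OF that(2)] by (auto simp: weight_def)
    show "f' x * (min (f x) (f' x) / f' x) = min (f x) (f' x)"
      using weightD(1)[OF that(1), of x] by (cases "f' x = 0") simp_all
  qed
  have k1: "weight \<Omega> k1" "\<And>x. f1 x * k1 x = min (fa x) (f1 x)"
    unfolding k1_def by (rule kw[OF fa(1) f1(1)], rule km[OF fa(1) f1(1)])
  have k2: "weight \<Omega> k2" "\<And>x. f2 x * k2 x = min (fb x) (f2 x)"
    unfolding k2_def by (rule kw[OF fb(1) f2(1)], rule km[OF fb(1) f2(1)])
  note gD = couplingsD[OF g' m(3,4)]
  interpret g: finite_measure \<gamma> by (rule coupling_mass[OF g' m(3,4)])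
  have spg: "space \<gamma> = \<Omega> \<times> \<Omega>" by (rule pair_space[OF gD(1)])
  define k where "k = (\<lambda>z. k1 (fst z) * k2 (snd z))"
  have k1m: "(\<lambda>z. k1 (fst z)) \<in> borel_measurable \<gamma>" and k2m: "(\<lambda>z. k2 (snd z)) \<in> borel_measurable \<gamma>"
    using measurable_compose[OF pair_fst_snd(1)[OF gD(1)] weightD(3)[OF k1(1)]]
      measurable_compose[OF pair_fst_snd(2)[OF gD(1)] weightD(3)[OF k2(1)]] by simp_all
  then have kmeas: "k \<in> borel_measurable \<gamma>" unfolding k_def by simp
  have kb: "0 \<le> k1 x" "k1 x \<le> 1" "0 \<le> k2 x" "k2 x \<le> 1" for x
    using weightD[OF k1(1)] weightD[OF k2(1)] by simp_all
  have kl: "k z \<le> k1 (fst z)" "k z \<le> k2 (snd z)" "0 \<le> k z" "k z \<le> 1" for z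
    using kb by (auto simp: k_def mult_left_le mult_left_le_one_le mult_le_one)
  define \<gamma>' where "\<gamma>' = density \<gamma> (\<lambda>z. ennreal (k z))"
  have sg': "sets \<gamma>' = sets (?M \<Otimes>\<^sub>M ?M)" by (simp add: \<gamma>'_def gD(1))
  have marg1: "emeasure \<gamma>' (B \<times> \<Omega>) \<le> emeasure a B" if B: "B \<in> sets ?M" for B
  proof -
    have "B \<times> \<Omega> \<in> sets \<gamma>" using B Omega_sets gD(1) by auto
    then have "emeasure \<gamma>' (B \<times> \<Omega>) = (\<integral>\<^sup>+z. ennreal (k z) * indicator (B \<times> \<Omega>) z \<partial>\<gamma>)"
      unfolding \<gamma>'_def using kmeas by (intro emeasure_density) simp_all
    also have "\<dots> \<le> (\<integral>\<^sup>+z. ennreal (k1 (fst z)) * indicator B (fst z) \<partial>\<gamma>)"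
      using kl(1) by (intro nn_integral_mono) (auto simp: indicator_def intro: ennreal_leI)
    also have "\<dots> = (\<integral>\<^sup>+x. ennreal (k1 x) * indicator B x \<partial>n1)"
      using weightD(3)[OF k1(1)] B by (intro coupling_nn_integral(1)[OF g' m(3,4)]) simp
    also have "\<dots> \<le> emeasure a B"
      unfolding fa(3) by (subst f1(3), rule thinned_dens_le[OF fl fa(1) f1(1) k1 B])
    finally show ?thesis .
  qed
  have marg2: "emeasure \<gamma>' (\<Omega> \<times> B) \<le> emeasure b B" if B: "B \<in> sets ?M" for B
  proof -
    have "\<Omega> \<times> B \<in> sets \<gamma>" using B Omega_sets gD(1) by auto
    then have "emeasure \<gamma>' (\<Omega> \<times> B) = (\<integral>\<^sup>+z. ennreal (k z) * indicator (\<Omega> \<times> B) z \<partial>\<gamma>)"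
      unfolding \<gamma>'_def using kmeas by (intro emeasure_density) simp_all
    also have "\<dots> \<le> (\<integral>\<^sup>+z. ennreal (k2 (snd z)) * indicator B (snd z) \<partial>\<gamma>)"
      using kl(2) by (intro nn_integral_mono) (auto simp: indicator_def intro: ennreal_leI)
    also have "\<dots> = (\<integral>\<^sup>+x. ennreal (k2 x) * indicator B x \<partial>n2)"
      using weightD(3)[OF k2(1)] B by (intro coupling_nn_integral(2)[OF g' m(3,4)]) simp
    also have "\<dots> \<le> emeasure b B"
      unfolding fb(3) by (subst f2(3), rule thinned_dens_le[OF fl fb(1) f2(1) k2 B])
    finally show ?thesis .
  qed
  let ?d = "\<lambda>z::'a\<times>'a. norm (fst z - snd z) powr p"
  have dm: "?d \<in> borel_measurable \<gamma>" by (rule cost_measurable[OF gD(1)])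
  have ik: "integrable \<gamma> k" "integrable \<gamma> (\<lambda>z. k1 (fst z))" "integrable \<gamma> (\<lambda>z. k2 (snd z))"
    using kl kb kmeas k1m k2m by (auto intro!: g.integrable_const_bound[where B = 1])
  have ikd: "integrable \<gamma> (\<lambda>z. k z * ?d z)"
    using kl dm kmeas by (intro Bochner_Integration.integrable_bound[OF int]) (auto simp: abs_mult mult_left_le_one_le)
  have sub: "subplan \<Omega> p a b \<gamma>'"
    unfolding subplan_def
  proof (intro conjI ballI)
    show "integrable \<gamma>' ?d"
      unfolding \<gamma>'_def using ikd dm kmeas kl(3) by (subst integrable_density) auto
  qed (use sg' marg1 marg2 in auto)
  have mass': "measure \<gamma>' (\<Omega> \<times> \<Omega>) = (\<integral>z. k z \<partial>\<gamma>)"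
  proof -
    have "measure \<gamma>' (\<Omega> \<times> \<Omega>) = (\<integral>z. 1 \<partial>\<gamma>')" using spg by (simp add: \<gamma>'_def)
    also have "\<dots> = (\<integral>z. k z *\<^sub>R 1 \<partial>\<gamma>)" unfolding \<gamma>'_def using kmeas kl(3) by (intro integral_density) auto
    finally show ?thesis by simp
  qed
  have cost': "(\<integral>z. ?d z \<partial>\<gamma>') = (\<integral>z. k z * ?d z \<partial>\<gamma>)"
    unfolding \<gamma>'_def using kmeas kl(3) dm by (subst integral_density) auto
  have iw: "integrable l f" if "weight \<Omega> f" for f
    by (rule bdd_meas_integrable[OF fl weight_bdd_meas[OF that]])
  have tot: "measure (dens l f) \<Omega> = (\<integral>x. f x \<partial>l)" if "weight \<Omega> f" for f
    unfolding measure_dens[OF fl that Omega_sets]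
    by (rule Bochner_Integration.integral_cong) (use fin_measD(3)[OF fl] in auto)
  have totals: "measure a \<Omega> = (\<integral>x. fa x \<partial>l)" "measure b \<Omega> = (\<integral>x. fb x \<partial>l)"
    "measure n1 \<Omega> = (\<integral>x. f1 x \<partial>l)" "measure n2 \<Omega> = (\<integral>x. f2 x \<partial>l)"
    unfolding fa(3) fb(3) f1(3) f2(3) using fa(1) fb(1) f1(1) f2(1) by (simp_all only: tot)
  have K1: "(\<integral>z. k1 (fst z) \<partial>\<gamma>) = (\<integral>x. min (fa x) (f1 x) \<partial>l)"
    unfolding coupling_integral(1)[OF g' m(3,4) weightD(3)[OF k1(1)]]
    by (subst f1(3), subst integral_dens[OF fl f1(1) weight_borel[OF fl k1(1)]]) (simp add: k1(2))
  have K2: "(\<integral>z. k2 (snd z) \<partial>\<gamma>) = (\<integral>x. min (fb x) (f2 x) \<partial>l)"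
    unfolding coupling_integral(2)[OF g' m(3,4) weightD(3)[OF k2(1)]]
    by (subst f2(3), subst integral_dens[OF fl f2(1) weight_borel[OF fl k2(1)]]) (simp add: k2(2))
  have one: "measure \<gamma> (\<Omega> \<times> \<Omega>) = measure n1 \<Omega>" "measure n1 \<Omega> = measure n2 \<Omega>"
  proof -
    show e: "measure \<gamma> (\<Omega> \<times> \<Omega>) = measure n1 \<Omega>" by (rule coupling_mass(2)[OF g' m(3,4)])
    have "measure n1 \<Omega> = (\<integral>z. 1 \<partial>\<gamma>)" using e spg by simp
    also have "\<dots> = (\<integral>z. 1 \<partial>n2)" using coupling_integral(2)[OF g' m(3,4), of "\<lambda>_. 1"] by simp
    finally show "measure n1 \<Omega> = measure n2 \<Omega>" using fin_measD(3)[OF m(4)] by simp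
  qed
  define h where "h = (\<lambda>x. fa x - fb x - f1 x + f2 x)"
  note fm = weightD(3)[OF fa(1)] weightD(3)[OF fb(1)] weightD(3)[OF f1(1)] weightD(3)[OF f2(1)]
  have hm: "h \<in> borel_measurable ?M" unfolding h_def using fm by simp
  define E where "E = {x \<in> \<Omega>. 0 \<le> h x}"
  have E: "E \<in> sets ?M"
  proof -
    have "{x \<in> space ?M. 0 \<le> h x} \<in> sets ?M" using hm by measurable
    then show ?thesis by (simp add: E_def)
  qed
  have OE: "\<Omega> - E \<in> sets ?M" using E Omega_sets by auto
  have sB: "\<mu> B - \<nu> B = (\<integral>x. h x * indicator B x \<partial>l)" if B: "B \<in> sets ?M" for B
  proof -
    have i: "integrable l (\<lambda>x. f x * indicator B x)" if "weight \<Omega> f" for f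
      by (rule iw[OF weight_mult_indicator[OF that B]])
    have "\<mu> B - \<nu> B = measure a B - measure b B - (measure n1 B - measure n2 B)"
      using parts_eq[OF mu, of B] parts_eq[OF nu, of B] by (simp add: a_def b_def n1_def n2_def)
    also have "\<dots> = (\<integral>x. fa x * indicator B x \<partial>l) - (\<integral>x. fb x * indicator B x \<partial>l)
        - ((\<integral>x. f1 x * indicator B x \<partial>l) - (\<integral>x. f2 x * indicator B x \<partial>l))"
      unfolding fa(3) fb(3) f1(3) f2(3) using fa(1) fb(1) f1(1) f2(1) by (simp only: measure_dens[OF fl _ B])
    also have "\<dots> = (\<integral>x. h x * indicator B x \<partial>l)"
      using i[OF fa(1)] i[OF fb(1)] i[OF f1(1)] i[OF f2(1)] by (simp add: h_def algebra_simps)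
    finally show ?thesis .
  qed
  have il: "integrable l h" unfolding h_def using iw fa(1) fb(1) f1(1) f2(1) by simp
  have imin: "integrable l (\<lambda>x. min (fa x) (f1 x))" "integrable l (\<lambda>x. min (fb x) (f2 x))"
    using iw fa(1) fb(1) f1(1) f2(1) by (auto intro: integrable_min)
  have "(\<integral>x. fa x + fb x + f1 x + f2 x - 2 * min (fa x) (f1 x) - 2 * min (fb x) (f2 x) \<partial>l) \<le> (\<integral>x. \<bar>h x\<bar> \<partial>l)"
  proof (rule integral_mono)
    fix x assume "x \<in> space l"
    have "fb x = 0 \<or> fa x = 0" "f2 x = 0 \<or> f1 x = 0" using fa(2)[of x] fb(2)[of x] f1(2)[of x] f2(2)[of x] by blast+
    then show "fa x + fb x + f1 x + f2 x - 2 * min (fa x) (f1 x) - 2 * min (fb x) (f2 x) \<le> \<bar>h x\<bar>"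
      using weightD(1)[OF fa(1), of x] weightD(1)[OF fb(1), of x] weightD(1)[OF f1(1), of x] weightD(1)[OF f2(1), of x]
      unfolding h_def by (auto simp: min_def)
  qed (use il imin iw fa(1) fb(1) f1(1) f2(1) in auto)
  also have "(\<integral>x. fa x + fb x + f1 x + f2 x - 2 * min (fa x) (f1 x) - 2 * min (fb x) (f2 x) \<partial>l)
     = measure a \<Omega> + measure b \<Omega> + measure n1 \<Omega> + measure n2 \<Omega> - 2 * (\<integral>z. k1 (fst z) \<partial>\<gamma>) - 2 * (\<integral>z. k2 (snd z) \<partial>\<gamma>)"
    using imin iw fa(1) fb(1) f1(1) f2(1) by (simp add: totals K1 K2)
  also have "(\<integral>x. \<bar>h x\<bar> \<partial>l) = (\<integral>x. h x * indicator E x - h x * indicator (\<Omega> - E) x \<partial>l)"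
    using fin_measD(3)[OF fl] by (intro Bochner_Integration.integral_cong) (auto simp: E_def indicator_def)
  also have "\<dots> = (\<mu> E - \<nu> E) - (\<mu> (\<Omega> - E) - \<nu> (\<Omega> - E))"
  proof -
    have "integrable l (\<lambda>x. h x * indicator B x)" if "B \<in> sets ?M" for B
      using that fl by (intro integrable_real_mult_indicator il) (simp add: fin_meas_def)
    from this[OF E] this[OF OE] show ?thesis by (simp add: sB[OF E] sB[OF OE])
  qed
  also have "\<dots> \<le> tv \<Omega> (\<lambda>A. \<mu> A - \<nu> A) \<Omega>"
    using sets.sets_into_space[OF E] by (intro tv_ge signed_measures_diff mu nu Omega_sets E) simp
  finally have T: "measure a \<Omega> + measure b \<Omega> + measure n1 \<Omega> + measure n2 \<Omega> - 2 * (\<integral>z. k1 (fst z) \<partial>\<gamma>) - 2 * (\<integral>z. k2 (snd z) \<partial>\<gamma>)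
     \<le> tv \<Omega> (\<lambda>A. \<mu> A - \<nu> A) \<Omega>" .
  define m0 where "m0 = measure \<gamma> (\<Omega> \<times> \<Omega>)"
  have "0 \<le> (\<integral>z. (1 - k1 (fst z)) * (1 - k2 (snd z)) \<partial>\<gamma>)"
    using kb by (intro integral_nonneg_AE AE_I2) simp
  also have "\<dots> = (\<integral>z. 1 - k1 (fst z) - k2 (snd z) + k z \<partial>\<gamma>)" by (simp add: k_def algebra_simps)
  also have "\<dots> = m0 - (\<integral>z. k1 (fst z) \<partial>\<gamma>) - (\<integral>z. k2 (snd z) \<partial>\<gamma>) + (\<integral>z. k z \<partial>\<gamma>)"
    using ik spg by (simp add: m0_def)
  finally have I1: "0 \<le> m0 - (\<integral>z. k1 (fst z) \<partial>\<gamma>) - (\<integral>z. k2 (snd z) \<partial>\<gamma>) + (\<integral>z. k z \<partial>\<gamma>)" .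
  have I2: "(\<integral>z. k z * ?d z \<partial>\<gamma>) \<le> (\<integral>z. ?d z \<partial>\<gamma>)"
    using ikd int kl by (intro integral_mono) (auto simp: mult_left_le_one_le)
  have "(\<integral>z. k z \<partial>\<gamma>) \<le> (\<integral>z. 1 \<partial>\<gamma>)" using ik kl by (intro integral_mono) auto
  then have I3: "(\<integral>z. k z \<partial>\<gamma>) \<le> m0" using spg by (simp add: m0_def)
  have "measure a \<Omega> + measure b \<Omega> - 2 * (\<integral>z. k z \<partial>\<gamma>) \<le> tv \<Omega> (\<lambda>A. \<mu> A - \<nu> A) \<Omega>"
    using T I1 one unfolding m0_def by linarith
  then have "\<alpha> * (measure a \<Omega> + measure b \<Omega> - 2 * (\<integral>z. k z \<partial>\<gamma>)) \<le> \<alpha> * tv \<Omega> (\<lambda>A. \<mu> A - \<nu> A) \<Omega>"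
    using ab by (intro mult_left_mono)
  moreover have "\<beta> * (\<integral>z. k z \<partial>\<gamma>) \<le> \<beta> * m0" using I3 ab by (intro mult_left_mono)
  ultimately have "plan_cost \<Omega> p \<alpha> \<beta> a b \<gamma>' \<le> (\<integral>z. ?d z \<partial>\<gamma>) + \<beta> * m0 + \<alpha> * tv \<Omega> (\<lambda>A. \<mu> A - \<nu> A) \<Omega>"
    using I2 by (simp add: plan_cost_def mass' cost')
  then show ?thesis using sub unfolding a_def b_def m0_def by blast
qed

text \<open>
  Hence the norm of \<open>\<mu>\<close> is the infimum of the plan costs. The properties of the norm below are read off from
  operations on plans.
\<close>

lemma ex_subplan:
  fixes \<Omega> :: "'a::euclidean_space set"
  assumes mu: "\<mu> \<in> signed_measures \<Omega>" and ab: "0 \<le> \<alpha>" "0 \<le> \<beta>" and r: "KR_norm \<Omega> p \<alpha> \<beta> \<mu> < ennreal r"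
  obtains \<gamma> where "subplan \<Omega> p (pos_part \<Omega> \<mu>) (neg_part \<Omega> \<mu>) \<gamma>"
    "plan_cost \<Omega> p \<alpha> \<beta> (pos_part \<Omega> \<mu>) (neg_part \<Omega> \<mu>) \<gamma> < r"
proof (rule ccontr)
  assume "\<not> thesis"
  then have n: "r \<le> plan_cost \<Omega> p \<alpha> \<beta> (pos_part \<Omega> \<mu>) (neg_part \<Omega> \<mu>) \<gamma>"
    if "subplan \<Omega> p (pos_part \<Omega> \<mu>) (neg_part \<Omega> \<mu>) \<gamma>" for \<gamma>
    using that \<open>\<And>\<gamma>. subplan \<Omega> p (pos_part \<Omega> \<mu>) (neg_part \<Omega> \<mu>) \<gamma> \<Longrightarrow>
      plan_cost \<Omega> p \<alpha> \<beta> (pos_part \<Omega> \<mu>) (neg_part \<Omega> \<mu>) \<gamma> < r \<Longrightarrow> thesis\<close> by force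
  have "ennreal r \<le> KR_norm \<Omega> p \<alpha> \<beta> \<mu>"
  proof (rule KR_norm_geI[OF mu ab])
    fix \<nu> \<gamma>
    assume nu: "\<nu> \<in> radon_measures \<Omega>" and g: "\<gamma> \<in> couplings (pos_part \<Omega> \<nu>) (neg_part \<Omega> \<nu>)"
      and int: "integrable \<gamma> (\<lambda>z. norm (fst z - snd z) powr p)"
    show "r \<le> (\<integral>z. norm (fst z - snd z) powr p \<partial>\<gamma>) + \<beta> * measure \<gamma> (\<Omega> \<times> \<Omega>) + \<alpha> * tv \<Omega> (\<lambda>A. \<mu> A - \<nu> A) \<Omega>"
      using ex_dominated_subplan[OF mu radon_signed[OF nu] g int ab] n by (meson order_trans)
  qed
  then show False using r by simp
qed


section \<open>Homogeneity, symmetry and continuity of the norm\<close>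

lemma radon_jordan: "\<mu> \<in> radon_measures \<Omega> \<Longrightarrow> is_jordan_decomposition \<Omega> \<mu> (pos_part \<Omega> \<mu>) (neg_part \<Omega> \<mu>)"
  by (intro Jordan_parts radon_signed)

lemma KR_norm_transfer:
  assumes "\<And>r. KR_norm \<Omega> p \<alpha> \<beta> \<mu> < ennreal r \<Longrightarrow> X \<le> ennreal r"
  shows "X \<le> KR_norm \<Omega> p \<alpha> \<beta> \<mu>"
proof (rule dense_ge)
  fix y assume y: "KR_norm \<Omega> p \<alpha> \<beta> \<mu> < y"
  show "X \<le> y" using assms y by (cases y) auto
qed

lemma subplan_swap:
  assumes s: "subplan \<Omega> p a b \<gamma>"
  defines "\<gamma>' \<equiv> distr \<gamma> (borel_on \<Omega> \<Otimes>\<^sub>M borel_on \<Omega>) (\<lambda>z. (snd z, fst z))"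
  shows "subplan \<Omega> p b a \<gamma>'" "plan_cost \<Omega> p \<alpha> \<beta> b a \<gamma>' = plan_cost \<Omega> p \<alpha> \<beta> a b \<gamma>"
proof -
  let ?M = "borel_on \<Omega>"
  have sg: "sets \<gamma> = sets (?M \<Otimes>\<^sub>M ?M)" and int: "integrable \<gamma> (\<lambda>z. norm (fst z - snd z) powr p)"
    using s by (simp_all add: subplan_def)
  have sw: "(\<lambda>z. (snd z, fst z)) \<in> measurable \<gamma> (?M \<Otimes>\<^sub>M ?M)"
    using pair_fst_snd[OF sg] by (intro measurable_Pair) simp_all
  have sg': "sets \<gamma>' = sets (?M \<Otimes>\<^sub>M ?M)" by (simp add: \<gamma>'_def)
  have dm: "(\<lambda>z. norm (fst z - snd z) powr p) \<in> borel_measurable (?M \<Otimes>\<^sub>M ?M)" by (rule cost_measurable[OF refl])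
  have em: "emeasure \<gamma>' (A \<times> B) = emeasure \<gamma> (B \<times> A)" if "A \<in> sets ?M" "B \<in> sets ?M" for A B
  proof -
    have "(\<lambda>z. (snd z, fst z)) -` (A \<times> B) \<inter> space \<gamma> = B \<times> A"
      using sets.sets_into_space[OF that(1)] sets.sets_into_space[OF that(2)] pair_space[OF sg] by auto
    then show ?thesis using that unfolding \<gamma>'_def by (subst emeasure_distr[OF sw]) auto
  qed
  show "subplan \<Omega> p b a \<gamma>'" unfolding subplan_def
  proof (intro conjI ballI)
    show "integrable \<gamma>' (\<lambda>z. norm (fst z - snd z) powr p)"
      unfolding \<gamma>'_def using int by (subst integrable_distr_eq[OF sw dm]) (simp add: norm_minus_commute)
    fix B assume "B \<in> sets ?M"
    then show "emeasure \<gamma>' (B \<times> \<Omega>) \<le> emeasure b B" "emeasure \<gamma>' (\<Omega> \<times> B) \<le> emeasure a B"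
      using s by (simp_all add: em Omega_sets subplan_def)
  qed (rule sg')
  have "(\<integral>z. norm (fst z - snd z) powr p \<partial>\<gamma>') = (\<integral>z. norm (fst z - snd z) powr p \<partial>\<gamma>)"
    unfolding \<gamma>'_def by (subst integral_distr[OF sw dm]) (simp add: norm_minus_commute)
  then show "plan_cost \<Omega> p \<alpha> \<beta> b a \<gamma>' = plan_cost \<Omega> p \<alpha> \<beta> a b \<gamma>"
    using em[OF Omega_sets Omega_sets] by (simp add: plan_cost_def measure_def)
qed

lemma jordan_minus:
  assumes "is_jordan_decomposition \<Omega> \<mu> a b" shows "is_jordan_decomposition \<Omega> (\<lambda>A. - \<mu> A) b a"
proof -
  obtain P where P: "P \<in> sets (borel_on \<Omega>)" "emeasure a (\<Omega> - P) = 0" "emeasure b P = 0"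
    using assms by (auto simp: is_jordan_decomposition_def)
  have "\<Omega> - (\<Omega> - P) = P" using sets.sets_into_space[OF P(1)] by auto
  then show ?thesis
    using assms P Omega_sets[of \<Omega>] unfolding is_jordan_decomposition_def
    by (intro conjI bexI[of _ "\<Omega> - P"]) auto
qed

lemma radon_minus:
  fixes \<Omega> :: "'a::t2_space set"
  assumes mu: "\<mu> \<in> radon_measures \<Omega>" shows "(\<lambda>A. - \<mu> A) \<in> radon_measures \<Omega>"
  using radon_scale[OF mu, of "-1"] by simp

lemma KR_norm_minus:
  fixes \<Omega> :: "'a::euclidean_space set"
  assumes mu: "\<mu> \<in> radon_measures \<Omega>" and ab: "0 \<le> \<alpha>" "0 \<le> \<beta>"
  shows "KR_norm \<Omega> p \<alpha> \<beta> (\<lambda>A. - \<mu> A) \<le> KR_norm \<Omega> p \<alpha> \<beta> \<mu>"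
proof (rule KR_norm_transfer)
  fix r assume "KR_norm \<Omega> p \<alpha> \<beta> \<mu> < ennreal r"
  then obtain \<gamma> where g: "subplan \<Omega> p (pos_part \<Omega> \<mu>) (neg_part \<Omega> \<mu>) \<gamma>"
    "plan_cost \<Omega> p \<alpha> \<beta> (pos_part \<Omega> \<mu>) (neg_part \<Omega> \<mu>) \<gamma> < r"
    using ex_subplan[OF radon_signed[OF mu] ab] by blast
  note sw = subplan_swap[OF g(1)]
  have "KR_norm \<Omega> p \<alpha> \<beta> (\<lambda>A. - \<mu> A) \<le> ennreal (plan_cost \<Omega> p \<alpha> \<beta> (pos_part \<Omega> \<mu>) (neg_part \<Omega> \<mu>) \<gamma>)"
    using KR_norm_le_plan_cost[OF radon_minus[OF mu] jordan_minus[OF radon_jordan[OF mu]] sw(1) ab] by (simp add: sw(2))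
  also have "\<dots> \<le> ennreal r" using g(2) by (intro ennreal_leI) simp
  finally show "KR_norm \<Omega> p \<alpha> \<beta> (\<lambda>A. - \<mu> A) \<le> ennreal r" .
qed

lemma jordan_scale:
  assumes J: "is_jordan_decomposition \<Omega> \<mu> a b" and c: "0 \<le> c"
  shows "is_jordan_decomposition \<Omega> (\<lambda>A. c * \<mu> A) (density a (\<lambda>_. ennreal c)) (density b (\<lambda>_. ennreal c))"
proof -
  have f: "fin_meas \<Omega> a" "fin_meas \<Omega> b" using J by (simp_all add: is_jordan_decomposition_def fin_meas_def)
  obtain P where P: "P \<in> sets (borel_on \<Omega>)" "emeasure a (\<Omega> - P) = 0" "emeasure b P = 0"
    using J by (auto simp: is_jordan_decomposition_def)
  have "\<Omega> - P \<in> sets (borel_on \<Omega>)" using P(1) Omega_sets by auto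
  then have z: "emeasure (density a (\<lambda>_. ennreal c)) (\<Omega> - P) = 0" "emeasure (density b (\<lambda>_. ennreal c)) P = 0"
    using P f by (simp_all add: emeasure_density_const fin_meas_def)
  have "c * \<mu> A = measure (density a (\<lambda>_. ennreal c)) A - measure (density b (\<lambda>_. ennreal c)) A"
    if "A \<in> sets (borel_on \<Omega>)" for A
    using J that by (simp add: measure_density_const'[OF f(1) c that] measure_density_const'[OF f(2) c that]
        is_jordan_decomposition_def right_diff_distrib)
  then show ?thesis
    using fin_meas_density_const[OF f(1), of c] fin_meas_density_const[OF f(2), of c] z P(1)
    unfolding is_jordan_decomposition_def fin_meas_def by blast
qed

lemma KR_norm_scale:
  fixes \<Omega> :: "'a::euclidean_space set"
  assumes mu: "\<mu> \<in> radon_measures \<Omega>" and ab: "0 \<le> \<alpha>" "0 \<le> \<beta>" and c: "0 < c"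
    and r: "KR_norm \<Omega> p \<alpha> \<beta> \<mu> \<le> ennreal r" "0 \<le> r"
  shows "KR_norm \<Omega> p \<alpha> \<beta> (\<lambda>A. c * \<mu> A) \<le> ennreal (c * r)"
proof (rule ennreal_le_epsilon)
  fix e :: real assume e: "0 < e"
  let ?M = "borel_on \<Omega>"
  let ?a = "pos_part \<Omega> \<mu>" and ?b = "neg_part \<Omega> \<mu>"
  note f = fin_meas_parts[OF radon_signed[OF mu]]
  have "0 < e / c" using e c by simp
  then have "ennreal r < ennreal (r + e / c)" using r(2) by (intro ennreal_lessI add_nonneg_pos) auto
  then have "KR_norm \<Omega> p \<alpha> \<beta> \<mu> < ennreal (r + e / c)" using r(1) by (rule le_less_trans[rotated])
  then obtain \<gamma> where g: "subplan \<Omega> p ?a ?b \<gamma>" "plan_cost \<Omega> p \<alpha> \<beta> ?a ?b \<gamma> < r + e / c"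
    using ex_subplan[OF radon_signed[OF mu] ab] by blast
  interpret g: finite_measure \<gamma> by (rule subplan_finite[OF f(1) g(1)])
  have sg: "sets \<gamma> = sets (?M \<Otimes>\<^sub>M ?M)" and int: "integrable \<gamma> (\<lambda>z. norm (fst z - snd z) powr p)"
    using g(1) by (simp_all add: subplan_def)
  have dm: "(\<lambda>z. norm (fst z - snd z) powr p) \<in> borel_measurable \<gamma>" using int by simp
  define \<gamma>' where "\<gamma>' = density \<gamma> (\<lambda>_. ennreal c)"
  have em: "emeasure \<gamma>' (A \<times> B) = ennreal c * emeasure \<gamma> (A \<times> B)" if "A \<in> sets ?M" "B \<in> sets ?M" for A B
    using that unfolding \<gamma>'_def by (intro emeasure_density_const) (auto simp: sg)
  have sub: "subplan \<Omega> p (density ?a (\<lambda>_. ennreal c)) (density ?b (\<lambda>_. ennreal c)) \<gamma>'"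
    unfolding subplan_def
  proof (intro conjI ballI)
    show "sets \<gamma>' = sets (?M \<Otimes>\<^sub>M ?M)" by (simp add: \<gamma>'_def sg)
    show "integrable \<gamma>' (\<lambda>z. norm (fst z - snd z) powr p)"
      unfolding \<gamma>'_def using int dm c by (subst integrable_density) auto
    fix B assume B: "B \<in> sets ?M"
    show "emeasure \<gamma>' (B \<times> \<Omega>) \<le> emeasure (density ?a (\<lambda>_. ennreal c)) B"
         "emeasure \<gamma>' (\<Omega> \<times> B) \<le> emeasure (density ?b (\<lambda>_. ennreal c)) B"
      using g(1) B f by (simp_all add: em Omega_sets subplan_def emeasure_density_const fin_meas_def mult_left_mono)
  qed
  have "measure \<gamma>' (\<Omega> \<times> \<Omega>) = c * measure \<gamma> (\<Omega> \<times> \<Omega>)"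
    using em[OF Omega_sets Omega_sets] c by (simp add: measure_def enn2real_mult)
  moreover have "(\<integral>z. norm (fst z - snd z) powr p \<partial>\<gamma>') = c * (\<integral>z. norm (fst z - snd z) powr p \<partial>\<gamma>)"
    unfolding \<gamma>'_def using c dm by (subst integral_density) auto
  ultimately have cost: "plan_cost \<Omega> p \<alpha> \<beta> (density ?a (\<lambda>_. ennreal c)) (density ?b (\<lambda>_. ennreal c)) \<gamma>'
      = c * plan_cost \<Omega> p \<alpha> \<beta> ?a ?b \<gamma>"
    using c by (simp add: plan_cost_def measure_density_const'[OF f(1) _ Omega_sets] measure_density_const'[OF f(2) _ Omega_sets] algebra_simps)
  have "KR_norm \<Omega> p \<alpha> \<beta> (\<lambda>A. c * \<mu> A) \<le> ennreal (c * plan_cost \<Omega> p \<alpha> \<beta> ?a ?b \<gamma>)"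
    using KR_norm_le_plan_cost[OF radon_scale[OF mu] jordan_scale[OF radon_jordan[OF mu]] sub ab] c
    by (simp add: cost)
  also have "\<dots> \<le> ennreal (c * (r + e / c))" using g(2) c by (intro ennreal_leI mult_left_mono) auto
  also have "c * (r + e / c) = c * r + e" using c by (simp add: field_simps)
  also have "ennreal (c * r + e) = ennreal (c * r) + ennreal e" using c r e by (intro ennreal_plus) auto
  finally show "KR_norm \<Omega> p \<alpha> \<beta> (\<lambda>A. c * \<mu> A) \<le> ennreal (c * r) + ennreal e" .
qed

lemma KR_norm_perturb:
  fixes \<Omega> :: "'a::euclidean_space set"
  assumes mu: "\<mu> \<in> signed_measures \<Omega>" and mu': "\<mu>' \<in> signed_measures \<Omega>" and a: "0 \<le> \<alpha>"
    and d: "tv \<Omega> (\<lambda>A. \<mu>' A - \<mu> A) \<Omega> \<le> c"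
  shows "KR_norm \<Omega> p \<alpha> \<beta> \<mu>' \<le> KR_norm \<Omega> p \<alpha> \<beta> \<mu> + ennreal (\<alpha> * c)"
  unfolding KR_norm_def[of \<Omega> p \<alpha> \<beta> \<mu>]
proof (rule ennreal_le_INF_add)
  fix \<nu> assume r: "\<nu> \<in> radon_measures \<Omega>"
  note nu = radon_signed[OF r]
  have c: "0 \<le> c" using d tv_nonneg order_trans by blast
  let ?R = "W p (pos_part \<Omega> \<nu>) (neg_part \<Omega> \<nu>) + ennreal (\<beta> / 2) * total_variation \<Omega> \<nu> \<Omega> + (if \<nu> \<Omega> = 0 then 0 else \<infinity>)"
  have "tv \<Omega> (\<lambda>A. \<mu>' A - \<nu> A) \<Omega> \<le> tv \<Omega> (\<lambda>A. \<mu> A - \<nu> A) \<Omega> + c"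
    using tv_lincomb_le[OF signed_measures_diff[OF mu nu] signed_measures_diff[OF mu' mu] Omega_sets, of 1 1] d by simp
  then have "\<alpha> * tv \<Omega> (\<lambda>A. \<mu>' A - \<nu> A) \<Omega> \<le> \<alpha> * tv \<Omega> (\<lambda>A. \<mu> A - \<nu> A) \<Omega> + \<alpha> * c"
    using a by (simp add: distrib_left[symmetric] mult_left_mono)
  then have "ennreal (\<alpha> * tv \<Omega> (\<lambda>A. \<mu>' A - \<nu> A) \<Omega>) \<le> ennreal (\<alpha> * tv \<Omega> (\<lambda>A. \<mu> A - \<nu> A) \<Omega> + \<alpha> * c)"
    by (rule ennreal_leI)
  also have "\<dots> = ennreal (\<alpha> * tv \<Omega> (\<lambda>A. \<mu> A - \<nu> A) \<Omega>) + ennreal (\<alpha> * c)"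
    by (intro ennreal_plus mult_nonneg_nonneg a c tv_nonneg)
  finally have e: "ennreal \<alpha> * total_variation \<Omega> (\<lambda>A. \<mu>' A - \<nu> A) \<Omega> \<le>
    ennreal \<alpha> * total_variation \<Omega> (\<lambda>A. \<mu> A - \<nu> A) \<Omega> + ennreal (\<alpha> * c)"
    by (simp add: total_variation_eq_tv signed_measures_diff mu mu' nu ennreal_mult[symmetric] a tv_nonneg)
  have "KR_norm \<Omega> p \<alpha> \<beta> \<mu>' \<le> ?R + ennreal \<alpha> * total_variation \<Omega> (\<lambda>A. \<mu>' A - \<nu> A) \<Omega>"
    unfolding KR_norm_def by (rule INF_lower[OF r])
  also have "\<dots> \<le> ?R + (ennreal \<alpha> * total_variation \<Omega> (\<lambda>A. \<mu> A - \<nu> A) \<Omega> + ennreal (\<alpha> * c))"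
    by (intro add_left_mono e)
  finally show "KR_norm \<Omega> p \<alpha> \<beta> \<mu>' \<le> ?R + ennreal \<alpha> * total_variation \<Omega> (\<lambda>A. \<mu> A - \<nu> A) \<Omega> + ennreal (\<alpha> * c)"
    by (simp add: add.assoc)
qed

lemma bdd_meas_indicator: "B \<in> sets (borel_on \<Omega>) \<Longrightarrow> bdd_meas \<Omega> (indicator B)"
  by (intro weight_bdd_meas weight_indicator)

text \<open>
  A multiple of an indicator function with values in \<open>[-\<beta>/2, \<beta>/2]\<close> is a test function.
\<close>

lemma KR_norm_definite:
  fixes \<Omega> :: "'a::euclidean_space set"
  assumes mu: "\<mu> \<in> signed_measures \<Omega>" and ab: "0 < \<alpha>" "0 < \<beta>" "\<beta> < 2 * \<alpha>"
    and z: "KR_norm \<Omega> p \<alpha> \<beta> \<mu> = 0"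
  shows "\<mu> B = 0"
proof (cases "B \<in> sets (borel_on \<Omega>)")
  case True
  have "c * \<mu> B \<le> 0" if c: "\<bar>c\<bar> = \<beta> / 2" for c
  proof -
    have t: "test_fun \<Omega> p \<alpha> \<beta> (\<lambda>x. 0 + c * indicator B x)"
      unfolding test_fun_def
    proof (intro conjI ballI)
      show "(\<lambda>x. 0 + c * indicator B x) \<in> borel_measurable (borel_on \<Omega>)" using True by simp
      fix x
      show "\<bar>0 + c * indicator B x\<bar> \<le> \<alpha>" using c ab by (auto simp: indicator_def)
      fix y
      have "c * indicator B x - c * indicator B y \<le> \<beta>"
        using c ab by (auto simp: indicator_def)
      moreover have "0 \<le> norm (x - y) powr p" by simp
      ultimately show "0 + c * indicator B x - (0 + c * indicator B y) \<le> \<beta> + norm (x - y) powr p"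
        by linarith
    qed
    have "ennreal (sint \<Omega> \<mu> (\<lambda>x. 0 + c * indicator B x)) \<le> 0"
      using KR_norm_dual[OF mu _ _ t] ab z by simp
    then have "sint \<Omega> \<mu> (\<lambda>x. 0 + c * indicator B x) \<le> 0" by (simp add: ennreal_eq_0_iff)
    moreover have "sint \<Omega> \<mu> (\<lambda>x. 0 + c * indicator B x) = sint \<Omega> \<mu> (\<lambda>_. 0) + c * \<mu> B"
      using sint_fun_add[OF mu _ bdd_meas_indicator[OF True], of "\<lambda>_. 0" c] sint_indicator[OF mu True]
      by (simp add: bdd_meas_def exI[of _ 0])
    ultimately show ?thesis by (simp add: sint_def)
  qed
  from this[of "\<beta> / 2"] this[of "- (\<beta> / 2)"] have "\<beta> / 2 * \<mu> B = 0" using ab by simp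
  then show ?thesis using ab by simp
qed (rule signed_measures_outside[OF mu])

section \<open>Elements of minimal norm in convex sets of weights\<close>

lemma weight_average:
  assumes "weight \<Omega> g" "weight \<Omega> h" shows "weight \<Omega> (\<lambda>x. (g x + h x) / 2)"
  unfolding weight_def
proof (intro conjI allI)
  show "(\<lambda>x. (g x + h x) / 2) \<in> borel_measurable (borel_on \<Omega>)"
    using weightD(3)[OF assms(1)] weightD(3)[OF assms(2)] by simp
  fix x show "0 \<le> (g x + h x) / 2" "(g x + h x) / 2 \<le> 1"
    using weightD(1,2)[OF assms(1), of x] weightD(1,2)[OF assms(2), of x] by auto
qed

text \<open>
  This replaces weak compactness. By the parallelogram law, elements of the sets \<open>C n\<close> whose \<open>L\<^sup>2\<close> norms
  are nearly minimal form a Cauchy sequence. A sufficiently fast subsequence converges almost everywhere, hence in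
  \<open>L\<^sup>1\<close> by dominated convergence.
\<close>

lemma midpoint_convex_L1_limit:
  fixes C :: "nat \<Rightarrow> ('a::topological_space \<Rightarrow> real) set"
  assumes b: "fin_meas \<Omega> b" and ne: "\<And>n. C n \<noteq> {}" and dec: "\<And>n. C (Suc n) \<subseteq> C n"
    and w: "\<And>n g. g \<in> C n \<Longrightarrow> weight \<Omega> g"
    and mid: "\<And>n g h. g \<in> C n \<Longrightarrow> h \<in> C n \<Longrightarrow> (\<lambda>x. (g x + h x) / 2) \<in> C n"
  shows "\<exists>g. weight \<Omega> g \<and> (\<forall>n. \<forall>e>0. \<exists>h\<in>C n. (\<integral>x. \<bar>h x - g x\<bar> \<partial>b) < e)"
proof -
  interpret b: finite_measure b using b by (simp add: fin_meas_def)
  define B where "B = measure b \<Omega>"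
  have spb: "space b = \<Omega>" by (rule fin_measD(3)[OF b])
  define q where "q = (\<lambda>h::'a \<Rightarrow> real. \<integral>x. h x ^ 2 \<partial>b)"
  have isq: "integrable b (\<lambda>x. g x * h x)" if "weight \<Omega> g" "weight \<Omega> h" for g h
    using weight_borel[OF b that(1)] weight_borel[OF b that(2)] weightD(1,2)[OF that(1)] weightD(1,2)[OF that(2)]
    by (intro b.integrable_const_bound[where B = 1]) (auto simp: mult_le_one)
  have iw: "integrable b g" if "weight \<Omega> g" for g by (rule bdd_meas_integrable[OF b weight_bdd_meas[OF that]])
  have q0: "0 \<le> q h" for h unfolding q_def by simp
  have q1: "q h \<le> B" if "weight \<Omega> h" for h
  proof -
    have "q h \<le> (\<integral>x. 1 \<partial>b)"
      unfolding q_def power2_eq_square using isq[OF that that] weightD(1,2)[OF that]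
      by (intro integral_mono) (auto simp: mult_le_one)
    then show ?thesis by (simp add: B_def spb)
  qed
  define r where "r = (\<lambda>n. Inf (q ` C n))"
  have bdd: "bdd_below (q ` C n)" for n using q0 by (intro bdd_belowI[of _ 0]) auto
  have rle: "r n \<le> q h" if "h \<in> C n" for n h unfolding r_def using that bdd by (intro cInf_lower) auto
  have rB: "r n \<le> B" for n using ne[of n] rle q1 w by (metis all_not_in_conv order_trans)
  have rinc: "r n \<le> r (Suc n)" for n
    unfolding r_def using ne dec bdd by (intro cInf_superset_mono) auto
  have decm: "C m \<subseteq> C n" if "n \<le> m" for n m
    using that by (rule lift_Suc_antimono_le[rotated]) (rule dec)
  have incr: "incseq r" by (rule incseq_SucI) (rule rinc)
  then obtain R where R: "r \<longlonglongrightarrow> R" "\<And>n. r n \<le> R"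
    using incseq_convergent[of r B] rB by blast
  have "\<exists>N. \<forall>n\<ge>N. R - r n \<le> (1/4)^k" for k
  proof -
    have "eventually (\<lambda>n. R - (1/4)^k < r n) sequentially"
      using R(1) by (rule order_tendstoD(1)) simp
    then show ?thesis unfolding eventually_sequentially by (metis diff_less_eq add.commute less_imp_le)
  qed
  then obtain N where N: "\<And>k n. N k \<le> n \<Longrightarrow> R - r n \<le> (1/4)^k" by metis
  \<comment> \<open>A monotone sequence of indices that is past \<open>N k\<close> and past \<open>k\<close>.\<close>
  define s where "s = (\<lambda>k. (\<Sum>i\<le>k. N i) + k)"
  have sN: "N k \<le> s k" for k unfolding s_def by (intro trans_le_add1 member_le_sum) auto
  have sS: "s k \<le> s (Suc k)" for k by (simp add: s_def)
  have sk: "k \<le> s k" for k by (simp add: s_def)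
  have "\<exists>h\<in>C (s k). q h \<le> r (s k) + (1/4)^k" for k
  proof -
    have "r (s k) < r (s k) + (1/4)^k" by simp
    then show ?thesis unfolding r_def
      using cInf_lessD[of "q ` C (s k)" "r (s k) + (1/4)^k"] ne[of "s k"] unfolding r_def by (auto intro: less_imp_le)
  qed
  then obtain u where u: "\<And>k. u k \<in> C (s k)" "\<And>k. q (u k) \<le> r (s k) + (1/4)^k" by metis
  have wu: "weight \<Omega> (u k)" for k using w u(1) by blast
  have step: "(\<integral>x. \<bar>u (Suc k) x - u k x\<bar> \<partial>b) \<le> (B / 2 + 3) * (1/2)^k" for k
  proof -
    let ?m = "\<lambda>x. (u k x + u (Suc k) x) / 2"
    have "u (Suc k) \<in> C (s k)" using u(1)[of "Suc k"] decm[OF sS[of k]] by blast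
    then have mC: "?m \<in> C (s k)" by (rule mid[OF u(1)])
    have i: "integrable b (\<lambda>x. u k x * u k x)" "integrable b (\<lambda>x. u (Suc k) x * u (Suc k) x)" "integrable b (\<lambda>x. ?m x * ?m x)"
      using isq wu weight_average[OF wu wu] by blast+
    have eq: "(\<integral>x. (u (Suc k) x - u k x)^2 \<partial>b) = 2 * q (u k) + 2 * q (u (Suc k)) - 4 * q ?m"
    proof -
      have "(\<integral>x. (u (Suc k) x - u k x)^2 \<partial>b) = (\<integral>x. 2 * (u k x * u k x) + 2 * (u (Suc k) x * u (Suc k) x) - 4 * (?m x * ?m x) \<partial>b)"
        by (intro Bochner_Integration.integral_cong refl) (simp add: power2_eq_square field_simps)
      also have "\<dots> = 2 * q (u k) + 2 * q (u (Suc k)) - 4 * q ?m"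
        unfolding q_def power2_eq_square using i
        by (simp only: Bochner_Integration.integral_diff Bochner_Integration.integral_add integral_mult_right_zero
            Bochner_Integration.integrable_add integrable_mult_right)
      finally show ?thesis .
    qed
    have p4: "(1/4::real)^Suc k \<le> (1/4)^k" by simp
    have D: "(\<integral>x. (u (Suc k) x - u k x)^2 \<partial>b) \<le> 6 * (1/4)^k"
      unfolding eq using u(2)[of k] u(2)[of "Suc k"] rle[OF mC] R(2)[of "s (Suc k)"] N[OF sN[of k]] p4 by linarith
    have i2: "integrable b (\<lambda>x. (u (Suc k) x - u k x)^2)"
      unfolding power2_eq_square right_diff_distrib left_diff_distrib using isq wu by (intro Bochner_Integration.integrable_diff) auto
    \<comment> \<open>Weighted arithmetic-geometric mean inequality: the weight \<open>2^k\<close> balances the bound \<open>6 (1/4)^k\<close> on the squares.\<close>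
    have "(\<integral>x. \<bar>u (Suc k) x - u k x\<bar> \<partial>b) \<le> (\<integral>x. ((1/2)^k + 2^k * (u (Suc k) x - u k x)^2) / 2 \<partial>b)"
    proof (rule integral_mono)
      show "integrable b (\<lambda>x. \<bar>u (Suc k) x - u k x\<bar>)" using iw wu by auto
      show "integrable b (\<lambda>x. ((1/2)^k + 2^k * (u (Suc k) x - u k x)^2) / 2)" using i2 by auto
      fix x
      define t where "t = \<bar>u (Suc k) x - u k x\<bar>"
      have "0 \<le> 2^k * (t - (1/2)^k)^2" by simp
      also have "\<dots> = 2^k * t^2 - 2 * t * (2^k * (1/2)^k) + (2^k * (1/2)^k) * (1/2)^k"
        by (simp add: power2_eq_square algebra_simps)
      also have "(2::real)^k * (1/2)^k = 1" by (simp add: power_mult_distrib[symmetric])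
      finally show "\<bar>u (Suc k) x - u k x\<bar> \<le> ((1/2)^k + 2^k * (u (Suc k) x - u k x)^2) / 2"
        by (simp add: t_def)
    qed
    also have "\<dots> = ((1/2)^k * B + 2^k * (\<integral>x. (u (Suc k) x - u k x)^2 \<partial>b)) / 2"
      using i2 by (simp add: B_def spb)
    also have "\<dots> \<le> ((1/2)^k * B + 2^k * (6 * (1/4)^k)) / 2"
      using D by (intro divide_right_mono add_left_mono mult_left_mono) auto
    also have "\<dots> = (B / 2 + 3) * (1/2)^k"
    proof -
      have "(2::real)^k * (1/4)^k = (1/2)^k" by (simp add: power_mult_distrib[symmetric])
      then show ?thesis by (simp add: algebra_simps)
    qed
    finally show ?thesis .
  qed
  have iS: "integrable b (\<lambda>x. \<bar>u (Suc k) x - u k x\<bar>)" for k using iw wu by auto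
  have um: "u k \<in> borel_measurable b" for k using weight_borel[OF b wu] .
  have "(\<integral>\<^sup>+x. (\<Sum>k. ennreal \<bar>u (Suc k) x - u k x\<bar>) \<partial>b) = (\<Sum>k. \<integral>\<^sup>+x. ennreal \<bar>u (Suc k) x - u k x\<bar> \<partial>b)"
    using um by (intro nn_integral_suminf) simp
  also have "\<dots> = (\<Sum>k. ennreal (\<integral>x. \<bar>u (Suc k) x - u k x\<bar> \<partial>b))"
    by (subst nn_integral_eq_integral[OF iS]) auto
  also have "\<dots> \<le> (\<Sum>k. ennreal ((B / 2 + 3) * (1/2)^k))"
    using step by (intro suminf_le ennreal_leI) auto
  also have "\<dots> < \<infinity>"
  proof -
    have "summable (\<lambda>k. (B / 2 + 3) * (1/2::real)^k)" by (intro summable_mult summable_geometric) simp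
    moreover have "0 \<le> B" by (simp add: B_def)
    ultimately have "(\<Sum>k. ennreal ((B / 2 + 3) * (1/2)^k)) = ennreal (\<Sum>k. (B / 2 + 3) * (1/2)^k)"
      by (intro suminf_ennreal2) auto
    then show ?thesis by simp
  qed
  finally have fin: "(\<integral>\<^sup>+x. (\<Sum>k. ennreal \<bar>u (Suc k) x - u k x\<bar>) \<partial>b) \<noteq> \<infinity>" by simp
  have AE: "AE x in b. convergent (\<lambda>k. u k x)"
  proof -
    have "AE x in b. (\<Sum>k. ennreal \<bar>u (Suc k) x - u k x\<bar>) \<noteq> \<infinity>"
      using fin um by (intro nn_integral_PInf_AE) auto
    then show ?thesis
    proof (rule AE_mp, intro AE_I2 impI)
      fix x assume "(\<Sum>k. ennreal \<bar>u (Suc k) x - u k x\<bar>) \<noteq> \<infinity>"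
      then have "summable (\<lambda>k. \<bar>u (Suc k) x - u k x\<bar>)" by (intro summable_suminf_not_top) auto
      then have "summable (\<lambda>k. u (Suc k) x - u k x)" by (rule summable_rabs_cancel)
      then have "(\<lambda>n. \<Sum>k<n. u (Suc k) x - u k x) \<longlonglongrightarrow> (\<Sum>k. u (Suc k) x - u k x)" by (rule summable_LIMSEQ)
      then have "(\<lambda>n. u n x - u 0 x) \<longlonglongrightarrow> (\<Sum>k. u (Suc k) x - u k x)" by (simp only: sum_lessThan_telescope[of "\<lambda>k. u k x"])
      then have "(\<lambda>n. u n x - u 0 x + u 0 x) \<longlonglongrightarrow> (\<Sum>k. u (Suc k) x - u k x) + u 0 x" by (intro tendsto_add tendsto_const)
      then show "convergent (\<lambda>k. u k x)" by (auto simp: convergent_def)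
    qed
  qed
  \<comment> \<open>Clipping makes \<open>g\<close> a weight also at the points where the sequence diverges.\<close>
  define g where "g = (\<lambda>x. max 0 (min 1 (lim (\<lambda>k. u k x))))"
  have "(\<lambda>x. lim (\<lambda>k. u k x)) \<in> borel_measurable (borel_on \<Omega>)"
    using weightD(3)[OF wu] by (rule borel_measurable_lim_metric)
  then have wg: "weight \<Omega> g" by (auto simp: weight_def g_def)
  have AEg: "AE x in b. (\<lambda>k. \<bar>u k x - g x\<bar>) \<longlonglongrightarrow> 0"
    using AE
  proof (rule AE_mp, intro AE_I2 impI)
    fix x assume "convergent (\<lambda>k. u k x)"
    then have L: "(\<lambda>k. u k x) \<longlonglongrightarrow> lim (\<lambda>k. u k x)" by (simp add: convergent_LIMSEQ_iff)
    have "0 \<le> lim (\<lambda>k. u k x)" "lim (\<lambda>k. u k x) \<le> 1"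
      using LIMSEQ_le_const[OF L, of 0] LIMSEQ_le_const2[OF L, of 1] weightD(1,2)[OF wu] by auto
    then have "g x = lim (\<lambda>k. u k x)" by (simp add: g_def)
    then show "(\<lambda>k. \<bar>u k x - g x\<bar>) \<longlonglongrightarrow> 0"
      using L by (metis LIM_zero tendsto_rabs_zero)
  qed
  have gm: "g \<in> borel_measurable b" by (rule weight_borel[OF b wg])
  have "(\<lambda>k. \<integral>x. \<bar>u k x - g x\<bar> \<partial>b) \<longlonglongrightarrow> (\<integral>x. 0 \<partial>b)"
  proof (rule integral_dominated_convergence[where w = "\<lambda>_. 1"])
    show "AE x in b. norm \<bar>u k x - g x\<bar> \<le> 1" for k
    proof (intro AE_I2)
      fix x
      show "norm \<bar>u k x - g x\<bar> \<le> 1"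
        using weightD(1,2)[OF wu[of k], of x] weightD(1,2)[OF wg, of x] by auto
    qed
  qed (use AEg um gm in auto)
  then have lim0: "(\<lambda>k. \<integral>x. \<bar>u k x - g x\<bar> \<partial>b) \<longlonglongrightarrow> 0" by simp
  have "\<exists>h\<in>C n. (\<integral>x. \<bar>h x - g x\<bar> \<partial>b) < e" if "0 < e" for n e
  proof -
    have "eventually (\<lambda>k. (\<integral>x. \<bar>u k x - g x\<bar> \<partial>b) < e) sequentially"
      using lim0 that by (rule order_tendstoD(2))
    then obtain k where k: "n \<le> k" "(\<integral>x. \<bar>u k x - g x\<bar> \<partial>b) < e"
      unfolding eventually_sequentially by (metis nle_le)
    have "u k \<in> C n" using u(1)[of k] decm[of n "s k"] sk[of k] k(1) by auto
    then show ?thesis using k(2) by blast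
  qed
  then show ?thesis using wg by blast
qed


section \<open>Splitting a measure along a Borel set\<close>

lemma plan_cost_nonneg:
  fixes \<Omega> :: "'a::euclidean_space set"
  assumes f: "fin_meas \<Omega> a" "fin_meas \<Omega> b" and s: "subplan \<Omega> p a b \<gamma>" and ab: "0 \<le> \<alpha>" "0 \<le> \<beta>"
  shows "0 \<le> plan_cost \<Omega> p \<alpha> \<beta> a b \<gamma>"
proof -
  interpret a: finite_measure a using f by (simp add: fin_meas_def)
  interpret b: finite_measure b using f by (simp add: fin_meas_def)
  interpret g: finite_measure \<gamma> by (rule subplan_finite[OF f(1) s])
  have "emeasure \<gamma> (\<Omega> \<times> \<Omega>) \<le> emeasure a \<Omega>" "emeasure \<gamma> (\<Omega> \<times> \<Omega>) \<le> emeasure b \<Omega>"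
    using s Omega_sets[of \<Omega>] by (auto simp: subplan_def)
  then have "measure \<gamma> (\<Omega> \<times> \<Omega>) \<le> measure a \<Omega>" "measure \<gamma> (\<Omega> \<times> \<Omega>) \<le> measure b \<Omega>"
    by (simp_all add: g.emeasure_eq_measure a.emeasure_eq_measure b.emeasure_eq_measure)
  then have "0 \<le> \<alpha> * (measure a \<Omega> + measure b \<Omega> - 2 * measure \<gamma> (\<Omega> \<times> \<Omega>))"
    using ab by (intro mult_nonneg_nonneg) auto
  then show ?thesis unfolding plan_cost_def using ab by (intro add_nonneg_nonneg) auto
qed

definition dens_diff :: "'a measure \<Rightarrow> 'a measure \<Rightarrow> ('a \<Rightarrow> real) \<Rightarrow> ('a \<Rightarrow> real) \<Rightarrow> 'a set \<Rightarrow> real" where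
  "dens_diff a b f h = (\<lambda>A. measure (dens a f) A - measure (dens b h) A)"

lemma dens_diff_jordan:
  assumes J: "is_jordan_decomposition \<Omega> \<mu> a b" and w: "weight \<Omega> f" "weight \<Omega> h"
  shows "is_jordan_decomposition \<Omega> (dens_diff a b f h) (dens a f) (dens b h)"
proof -
  have m: "fin_meas \<Omega> a" "fin_meas \<Omega> b" using J by (simp_all add: is_jordan_decomposition_def fin_meas_def)
  obtain P where P: "P \<in> sets (borel_on \<Omega>)" "emeasure a (\<Omega> - P) = 0" "emeasure b P = 0"
    using J by (auto simp: is_jordan_decomposition_def)
  have OP: "\<Omega> - P \<in> sets (borel_on \<Omega>)" using P(1) Omega_sets by auto
  have "emeasure (dens a f) (\<Omega> - P) = 0" "emeasure (dens b h) P = 0"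
    using emeasure_dens_le[OF m(1) w(1) OP] emeasure_dens_le[OF m(2) w(2) P(1)] P by auto
  then show ?thesis
    using fin_meas_dens[OF m(1) w(1)] fin_meas_dens[OF m(2) w(2)] P(1)
    unfolding is_jordan_decomposition_def fin_meas_def dens_diff_def by blast
qed

lemma dens_diff_signed:
  assumes J: "is_jordan_decomposition \<Omega> \<mu> a b" and w: "weight \<Omega> f" "weight \<Omega> h"
  shows "dens_diff a b f h \<in> signed_measures \<Omega>"
  unfolding dens_diff_def using J w
  by (intro fin_meas_diff_signed fin_meas_dens) (simp_all add: is_jordan_decomposition_def fin_meas_def)

lemma dens_diff_radon:
  fixes \<Omega> :: "'a::t2_space set"
  assumes mu: "\<mu> \<in> radon_measures \<Omega>" and J: "is_jordan_decomposition \<Omega> \<mu> a b" and w: "weight \<Omega> f" "weight \<Omega> h"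
  shows "dens_diff a b f h \<in> radon_measures \<Omega>"
proof (rule radon_tv_dominated[OF mu dens_diff_signed[OF J w], of 1])
  have m: "fin_meas \<Omega> a" "fin_meas \<Omega> b" using J by (simp_all add: is_jordan_decomposition_def fin_meas_def)
  interpret a: finite_measure a using m by (simp add: fin_meas_def)
  interpret b: finite_measure b using m by (simp add: fin_meas_def)
  fix A assume A: "A \<in> sets (borel_on \<Omega>)"
  have "measure (dens a f) A \<le> measure a A" "measure (dens b h) A \<le> measure b A"
    using emeasure_dens_le[OF m(1) w(1) A] emeasure_dens_le[OF m(2) w(2) A]
      fin_meas_dens[OF m(1) w(1)] fin_meas_dens[OF m(2) w(2)]
    by (simp_all add: fin_meas_def finite_measure.emeasure_eq_measure a.emeasure_eq_measure b.emeasure_eq_measure)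
  then show "tv \<Omega> (dens_diff a b f h) A \<le> 1 * tv \<Omega> \<mu> A"
    using jordan_parts_eq[OF J] jordan_parts_eq[OF dens_diff_jordan[OF J w]] by (simp add: tv_def)
qed

lemma tv_dens_diff_le:
  assumes J: "is_jordan_decomposition \<Omega> \<mu> a b" and w: "weight \<Omega> f" "weight \<Omega> g" "weight \<Omega> h"
  shows "tv \<Omega> (\<lambda>A. dens_diff a b f g A - dens_diff a b f h A) \<Omega> \<le> (\<integral>x. \<bar>h x - g x\<bar> \<partial>b)"
proof (rule tv_le[OF signed_measures_diff[OF dens_diff_signed[OF J w(1,2)] dens_diff_signed[OF J w(1,3)]] Omega_sets])
  have b: "fin_meas \<Omega> b" using J by (simp add: is_jordan_decomposition_def fin_meas_def)
  have iw: "integrable b f" if "weight \<Omega> f" for f by (rule bdd_meas_integrable[OF b weight_bdd_meas[OF that]])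
  have d: "dens_diff a b f g E - dens_diff a b f h E = (\<integral>x. (h x - g x) * indicator E x \<partial>b)"
    and i: "integrable b (\<lambda>x. (h x - g x) * indicator E x)" if E: "E \<in> sets (borel_on \<Omega>)" for E
  proof -
    show "dens_diff a b f g E - dens_diff a b f h E = (\<integral>x. (h x - g x) * indicator E x \<partial>b)"
      using iw[OF weight_mult_indicator[OF w(2) E]] iw[OF weight_mult_indicator[OF w(3) E]]
      by (simp add: dens_diff_def measure_dens[OF b w(2) E] measure_dens[OF b w(3) E] left_diff_distrib)
    show "integrable b (\<lambda>x. (h x - g x) * indicator E x)"
      using iw[OF weight_mult_indicator[OF w(2) E]] iw[OF weight_mult_indicator[OF w(3) E]]
      by (simp add: left_diff_distrib)
  qed
  fix E assume E: "E \<in> sets (borel_on \<Omega>)" "E \<subseteq> \<Omega>"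
  have OE: "\<Omega> - E \<in> sets (borel_on \<Omega>)" using E Omega_sets by auto
  have "dens_diff a b f g E - dens_diff a b f h E - (dens_diff a b f g (\<Omega> - E) - dens_diff a b f h (\<Omega> - E))
    = (\<integral>x. (h x - g x) * indicator E x - (h x - g x) * indicator (\<Omega> - E) x \<partial>b)"
    using i[OF E(1)] i[OF OE] by (simp add: d[OF E(1)] d[OF OE])
  also have "\<dots> \<le> (\<integral>x. \<bar>h x - g x\<bar> \<partial>b)"
    using i[OF E(1)] i[OF OE] iw w by (intro integral_mono) (auto simp: indicator_def)
  finally show "dens_diff a b f g E - dens_diff a b f h E - (dens_diff a b f g (\<Omega> - E) - dens_diff a b f h (\<Omega> - E))
    \<le> (\<integral>x. \<bar>h x - g x\<bar> \<partial>b)" .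
qed

lemma weight_compl: "weight \<Omega> g \<Longrightarrow> weight \<Omega> (\<lambda>x. 1 - g x)"
  unfolding weight_def by (auto intro: borel_measurable_diff)

text \<open>
  A plan sends a part of the mass of \<open>a\<close> inside \<open>A\<close> onto some part \<open>g\<close> of \<open>b\<close>. These are the parts that plans of
  cost at most \<open>r\<close> can produce.
\<close>

definition split_weights ::
  "'a::euclidean_space set \<Rightarrow> real \<Rightarrow> real \<Rightarrow> real \<Rightarrow> 'a measure \<Rightarrow> 'a measure \<Rightarrow> 'a set \<Rightarrow> real \<Rightarrow> ('a \<Rightarrow> real) set" where
  "split_weights \<Omega> p \<alpha> \<beta> a b A r = {g. weight \<Omega> g \<and> (\<exists>\<gamma>. subplan \<Omega> p a b \<gamma> \<and> plan_cost \<Omega> p \<alpha> \<beta> a b \<gamma> \<le> r \<and>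
     (\<forall>B\<in>sets (borel_on \<Omega>). measure \<gamma> (A \<times> B) = measure (dens b g) B))}"

lemma split_weights_nonempty:
  fixes \<Omega> :: "'a::euclidean_space set"
  assumes a: "fin_meas \<Omega> a" and b: "fin_meas \<Omega> b" and A: "A \<in> sets (borel_on \<Omega>)"
    and s: "subplan \<Omega> p a b \<gamma>" "plan_cost \<Omega> p \<alpha> \<beta> a b \<gamma> \<le> r"
  shows "split_weights \<Omega> p \<alpha> \<beta> a b A r \<noteq> {}"
proof -
  let ?M = "borel_on \<Omega>"
  have sg: "sets \<gamma> = sets (?M \<Otimes>\<^sub>M ?M)" using s by (simp add: subplan_def)
  interpret g: finite_measure \<gamma> by (rule subplan_finite[OF a s(1)])
  define \<gamma>1 where "\<gamma>1 = density \<gamma> (indicator (A \<times> \<Omega>))"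
  define t where "t = distr \<gamma>1 ?M snd"
  have AO: "A \<subseteq> \<Omega>" using sets.sets_into_space[OF A] by simp
  have AxO: "A \<times> \<Omega> \<in> sets \<gamma>" using A Omega_sets sg by auto
  have s1: "sets \<gamma>1 = sets (?M \<Otimes>\<^sub>M ?M)" by (simp add: \<gamma>1_def sg)
  have e1: "emeasure \<gamma>1 X = emeasure \<gamma> ((A \<times> \<Omega>) \<inter> X)" if "X \<in> sets \<gamma>" for X
    unfolding \<gamma>1_def by (rule emeasure_restricted[OF AxO that])
  have f1: "finite_measure \<gamma>1"
    using e1[of "\<Omega> \<times> \<Omega>"] pair_space[OF sg] pair_space[OF s1] sets.top[of \<gamma>] by (intro finite_measureI) simp
  have ft: "fin_meas \<Omega> t" unfolding t_def by (rule marginal_fin_meas(2)[OF s1 f1])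
  have et: "emeasure t B = emeasure \<gamma> (A \<times> B)" if B: "B \<in> sets ?M" for B
  proof -
    have OB: "\<Omega> \<times> B \<in> sets \<gamma>" using B Omega_sets sg by auto
    have "(A \<times> \<Omega>) \<inter> (\<Omega> \<times> B) = A \<times> B" using AO sets.sets_into_space[OF B] by auto
    then show ?thesis using marginal_emeasure(2)[OF s1 B] e1[OF OB] by (simp add: t_def)
  qed
  have le: "emeasure t B \<le> emeasure b B" if B: "B \<in> sets ?M" for B
  proof -
    have "emeasure \<gamma> (A \<times> B) \<le> emeasure \<gamma> (\<Omega> \<times> B)"
      using AO B Omega_sets sg by (intro emeasure_mono) auto
    also have "\<dots> \<le> emeasure b B" using s(1) B by (simp add: subplan_def)
    finally show ?thesis by (simp add: et[OF B])
  qed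
  obtain g where g: "weight \<Omega> g" "t = dens b g"
    using ex_dens[OF b ft le Omega_sets] by auto
  have "measure \<gamma> (A \<times> B) = measure (dens b g) B" if "B \<in> sets ?M" for B
    using et[OF that] g(2) by (simp add: measure_def)
  then show ?thesis using g(1) s unfolding split_weights_def by blast
qed

lemma split_weights_midpoint:
  fixes \<Omega> :: "'a::euclidean_space set"
  assumes a: "fin_meas \<Omega> a" and b: "fin_meas \<Omega> b" and A: "A \<in> sets (borel_on \<Omega>)"
    and g: "g \<in> split_weights \<Omega> p \<alpha> \<beta> a b A r" and h: "h \<in> split_weights \<Omega> p \<alpha> \<beta> a b A r"
  shows "(\<lambda>x. (g x + h x) / 2) \<in> split_weights \<Omega> p \<alpha> \<beta> a b A r"
proof -
  let ?M = "borel_on \<Omega>"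
  let ?d = "\<lambda>z::'a\<times>'a. norm (fst z - snd z) powr p"
  obtain \<gamma> where s: "subplan \<Omega> p a b \<gamma>" "plan_cost \<Omega> p \<alpha> \<beta> a b \<gamma> \<le> r"
      "\<And>B. B \<in> sets ?M \<Longrightarrow> measure \<gamma> (A \<times> B) = measure (dens b g) B"
    using g by (auto simp: split_weights_def)
  obtain \<gamma>' where s': "subplan \<Omega> p a b \<gamma>'" "plan_cost \<Omega> p \<alpha> \<beta> a b \<gamma>' \<le> r"
      "\<And>B. B \<in> sets ?M \<Longrightarrow> measure \<gamma>' (A \<times> B) = measure (dens b h) B"
    using h by (auto simp: split_weights_def)
  have w: "weight \<Omega> g" "weight \<Omega> h" using g h by (simp_all add: split_weights_def)
  interpret g: finite_measure \<gamma> by (rule subplan_finite[OF a s(1)])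
  interpret g': finite_measure \<gamma>' by (rule subplan_finite[OF a s'(1)])
  have sg: "sets \<gamma> = sets (?M \<Otimes>\<^sub>M ?M)" "sets \<gamma>' = sets (?M \<Otimes>\<^sub>M ?M)"
    and int: "integrable \<gamma> ?d" "integrable \<gamma>' ?d"
    using s(1) s'(1) by (simp_all add: subplan_def)
  have ss: "sets \<gamma>' = sets \<gamma>" using sg by simp
  define \<gamma>2 where "\<gamma>2 = density (add_measure \<gamma> \<gamma>') (\<lambda>_. ennreal (1/2))"
  have s2: "sets \<gamma>2 = sets (?M \<Otimes>\<^sub>M ?M)" by (simp add: \<gamma>2_def sg)
  have em: "emeasure \<gamma>2 X = ennreal ((measure \<gamma> X + measure \<gamma>' X) / 2)" if "X \<in> sets \<gamma>" for X
  proof -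
    have "emeasure \<gamma>2 X = ennreal (1/2) * emeasure (add_measure \<gamma> \<gamma>') X"
      unfolding \<gamma>2_def using that by (intro emeasure_density_const) simp
    also have "\<dots> = ennreal (1/2) * ennreal (measure \<gamma> X + measure \<gamma>' X)"
      by (simp add: emeasure_add_measure[OF ss] g.emeasure_eq_measure g'.emeasure_eq_measure)
    also have "\<dots> = ennreal (1/2 * (measure \<gamma> X + measure \<gamma>' X))"
      by (subst ennreal_mult) auto
    finally show ?thesis by simp
  qed
  have me: "measure \<gamma>2 X = (measure \<gamma> X + measure \<gamma>' X) / 2" if "X \<in> sets \<gamma>" for X
    using em[OF that] by (intro measure_eq_emeasure_eq_ennreal) auto
  have avg: "ennreal ((measure \<gamma> X + measure \<gamma>' X) / 2) \<le> E"
    if "emeasure \<gamma> X \<le> E" "emeasure \<gamma>' X \<le> E" for X E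
  proof (cases E)
    case (real e)
    then have "(measure \<gamma> X + measure \<gamma>' X) / 2 \<le> e"
      using that by (simp add: g.emeasure_eq_measure g'.emeasure_eq_measure)
    then show ?thesis using real by (simp add: ennreal_leI)
  qed simp
  have dm: "?d \<in> borel_measurable (add_measure \<gamma> \<gamma>')" using sg by (intro cost_measurable[of _ \<Omega>]) simp
  note ia = integral_add_measure[OF ss int]
  have sub: "subplan \<Omega> p a b \<gamma>2"
    unfolding subplan_def
  proof (intro conjI ballI)
    show "integrable \<gamma>2 ?d" unfolding \<gamma>2_def using ia(1) dm by (subst integrable_density) auto
    fix B assume B: "B \<in> sets ?M"
    then have X: "B \<times> \<Omega> \<in> sets \<gamma>" "\<Omega> \<times> B \<in> sets \<gamma>" using Omega_sets sg by auto
    show "emeasure \<gamma>2 (B \<times> \<Omega>) \<le> emeasure a B" "emeasure \<gamma>2 (\<Omega> \<times> B) \<le> emeasure b B"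
      unfolding em[OF X(1)] em[OF X(2)] using B s(1) s'(1) by (auto intro!: avg simp: subplan_def)
  qed (rule s2)
  have i2: "(\<integral>z. ?d z \<partial>\<gamma>2) = ((\<integral>z. ?d z \<partial>\<gamma>) + (\<integral>z. ?d z \<partial>\<gamma>')) / 2"
  proof -
    have "(\<integral>z. ?d z \<partial>\<gamma>2) = (\<integral>z. (1/2) *\<^sub>R ?d z \<partial>add_measure \<gamma> \<gamma>')"
      unfolding \<gamma>2_def using dm by (intro integral_density) auto
    then show ?thesis by (simp add: ia(2))
  qed
  have OO: "\<Omega> \<times> \<Omega> \<in> sets \<gamma>" using Omega_sets sg by auto
  have "plan_cost \<Omega> p \<alpha> \<beta> a b \<gamma>2 = (plan_cost \<Omega> p \<alpha> \<beta> a b \<gamma> + plan_cost \<Omega> p \<alpha> \<beta> a b \<gamma>') / 2"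
    unfolding plan_cost_def i2 me[OF OO] by (simp add: field_simps)
  then have cost: "plan_cost \<Omega> p \<alpha> \<beta> a b \<gamma>2 \<le> r" using s(2) s'(2) by simp
  have wa: "weight \<Omega> (\<lambda>x. (g x + h x) / 2)" by (rule weight_average[OF w])
  have "measure \<gamma>2 (A \<times> B) = measure (dens b (\<lambda>x. (g x + h x) / 2)) B" if B: "B \<in> sets ?M" for B
  proof -
    have "A \<times> B \<in> sets \<gamma>" using A B sg by auto
    then have "measure \<gamma>2 (A \<times> B) = (measure (dens b g) B + measure (dens b h) B) / 2"
      by (simp add: me s(3)[OF B] s'(3)[OF B])
    also have "\<dots> = (\<integral>x. (g x * indicator B x + h x * indicator B x) / 2 \<partial>b)"
      using bdd_meas_integrable[OF b weight_bdd_meas[OF weight_mult_indicator[OF w(1) B]]]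
        bdd_meas_integrable[OF b weight_bdd_meas[OF weight_mult_indicator[OF w(2) B]]]
      by (simp add: measure_dens[OF b w(1) B] measure_dens[OF b w(2) B])
    also have "\<dots> = measure (dens b (\<lambda>x. (g x + h x) / 2)) B"
      unfolding measure_dens[OF b wa B] by (intro Bochner_Integration.integral_cong) (auto simp: algebra_simps add_divide_distrib)
    finally show ?thesis .
  qed
  then show ?thesis using wa sub cost unfolding split_weights_def by blast
qed

text \<open>
  Restricting the plan to \<open>A \<times> \<Omega>\<close> and to \<open>(\<Omega> - A) \<times> \<Omega>\<close> gives plans for the two pieces, and the plan cost is additive
  under this splitting.
\<close>

lemma split_weights_KR_norm:
  fixes \<Omega> :: "'a::euclidean_space set"
  assumes mu: "\<mu> \<in> radon_measures \<Omega>" and J: "is_jordan_decomposition \<Omega> \<mu> a b" and ab: "0 \<le> \<alpha>" "0 \<le> \<beta>"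
    and A: "A \<in> sets (borel_on \<Omega>)" and h: "h \<in> split_weights \<Omega> p \<alpha> \<beta> a b A r"
  shows "KR_norm \<Omega> p \<alpha> \<beta> (dens_diff a b (indicator A) h)
    + KR_norm \<Omega> p \<alpha> \<beta> (dens_diff a b (indicator (\<Omega> - A)) (\<lambda>x. 1 - h x)) \<le> ennreal r"
proof -
  let ?M = "borel_on \<Omega>"
  let ?d = "\<lambda>z::'a\<times>'a. norm (fst z - snd z) powr p"
  have m: "fin_meas \<Omega> a" "fin_meas \<Omega> b" using J by (simp_all add: is_jordan_decomposition_def fin_meas_def)
  interpret a: finite_measure a using m by (simp add: fin_meas_def)
  interpret b: finite_measure b using m by (simp add: fin_meas_def)
  obtain \<gamma> where s: "subplan \<Omega> p a b \<gamma>" "plan_cost \<Omega> p \<alpha> \<beta> a b \<gamma> \<le> r"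
      "\<And>B. B \<in> sets ?M \<Longrightarrow> measure \<gamma> (A \<times> B) = measure (dens b h) B"
    using h by (auto simp: split_weights_def)
  have w: "weight \<Omega> h" using h by (simp add: split_weights_def)
  note wc = weight_compl[OF w]
  have OA: "\<Omega> - A \<in> sets ?M" using A Omega_sets by auto
  have AO: "A \<subseteq> \<Omega>" using sets.sets_into_space[OF A] by simp
  interpret g: finite_measure \<gamma> by (rule subplan_finite[OF m(1) s(1)])
  have sg: "sets \<gamma> = sets (?M \<Otimes>\<^sub>M ?M)" and int: "integrable \<gamma> ?d" using s(1) by (simp_all add: subplan_def)
  have dm: "?d \<in> borel_measurable \<gamma>" using int by simp
  define G where "G = (\<lambda>S. density \<gamma> (indicator (S \<times> \<Omega>)))"
  have sG: "sets (G S) = sets (?M \<Otimes>\<^sub>M ?M)" for S by (simp add: G_def sg)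
  have eG: "emeasure (G S) (B \<times> C) = emeasure \<gamma> ((S \<inter> B) \<times> C)"
    if "S \<in> sets ?M" "B \<in> sets ?M" "C \<in> sets ?M" for S B C
  proof -
    have 1: "S \<times> \<Omega> \<in> sets \<gamma>" "B \<times> C \<in> sets \<gamma>" using that Omega_sets sg by auto
    have "(S \<times> \<Omega>) \<inter> (B \<times> C) = (S \<inter> B) \<times> C" using sets.sets_into_space[OF that(3)] by auto
    then show ?thesis unfolding G_def using emeasure_restricted[OF 1] by simp
  qed
  have iG: "integrable (G S) ?d" "(\<integral>z. ?d z \<partial>G S) = (\<integral>z. indicator (S \<times> \<Omega>) z * ?d z \<partial>\<gamma>)"
    "integrable \<gamma> (\<lambda>z. indicator (S \<times> \<Omega>) z * ?d z)" if S: "S \<in> sets ?M" for S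
  proof -
    have SO: "S \<times> \<Omega> \<in> sets \<gamma>" using S Omega_sets sg by auto
    have e: "indicator (S \<times> \<Omega>) = (\<lambda>z. ennreal (indicator (S \<times> \<Omega>) z))" by (auto simp: indicator_def)
    show i: "integrable \<gamma> (\<lambda>z. indicator (S \<times> \<Omega>) z * ?d z)"
      using integrable_real_mult_indicator[OF SO int] by (simp add: mult.commute)
    show "integrable (G S) ?d" unfolding G_def e using i dm SO by (subst integrable_density) auto
    show "(\<integral>z. ?d z \<partial>G S) = (\<integral>z. indicator (S \<times> \<Omega>) z * ?d z \<partial>\<gamma>)"
      unfolding G_def e using dm SO by (subst integral_density) auto
  qed
  have marg: "emeasure (G S) (B \<times> \<Omega>) \<le> emeasure (dens a (indicator S)) B" if S: "S \<in> sets ?M" and B: "B \<in> sets ?M" for S B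
  proof -
    have "emeasure (G S) (B \<times> \<Omega>) \<le> emeasure a (S \<inter> B)"
      using s(1) S B eG[OF S B Omega_sets] by (simp add: subplan_def)
    also have "emeasure a (S \<inter> B) = emeasure (dens a (indicator S)) B"
    proof -
      have "(\<lambda>x. ennreal (indicator S x)) = indicator S" by (auto simp: indicator_def)
      then show ?thesis unfolding dens_def using emeasure_restricted[of S a B] S B m(1) by (simp add: fin_meas_def)
    qed
    finally show ?thesis .
  qed
  have fd: "finite_measure (dens b h)" "finite_measure (dens b (\<lambda>x. 1 - h x))"
    using fin_meas_dens[OF m(2) w] fin_meas_dens[OF m(2) wc] by (simp_all add: fin_meas_def)
  have bsum: "measure b B = measure (dens b h) B + measure (dens b (\<lambda>x. 1 - h x)) B" if B: "B \<in> sets ?M" for B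
  proof -
    have "measure (dens b h) B + measure (dens b (\<lambda>x. 1 - h x)) B
        = (\<integral>x. h x * indicator B x + (1 - h x) * indicator B x \<partial>b)"
      using bdd_meas_integrable[OF m(2) weight_bdd_meas[OF weight_mult_indicator[OF w B]]]
        bdd_meas_integrable[OF m(2) weight_bdd_meas[OF weight_mult_indicator[OF wc B]]]
      by (simp add: measure_dens[OF m(2) w B] measure_dens[OF m(2) wc B])
    also have "\<dots> = (\<integral>x. indicator B x \<partial>b)" by (simp add: algebra_simps)
    also have "\<dots> = measure b B" using B sets.sets_into_space[OF B] m(2) fin_measD(3)[OF m(2)] by (simp add: fin_meas_def Int_absorb2)
    finally show ?thesis by simp
  qed
  have sub1: "subplan \<Omega> p (dens a (indicator A)) (dens b h) (G A)"
    unfolding subplan_def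
  proof (intro conjI ballI)
    fix B assume B: "B \<in> sets ?M"
    show "emeasure (G A) (B \<times> \<Omega>) \<le> emeasure (dens a (indicator A)) B" by (rule marg[OF A B])
    show "emeasure (G A) (\<Omega> \<times> B) \<le> emeasure (dens b h) B"
      using eG[OF A Omega_sets B] s(3)[OF B] AO fd by (simp add: Int_absorb2 g.emeasure_eq_measure finite_measure.emeasure_eq_measure)
  qed (use sG iG[OF A] in auto)
  have sub2: "subplan \<Omega> p (dens a (indicator (\<Omega> - A))) (dens b (\<lambda>x. 1 - h x)) (G (\<Omega> - A))"
    unfolding subplan_def
  proof (intro conjI ballI)
    fix B assume B: "B \<in> sets ?M"
    show "emeasure (G (\<Omega> - A)) (B \<times> \<Omega>) \<le> emeasure (dens a (indicator (\<Omega> - A))) B" by (rule marg[OF OA B])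
    have "emeasure \<gamma> (\<Omega> \<times> B) \<le> emeasure b B" using s(1) B by (simp add: subplan_def)
    then have l: "measure \<gamma> (\<Omega> \<times> B) \<le> measure b B" by (simp add: g.emeasure_eq_measure b.emeasure_eq_measure)
    have X: "\<Omega> \<times> B \<in> sets \<gamma>" "A \<times> B \<in> sets \<gamma>" using A B Omega_sets sg by auto
    have "(\<Omega> - A) \<times> B = \<Omega> \<times> B - A \<times> B" by auto
    then have "measure \<gamma> ((\<Omega> - A) \<times> B) = measure \<gamma> (\<Omega> \<times> B) - measure \<gamma> (A \<times> B)"
      using AO X by (simp add: g.finite_measure_Diff Sigma_mono)
    then have "measure \<gamma> ((\<Omega> - A) \<times> B) \<le> measure (dens b (\<lambda>x. 1 - h x)) B"
      using l bsum[OF B] s(3)[OF B] by simp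
    moreover have "(\<Omega> - A) \<inter> \<Omega> = \<Omega> - A" by auto
    ultimately show "emeasure (G (\<Omega> - A)) (\<Omega> \<times> B) \<le> emeasure (dens b (\<lambda>x. 1 - h x)) B"
      using eG[OF OA Omega_sets B] fd by (simp add: g.emeasure_eq_measure finite_measure.emeasure_eq_measure ennreal_leI)
  qed (use sG iG[OF OA] in auto)
  let ?c1 = "plan_cost \<Omega> p \<alpha> \<beta> (dens a (indicator A)) (dens b h) (G A)"
  let ?c2 = "plan_cost \<Omega> p \<alpha> \<beta> (dens a (indicator (\<Omega> - A))) (dens b (\<lambda>x. 1 - h x)) (G (\<Omega> - A))"
  have massG: "measure (G A) (\<Omega> \<times> \<Omega>) + measure (G (\<Omega> - A)) (\<Omega> \<times> \<Omega>) = measure \<gamma> (\<Omega> \<times> \<Omega>)"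
  proof -
    have X: "\<Omega> \<times> \<Omega> \<in> sets \<gamma>" "A \<times> \<Omega> \<in> sets \<gamma>" using A Omega_sets sg by auto
    have "(\<Omega> - A) \<times> \<Omega> = \<Omega> \<times> \<Omega> - A \<times> \<Omega>" by auto
    then have "measure \<gamma> ((\<Omega> - A) \<times> \<Omega>) = measure \<gamma> (\<Omega> \<times> \<Omega>) - measure \<gamma> (A \<times> \<Omega>)"
      using AO X by (simp add: g.finite_measure_Diff Sigma_mono)
    moreover have "measure (G A) (\<Omega> \<times> \<Omega>) = measure \<gamma> (A \<times> \<Omega>)"
      "measure (G (\<Omega> - A)) (\<Omega> \<times> \<Omega>) = measure \<gamma> ((\<Omega> - A) \<times> \<Omega>)"
      using eG[OF A Omega_sets Omega_sets] eG[OF OA Omega_sets Omega_sets] AO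
      by (simp_all add: measure_def Int_absorb2 Int_absorb1 Diff_subset)
    ultimately show ?thesis by simp
  qed
  have intG: "(\<integral>z. ?d z \<partial>G A) + (\<integral>z. ?d z \<partial>G (\<Omega> - A)) = (\<integral>z. ?d z \<partial>\<gamma>)"
  proof -
    have "(\<integral>z. ?d z \<partial>G A) + (\<integral>z. ?d z \<partial>G (\<Omega> - A))
        = (\<integral>z. indicator (A \<times> \<Omega>) z * ?d z + indicator ((\<Omega> - A) \<times> \<Omega>) z * ?d z \<partial>\<gamma>)"
      using iG[OF A] iG[OF OA] by simp
    also have "\<dots> = (\<integral>z. ?d z \<partial>\<gamma>)"
      using pair_space[OF sg] AO by (intro Bochner_Integration.integral_cong) (auto simp: indicator_def)
    finally show ?thesis .
  qed
  have adens: "measure (dens a (indicator S)) \<Omega> = measure a S" if S: "S \<in> sets ?M" for S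
  proof -
    have "(\<lambda>x. ennreal (indicator S x)) = indicator S" by (auto simp: indicator_def)
    moreover have "S \<inter> \<Omega> = S" using sets.sets_into_space[OF S] by auto
    ultimately show ?thesis unfolding dens_def measure_def using emeasure_restricted[of S a \<Omega>] S Omega_sets[of \<Omega>] m(1) by (simp add: fin_meas_def)
  qed
  have aT: "measure a \<Omega> = measure a A + measure a (\<Omega> - A)"
    using a.finite_measure_compl[of A] A m(1) fin_measD(3)[OF m(1)] by (simp add: fin_meas_def)
  have csum: "?c1 + ?c2 = plan_cost \<Omega> p \<alpha> \<beta> a b \<gamma>"
    unfolding plan_cost_def intG[symmetric] massG[symmetric] adens[OF A] adens[OF OA] aT bsum[OF Omega_sets]
    by (simp add: algebra_simps)
  note wA = weight_indicator[OF A] and wOA = weight_indicator[OF OA]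
  have "KR_norm \<Omega> p \<alpha> \<beta> (dens_diff a b (indicator A) h) \<le> ennreal ?c1"
    by (rule KR_norm_le_plan_cost[OF dens_diff_radon[OF mu J wA w] dens_diff_jordan[OF J wA w] sub1 ab])
  moreover have "KR_norm \<Omega> p \<alpha> \<beta> (dens_diff a b (indicator (\<Omega> - A)) (\<lambda>x. 1 - h x)) \<le> ennreal ?c2"
    by (rule KR_norm_le_plan_cost[OF dens_diff_radon[OF mu J wOA wc] dens_diff_jordan[OF J wOA wc] sub2 ab])
  moreover have "ennreal ?c1 + ennreal ?c2 = ennreal (plan_cost \<Omega> p \<alpha> \<beta> a b \<gamma>)"
    unfolding csum[symmetric]
    by (intro ennreal_plus[symmetric] plan_cost_nonneg[OF _ _ sub1 ab] plan_cost_nonneg[OF _ _ sub2 ab] fin_meas_dens m wA wOA w wc)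
  ultimately have "KR_norm \<Omega> p \<alpha> \<beta> (dens_diff a b (indicator A) h)
    + KR_norm \<Omega> p \<alpha> \<beta> (dens_diff a b (indicator (\<Omega> - A)) (\<lambda>x. 1 - h x)) \<le> ennreal (plan_cost \<Omega> p \<alpha> \<beta> a b \<gamma>)"
    using add_mono by fastforce
  also have "\<dots> \<le> ennreal r" using s(2) by (rule ennreal_leI)
  finally show ?thesis .
qed

text \<open>
  Plans of cost at most \<open>1 + 1/(n+1)\<close> yield midpoint convex sets of weights which decrease with \<open>n\<close>. The norm
  being Lipschitz for the total variation, the \<open>L\<^sup>1\<close> limit of such weights splits \<open>\<mu>\<close> without any loss.
\<close>

lemma ex_optimal_split:
  fixes \<Omega> :: "'a::euclidean_space set"
  assumes mu: "\<mu> \<in> radon_measures \<Omega>" and ab: "0 \<le> \<alpha>" "0 \<le> \<beta>" and le: "KR_norm \<Omega> p \<alpha> \<beta> \<mu> \<le> 1"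
    and A: "A \<in> sets (borel_on \<Omega>)"
  defines "a \<equiv> pos_part \<Omega> \<mu>" and "b \<equiv> neg_part \<Omega> \<mu>"
  shows "\<exists>g. weight \<Omega> g \<and> KR_norm \<Omega> p \<alpha> \<beta> (dens_diff a b (indicator A) g)
    + KR_norm \<Omega> p \<alpha> \<beta> (dens_diff a b (indicator (\<Omega> - A)) (\<lambda>x. 1 - g x)) \<le> 1"
proof -
  note J = radon_jordan[OF mu, folded a_def b_def]
  have m: "fin_meas \<Omega> a" "fin_meas \<Omega> b" using J by (simp_all add: is_jordan_decomposition_def fin_meas_def)
  have OA: "\<Omega> - A \<in> sets (borel_on \<Omega>)" using A Omega_sets by auto
  define C where "C = (\<lambda>n. split_weights \<Omega> p \<alpha> \<beta> a b A (1 + 1 / real (Suc n)))"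
  have "\<exists>g. weight \<Omega> g \<and> (\<forall>n. \<forall>e>0. \<exists>h\<in>C n. (\<integral>x. \<bar>h x - g x\<bar> \<partial>b) < e)"
  proof (rule midpoint_convex_L1_limit[OF m(2)])
    show "C n \<noteq> {}" for n
    proof -
      have "(1::ennreal) < ennreal (1 + 1 / real (Suc n))"
        using ennreal_lessI[of "1 + 1 / real (Suc n)" 1] by simp
      then have "KR_norm \<Omega> p \<alpha> \<beta> \<mu> < ennreal (1 + 1 / real (Suc n))" using le by (rule le_less_trans[rotated])
      then obtain \<gamma> where "subplan \<Omega> p a b \<gamma>" "plan_cost \<Omega> p \<alpha> \<beta> a b \<gamma> < 1 + 1 / real (Suc n)"
        using ex_subplan[OF radon_signed[OF mu] ab] unfolding a_def b_def by blast
      then show ?thesis unfolding C_def by (intro split_weights_nonempty[OF m A]) auto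
    qed
    show "C (Suc n) \<subseteq> C n" for n
    proof -
      have "1 + 1 / real (Suc (Suc n)) \<le> 1 + 1 / real (Suc n)" by (simp add: frac_le)
      then show ?thesis unfolding C_def split_weights_def by (fastforce intro: order_trans)
    qed
    show "weight \<Omega> g" if "g \<in> C n" for n g using that by (simp add: C_def split_weights_def)
    show "(\<lambda>x. (g x + h x) / 2) \<in> C n" if "g \<in> C n" "h \<in> C n" for n g h
      using that unfolding C_def by (rule split_weights_midpoint[OF m A])
  qed
  then obtain g where g: "weight \<Omega> g" "\<And>n e. 0 < e \<Longrightarrow> \<exists>h\<in>C n. (\<integral>x. \<bar>h x - g x\<bar> \<partial>b) < e" by blast
  let ?K = "KR_norm \<Omega> p \<alpha> \<beta>"
  have "?K (dens_diff a b (indicator A) g) + ?K (dens_diff a b (indicator (\<Omega> - A)) (\<lambda>x. 1 - g x)) \<le> 1"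
  proof (rule ennreal_le_epsilon)
    fix e :: real assume e: "0 < e"
    obtain n where n: "1 / real (Suc n) < e / 2" using nat_approx_posE[of "e / 2"] e by auto
    \<comment> \<open>Each of the two pieces loses at most \<open>\<alpha> * \<delta> \<le> e / 4\<close>; the other half of \<open>e\<close> is the excess cost of the plan.\<close>
    define \<delta> where "\<delta> = e / (4 * (\<alpha> + 1))"
    have d0: "0 < \<delta>" using e ab by (simp add: \<delta>_def)
    have d: "\<alpha> * \<delta> \<le> e / 4"
    proof -
      have "\<alpha> * \<delta> \<le> (\<alpha> + 1) * \<delta>" using d0 by simp
      also have "\<dots> = e / 4" using ab by (simp add: \<delta>_def field_simps)
      finally show ?thesis .
    qed
    obtain h where h: "h \<in> C n" "(\<integral>x. \<bar>h x - g x\<bar> \<partial>b) < \<delta>" using g(2)[OF d0] by blast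
    have wh: "weight \<Omega> h" using h(1) by (simp add: C_def split_weights_def)
    note w = weight_indicator[OF A] weight_indicator[OF OA] g(1) wh weight_compl[OF g(1)] weight_compl[OF wh]
    have 1: "?K (dens_diff a b (indicator A) g) \<le> ?K (dens_diff a b (indicator A) h) + ennreal (\<alpha> * \<delta>)"
      using tv_dens_diff_le[OF J w(1,3,4)] h(2)
      by (intro KR_norm_perturb[OF dens_diff_signed[OF J w(1,4)] dens_diff_signed[OF J w(1,3)] ab(1)]) simp
    have "(\<lambda>x. \<bar>1 - h x - (1 - g x)\<bar>) = (\<lambda>x. \<bar>h x - g x\<bar>)" by auto
    then have 2: "?K (dens_diff a b (indicator (\<Omega> - A)) (\<lambda>x. 1 - g x)) \<le> ?K (dens_diff a b (indicator (\<Omega> - A)) (\<lambda>x. 1 - h x)) + ennreal (\<alpha> * \<delta>)"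
      using tv_dens_diff_le[OF J w(2,5,6)] h(2)
      by (intro KR_norm_perturb[OF dens_diff_signed[OF J w(2,6)] dens_diff_signed[OF J w(2,5)] ab(1)]) simp
    have "?K (dens_diff a b (indicator A) g) + ?K (dens_diff a b (indicator (\<Omega> - A)) (\<lambda>x. 1 - g x))
       \<le> (?K (dens_diff a b (indicator A) h) + ?K (dens_diff a b (indicator (\<Omega> - A)) (\<lambda>x. 1 - h x))) + (ennreal (\<alpha> * \<delta>) + ennreal (\<alpha> * \<delta>))"
      using add_mono[OF 1 2] by (simp add: ac_simps)
    also have "\<dots> \<le> ennreal (1 + 1 / real (Suc n)) + (ennreal (\<alpha> * \<delta>) + ennreal (\<alpha> * \<delta>))"
      using h(1) unfolding C_def by (intro add_right_mono split_weights_KR_norm[OF mu J ab A])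
    also have "\<dots> = ennreal (1 + 1 / real (Suc n) + (\<alpha> * \<delta> + \<alpha> * \<delta>))"
      using d0 ab by (simp add: ennreal_plus[symmetric] del: ennreal_plus)
    also have "\<dots> \<le> ennreal (1 + e)" using n d by (intro ennreal_leI) linarith
    also have "\<dots> = 1 + ennreal e" using e by simp
    finally show "?K (dens_diff a b (indicator A) g) + ?K (dens_diff a b (indicator (\<Omega> - A)) (\<lambda>x. 1 - g x)) \<le> 1 + ennreal e" .
  qed
  then show ?thesis using g(1) by blast
qed

lemma extremal_pointsD:
  assumes "u \<in> extremal_points C" "v1 \<in> C" "v2 \<in> C" "0 < t" "t < 1" "\<And>A. u A = t * v1 A + (1 - t) * v2 A"
  shows "u = v1" "u = v2"
proof -
  have "u = (\<lambda>A. t * v1 A + (1 - t) * v2 A)" by (rule ext) (rule assms(6))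
  then have "u = v1 \<and> u = v2" using assms(1-5) by (simp add: extremal_points_def)
  then show "u = v1" and "u = v2" by blast+
qed

text \<open>
  If both norms are positive, \<open>\<mu>\<close> is a convex combination of the two summands rescaled into the ball.
\<close>

lemma extremal_proportional:
  fixes \<Omega> :: "'a::euclidean_space set"
  assumes ab: "0 < \<alpha>" "0 < \<beta>" "\<beta> < 2 * \<alpha>"
    and ex: "\<mu> \<in> extremal_points (KR_ball \<Omega> p \<alpha> \<beta>)"
    and r: "\<mu>1 \<in> radon_measures \<Omega>" "\<mu>2 \<in> radon_measures \<Omega>" and sum: "\<mu> = (\<lambda>A. \<mu>1 A + \<mu>2 A)"
    and le: "KR_norm \<Omega> p \<alpha> \<beta> \<mu>1 + KR_norm \<Omega> p \<alpha> \<beta> \<mu>2 \<le> 1"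
  shows "\<exists>c. \<mu>1 = (\<lambda>A. c * \<mu> A)"
proof -
  let ?K = "KR_norm \<Omega> p \<alpha> \<beta>"
  have "?K \<mu>1 < \<top>" "?K \<mu>2 < \<top>" using le by (auto simp: less_top[symmetric] top_unique)
  then obtain c1 c2 where c: "?K \<mu>1 = ennreal c1" "?K \<mu>2 = ennreal c2" "0 \<le> c1" "0 \<le> c2"
    by (metis less_top_ennreal)
  have c12: "c1 + c2 \<le> 1" using le c by (simp add: ennreal_plus[symmetric] del: ennreal_plus)
  have zero: "\<mu>' A = 0" if "\<mu>' \<in> radon_measures \<Omega>" "?K \<mu>' = 0" for \<mu>' A
    using KR_norm_definite[OF radon_signed[OF that(1)] ab that(2)] .
  consider "c1 = 0" | "c1 = 1" | "0 < c1" "c1 < 1" using c c12 by force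
  then show ?thesis
  proof cases
    case 1
    then have "\<mu>1 = (\<lambda>A. 0 * \<mu> A)" using zero[OF r(1)] c by auto
    then show ?thesis by blast
  next
    case 2
    then have "?K \<mu>2 = 0" using c c12 by simp
    then have "\<mu>1 = (\<lambda>A. 1 * \<mu> A)" using zero[OF r(2)] sum by auto
    then show ?thesis by blast
  next
    case 3
    define v1 where "v1 = (\<lambda>A. (1 / c1) * \<mu>1 A)"
    define v2 where "v2 = (\<lambda>A. (1 / (1 - c1)) * \<mu>2 A)"
    have "?K v1 \<le> ennreal ((1 / c1) * c1)"
      unfolding v1_def using 3 c ab by (intro KR_norm_scale r) auto
    then have v1: "v1 \<in> KR_ball \<Omega> p \<alpha> \<beta>"
      using 3 radon_scale[OF r(1), of "1 / c1"] by (simp add: KR_ball_def v1_def)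
    have "?K v2 \<le> ennreal ((1 / (1 - c1)) * c2)"
      unfolding v2_def using 3 c ab by (intro KR_norm_scale r) auto
    also have "\<dots> \<le> ennreal 1" using 3 c12 by (intro ennreal_leI) (simp add: field_simps)
    finally have v2: "v2 \<in> KR_ball \<Omega> p \<alpha> \<beta>"
      using radon_scale[OF r(2), of "1 / (1 - c1)"] by (simp add: KR_ball_def v2_def)
    have "\<mu> A = c1 * v1 A + (1 - c1) * v2 A" for A
      using 3 by (simp add: sum v1_def v2_def)
    then have "\<mu> = v1" by (rule extremal_pointsD(1)[OF ex v1 v2 3])
    then have "\<mu>1 = (\<lambda>A. c1 * \<mu> A)" using 3 by (simp add: v1_def)
    then show ?thesis by blast
  qed
qed

text \<open>
  The piece \<open>1\<^sub>A a - g b\<close> of a lossless splitting equals \<open>c \<mu>\<close>. On a carrier of \<open>a\<close> this reads \<open>1\<^sub>A a = c a\<close>, so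
  that \<open>c = 1\<close> if \<open>a\<close> charges \<open>A\<close>, and \<open>c = 0\<close> if \<open>a\<close> charges the complement.
\<close>

lemma extremal_zero_one:
  fixes \<Omega> :: "'a::euclidean_space set"
  assumes ab: "0 < \<alpha>" "0 < \<beta>" "\<beta> < 2 * \<alpha>"
    and ex: "\<mu> \<in> extremal_points (KR_ball \<Omega> p \<alpha> \<beta>)" and A: "A \<in> sets (borel_on \<Omega>)"
  shows "measure (pos_part \<Omega> \<mu>) A = 0 \<or> measure (pos_part \<Omega> \<mu>) (\<Omega> - A) = 0"
proof -
  let ?M = "borel_on \<Omega>"
  have mu: "\<mu> \<in> radon_measures \<Omega>" and le: "KR_norm \<Omega> p \<alpha> \<beta> \<mu> \<le> 1"
    using ex by (auto simp: extremal_points_def KR_ball_def)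
  define a where "a = pos_part \<Omega> \<mu>"
  define b where "b = neg_part \<Omega> \<mu>"
  note J = radon_jordan[OF mu, folded a_def b_def]
  have m: "fin_meas \<Omega> a" "fin_meas \<Omega> b" using J by (simp_all add: is_jordan_decomposition_def fin_meas_def)
  interpret a: finite_measure a using m by (simp add: fin_meas_def)
  interpret b: finite_measure b using m by (simp add: fin_meas_def)
  have OA: "\<Omega> - A \<in> sets ?M" using A Omega_sets by auto
  obtain g where g: "weight \<Omega> g" "KR_norm \<Omega> p \<alpha> \<beta> (dens_diff a b (indicator A) g)
    + KR_norm \<Omega> p \<alpha> \<beta> (dens_diff a b (indicator (\<Omega> - A)) (\<lambda>x. 1 - g x)) \<le> 1"
    using ex_optimal_split[OF mu _ _ le A] ab unfolding a_def b_def by auto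
  note wA = weight_indicator[OF A] and wOA = weight_indicator[OF OA] and wc = weight_compl[OF g(1)]
  have iw: "integrable m f" if "weight \<Omega> f" "fin_meas \<Omega> m" for f m by (rule bdd_meas_integrable[OF that(2) weight_bdd_meas[OF that(1)]])
  have sum: "\<mu> = (\<lambda>B. dens_diff a b (indicator A) g B + dens_diff a b (indicator (\<Omega> - A)) (\<lambda>x. 1 - g x) B)"
  proof (rule signed_measures_eqI[OF radon_signed[OF mu] signed_measures_add[OF dens_diff_signed[OF J wA g(1)] dens_diff_signed[OF J wOA wc]]])
    fix B assume B: "B \<in> sets ?M"
    have e: "measure (dens m f) B + measure (dens m h) B = measure m B"
      if "weight \<Omega> f" "weight \<Omega> h" "fin_meas \<Omega> m" "\<And>x. x \<in> \<Omega> \<Longrightarrow> f x + h x = 1" for m f h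
    proof -
      have "measure (dens m f) B + measure (dens m h) B = (\<integral>x. f x * indicator B x + h x * indicator B x \<partial>m)"
        using iw[OF weight_mult_indicator[OF that(1) B] that(3)] iw[OF weight_mult_indicator[OF that(2) B] that(3)]
        by (simp add: measure_dens[OF that(3,1) B] measure_dens[OF that(3,2) B])
      also have "\<dots> = (\<integral>x. indicator B x \<partial>m)"
        using that(4) fin_measD(3)[OF that(3)] by (intro Bochner_Integration.integral_cong) (auto simp: distrib_right[symmetric])
      also have "\<dots> = measure m B"
        using B sets.sets_into_space[OF B] that(3) fin_measD(3)[OF that(3)] by (simp add: fin_meas_def Int_absorb2)
      finally show ?thesis .
    qed
    have "measure (dens a (indicator A)) B + measure (dens a (indicator (\<Omega> - A))) B = measure a B"
      by (rule e[OF wA wOA m(1)]) (auto simp: indicator_def)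
    moreover have "measure (dens b g) B + measure (dens b (\<lambda>x. 1 - g x)) B = measure b B"
      by (rule e[OF g(1) wc m(2)]) auto
    moreover have "\<mu> B = measure a B - measure b B" using parts_eq[OF radon_signed[OF mu]] by (simp add: a_def b_def)
    ultimately show "\<mu> B = dens_diff a b (indicator A) g B + dens_diff a b (indicator (\<Omega> - A)) (\<lambda>x. 1 - g x) B"
      by (simp add: dens_diff_def)
  qed
  obtain c where c: "dens_diff a b (indicator A) g = (\<lambda>B. c * \<mu> B)"
    using extremal_proportional[OF ab ex dens_diff_radon[OF mu J wA g(1)] dens_diff_radon[OF mu J wOA wc] sum g(2)] by blast
  obtain P where P: "P \<in> sets ?M" "emeasure a (\<Omega> - P) = 0" "emeasure b P = 0"
    using J by (auto simp: is_jordan_decomposition_def)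
  have key: "measure a (A \<inter> B) = c * measure a B" if B: "B \<in> sets ?M" "B \<subseteq> P" for B
  proof -
    have "emeasure b B = 0" using B P m(2) by (intro emeasure_eq_0[OF _ P(3)]) (auto simp: fin_meas_def)
    then have b0: "measure b B = 0" "measure (dens b g) B = 0"
      using emeasure_dens_le[OF m(2) g(1) B(1)] by (simp_all add: measure_def)
    have "(\<lambda>x. ennreal (indicator A x)) = indicator A" by (auto simp: indicator_def)
    then have "measure (dens a (indicator A)) B = measure a (A \<inter> B)"
      unfolding dens_def measure_def using emeasure_restricted[of A a B] A B(1) m(1) by (simp add: fin_meas_def)
    moreover have "\<mu> B = measure a B - measure b B" using parts_eq[OF radon_signed[OF mu]] by (simp add: a_def b_def)
    ultimately show ?thesis using fun_cong[OF c, of B] b0 by (simp add: dens_diff_def)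
  qed
  have nP: "measure a (S \<inter> P) = measure a S" if S: "S \<in> sets ?M" for S
  proof -
    have OP: "\<Omega> - P \<in> sets ?M" using P(1) Omega_sets by auto
    have "S - P \<subseteq> \<Omega> - P" using sets.sets_into_space[OF S] by auto
    then have "emeasure a (S - P) = 0" using OP m(1) by (intro emeasure_eq_0[OF _ P(2)]) (auto simp: fin_meas_def)
    then have "measure a (S - P) = 0" by (simp add: measure_def)
    moreover have "measure a (S - P) = measure a S - measure a (S \<inter> P)"
      using a.finite_measure_Diff'[of S P] S P(1) m(1) by (simp add: fin_meas_def)
    ultimately show ?thesis by simp
  qed
  have "A \<inter> ((\<Omega> - A) \<inter> P) = {}" by auto
  then have 1: "c * measure a (\<Omega> - A) = 0"
    using key[of "(\<Omega> - A) \<inter> P"] nP[OF OA] OA P(1) by simp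
  have "A \<inter> (A \<inter> P) = A \<inter> P" by auto
  then have 2: "measure a A = c * measure a A"
    using key[of "A \<inter> P"] nP[OF A] A P(1) by simp
  show ?thesis
  proof (cases "c = 0")
    case True then show ?thesis using 2 by (simp add: a_def)
  next
    case False then show ?thesis using 1 by (simp add: a_def)
  qed
qed

lemma extremal_minus:
  fixes \<Omega> :: "'a::euclidean_space set"
  assumes ab: "0 < \<alpha>" "0 < \<beta>"
    and ex: "\<mu> \<in> extremal_points (KR_ball \<Omega> p \<alpha> \<beta>)"
  shows "(\<lambda>A. - \<mu> A) \<in> extremal_points (KR_ball \<Omega> p \<alpha> \<beta>)"
proof -
  have neg: "(\<lambda>A. - v A) \<in> KR_ball \<Omega> p \<alpha> \<beta>" if "v \<in> KR_ball \<Omega> p \<alpha> \<beta>" for v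
    using that KR_norm_minus[of v \<Omega> \<alpha> \<beta> p] radon_minus[of v \<Omega>] ab by (auto simp: KR_ball_def)
  show ?thesis unfolding extremal_points_def
  proof (safe)
    show "(\<lambda>A. - \<mu> A) \<in> KR_ball \<Omega> p \<alpha> \<beta>" using ex neg by (simp add: extremal_points_def)
    fix v1 v2 and t :: real
    assume v: "v1 \<in> KR_ball \<Omega> p \<alpha> \<beta>" "v2 \<in> KR_ball \<Omega> p \<alpha> \<beta>" "0 < t" "t < 1"
      and eq: "(\<lambda>A. - \<mu> A) = (\<lambda>A. t * v1 A + (1 - t) * v2 A)"
    have "\<mu> A = t * (- v1 A) + (1 - t) * (- v2 A)" for A
      using fun_cong[OF eq, of A] by simp
    note D = extremal_pointsD[OF ex neg[OF v(1)] neg[OF v(2)] v(3,4) this]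
    have e: "\<And>A. \<mu> A = - v1 A" "\<And>A. \<mu> A = - v2 A" using fun_cong[OF D(1)] fun_cong[OF D(2)] by simp_all
    show "(\<lambda>A. - \<mu> A) = v1" by (rule ext) (simp add: e(1))
    show "(\<lambda>A. - \<mu> A) = v2" by (rule ext) (simp add: e(2))
  qed
qed

text \<open>
  Each member of a countable basis or its complement is null. Off the union of these null sets there is exactly one
  point, since basic open sets separate points.
\<close>

lemma zero_one_measure_point:
  fixes \<Omega> :: "'a::{second_countable_topology,t2_space} set"
  assumes m: "fin_meas \<Omega> m" and z: "\<And>A. A \<in> sets (borel_on \<Omega>) \<Longrightarrow> measure m A = 0 \<or> measure m (\<Omega> - A) = 0"
    and nz: "measure m \<Omega> \<noteq> 0"
  shows "\<exists>x\<in>\<Omega>. \<forall>B\<in>sets (borel_on \<Omega>). measure m B = measure m \<Omega> * indicator B x"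
proof -
  let ?M = "borel_on \<Omega>"
  interpret finite_measure m using m by (simp add: fin_meas_def)
  have sm: "sets m = sets ?M" and sp: "space m = \<Omega>" using fin_measD[OF m] by simp_all
  obtain \<B> :: "'a set set" where Bs: "countable \<B>" "topological_basis \<B>" using ex_countable_basis by blast
  have op: "\<Omega> \<inter> U \<in> sets ?M" if "open U" for U using that by (auto simp: sets_restrict_space)
  define F where "F = (\<lambda>U. if measure m (\<Omega> - U) = 0 then \<Omega> - U else \<Omega> \<inter> U)"
  have F: "F U \<in> null_sets m" if U: "U \<in> \<B>" for U
  proof -
    have oU: "\<Omega> \<inter> U \<in> sets ?M" using op Bs(2) U topological_basis_open by blast
    have e: "\<Omega> - \<Omega> \<inter> U = \<Omega> - U" by auto
    have "measure m (F U) = 0" using z[OF oU] by (auto simp: F_def e)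
    moreover have "\<Omega> - U \<in> sets ?M" using sets.Diff[OF Omega_sets oU] by (simp add: e)
    then have "F U \<in> sets m" using oU sm by (simp add: F_def)
    ultimately show ?thesis by (auto simp: null_sets_def emeasure_eq_measure)
  qed
  have N: "(\<Union>U\<in>\<B>. F U) \<in> null_sets m" using Bs(1) F by (rule null_sets_UN')
  have "\<Omega> \<noteq> (\<Union>U\<in>\<B>. F U)" using N nz by (auto simp: null_sets_def measure_def)
  moreover have "(\<Union>U\<in>\<B>. F U) \<subseteq> \<Omega>" by (auto simp: F_def split: if_splits)
  ultimately obtain x where x: "x \<in> \<Omega>" "x \<notin> (\<Union>U\<in>\<B>. F U)" by blast
  have rest: "\<Omega> - {x} \<subseteq> (\<Union>U\<in>\<B>. F U)"
  proof
    fix y assume y: "y \<in> \<Omega> - {x}"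
    then obtain V where V: "open V" "x \<in> V" "y \<notin> V" using t1_space[of x y] by auto
    obtain U where U: "U \<in> \<B>" "x \<in> U" "U \<subseteq> V" using topological_basisE[OF Bs(2) V(1,2)] by blast
    have "F U = \<Omega> - U" using x U by (auto simp: F_def split: if_splits)
    then show "y \<in> (\<Union>U\<in>\<B>. F U)" using U V y by auto
  qed
  have null: "measure m S = 0" if S: "S \<in> sets ?M" "x \<notin> S" for S
  proof -
    have "S \<subseteq> (\<Union>U\<in>\<B>. F U)" using S rest sets.sets_into_space[OF S(1)] by auto
    then have "S \<in> null_sets m" using null_sets_subset[OF N] S(1) sm by blast
    then show ?thesis by (simp add: null_sets_def measure_def)
  qed
  have "measure m B = measure m \<Omega> * indicator B x" if B: "B \<in> sets ?M" for B
  proof (cases "x \<in> B")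
    case True
    have "measure m (\<Omega> - B) = 0" using B Omega_sets True by (intro null) auto
    then show ?thesis using True finite_measure_compl[of B] B sm sp by simp
  next
    case False then show ?thesis using null[OF B] by simp
  qed
  then show ?thesis using x(1) by blast
qed


section \<open>Point masses and dipoles\<close>

lemma powr_subadditive:
  fixes s t p :: real
  assumes "0 \<le> s" "0 \<le> t" "0 < p" "p \<le> 1"
  shows "(s + t) powr p \<le> s powr p + t powr p"
proof (cases "s + t = 0")
  case True then show ?thesis using assms by simp
next
  case False
  then have st: "0 < s + t" using assms by linarith
  have u: "r / (s + t) \<le> (r / (s + t)) powr p" if "0 \<le> r" "r \<le> s + t" for r
    using powr_mono'[of p 1 "r / (s + t)"] that st assms by simp
  have "1 = s / (s + t) + t / (s + t)" using st by (simp add: add_divide_distrib[symmetric])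
  also have "\<dots> \<le> (s / (s + t)) powr p + (t / (s + t)) powr p"
    using assms by (intro add_mono u) auto
  also have "\<dots> = (s powr p + t powr p) / (s + t) powr p"
    using assms st by (simp add: powr_divide add_divide_distrib)
  finally show ?thesis using st by (simp add: field_simps)
qed

lemma norm_powr_triangle:
  fixes x y z :: "'a::real_normed_vector"
  assumes "0 < p" "p \<le> 1"
  shows "norm (x - z) powr p \<le> norm (x - y) powr p + norm (y - z) powr p"
proof -
  have "norm (x - z) \<le> norm (x - y) + norm (y - z)" using norm_triangle_ineq[of "x - y" "y - z"] by simp
  then have "norm (x - z) powr p \<le> (norm (x - y) + norm (y - z)) powr p" using assms by (intro powr_mono2) auto
  also have "\<dots> \<le> norm (x - y) powr p + norm (y - z) powr p" using assms by (intro powr_subadditive) auto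
  finally show ?thesis .
qed

lemma fin_meas_return: "x \<in> \<Omega> \<Longrightarrow> fin_meas \<Omega> (return (borel_on \<Omega>) x)"
  by (auto simp: fin_meas_def intro!: prob_space.finite_measure prob_space_return)

lemma dirac_sets: "A \<in> sets (borel_on \<Omega>) \<Longrightarrow> dirac \<Omega> x A = indicator A x"
  by (simp add: dirac_def measure_return)

lemma dirac_signed: "x \<in> \<Omega> \<Longrightarrow> dirac \<Omega> x \<in> signed_measures \<Omega>"
  unfolding dirac_def by (intro fin_meas_signed fin_meas_return)

lemma sint_dirac:
  assumes x: "x \<in> \<Omega>" and f: "bdd_meas \<Omega> f" shows "sint \<Omega> (dirac \<Omega> x) f = f x"
proof -
  have "sint \<Omega> (dirac \<Omega> x) f = (\<integral>z. f z \<partial>return (borel_on \<Omega>) x) - (\<integral>z. f z \<partial>null_measure (borel_on \<Omega>))"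
    by (rule sint_eq[OF dirac_signed[OF x] fin_meas_return[OF x] fin_meas_null _ f]) (simp add: dirac_def)
  also have "(\<integral>z. f z \<partial>return (borel_on \<Omega>) x) = f x"
    using x f by (intro integral_return) (auto simp: bdd_meas_def)
  also have "(\<integral>z. f z \<partial>null_measure (borel_on \<Omega>)) = 0" 
    using f by (auto simp: bdd_meas_def integrable_iff_bounded nn_integral_null_measure has_bochner_integral_iff
        intro!: integral_eq_zero_AE AE_I'[of "\<Omega>"] Omega_sets)
  finally show ?thesis by simp
qed

lemma two_point_radon:
  fixes \<Omega> :: "'a::t2_space set"
  assumes "x \<in> \<Omega>" "y \<in> \<Omega>"
  shows "(\<lambda>A. c1 * dirac \<Omega> x A + c2 * dirac \<Omega> y A) \<in> radon_measures \<Omega>"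
proof (rule finite_support_radon[where F = "{x, y}"])
  show "(\<lambda>A. c1 * dirac \<Omega> x A + c2 * dirac \<Omega> y A) \<in> signed_measures \<Omega>"
    using assms by (intro signed_measures_lincomb dirac_signed)
qed (auto simp: dirac_sets)

lemma sint_two_point:
  assumes "x \<in> \<Omega>" "y \<in> \<Omega>" "bdd_meas \<Omega> f"
  shows "sint \<Omega> (\<lambda>A. c1 * dirac \<Omega> x A + c2 * dirac \<Omega> y A) f = c1 * f x + c2 * f y"
  using assms by (simp add: sint_lincomb dirac_signed sint_dirac)

lemma KR_norm_le_tv:
  fixes \<Omega> :: "'a::euclidean_space set"
  assumes mu: "\<mu> \<in> radon_measures \<Omega>" and ab: "0 \<le> \<alpha>" "0 \<le> \<beta>"
  shows "KR_norm \<Omega> p \<alpha> \<beta> \<mu> \<le> ennreal (\<alpha> * tv \<Omega> \<mu> \<Omega>)"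
proof -
  let ?N = "null_measure (borel_on \<Omega> \<Otimes>\<^sub>M borel_on \<Omega>)"
  have i0: "integral\<^sup>L ?N f = 0" "integrable ?N f" if "f \<in> borel_measurable (borel_on \<Omega> \<Otimes>\<^sub>M borel_on \<Omega>)" for f :: "'a \<times> 'a \<Rightarrow> real"
    using that by (auto simp: integrable_iff_bounded nn_integral_null_measure intro!: integral_eq_zero_AE)
  have dm: "(\<lambda>z. norm (fst z - snd z) powr p) \<in> borel_measurable (borel_on \<Omega> \<Otimes>\<^sub>M borel_on \<Omega>)"
    by (rule cost_measurable[OF refl])
  have "subplan \<Omega> p (pos_part \<Omega> \<mu>) (neg_part \<Omega> \<mu>) ?N"
    using i0(2)[OF dm] by (simp add: subplan_def)
  from KR_norm_le_plan_cost[OF mu radon_jordan[OF mu] this ab] show ?thesis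
    using i0(1)[OF dm] by (simp add: plan_cost_def tv_def)
qed

text \<open>
  The point mass is created in full at cost \<open>\<alpha>\<close> per unit.
\<close>

lemma point_mass_in_ball:
  fixes \<Omega> :: "'a::euclidean_space set"
  assumes x: "x \<in> \<Omega>" and ab: "0 \<le> \<alpha>" "0 \<le> \<beta>" and c: "\<alpha> * \<bar>c\<bar> \<le> 1"
  shows "(\<lambda>A. c * dirac \<Omega> x A) \<in> KR_ball \<Omega> p \<alpha> \<beta>"
proof -
  have rad: "(\<lambda>A. c * dirac \<Omega> x A) \<in> radon_measures \<Omega>"
    using two_point_radon[OF x x, of c 0] by simp
  have "tv \<Omega> (\<lambda>A. c * dirac \<Omega> x A) \<Omega> \<le> \<bar>c\<bar>"
  proof (rule tv_le[OF radon_signed[OF rad] Omega_sets])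
    fix E assume "E \<in> sets (borel_on \<Omega>)"
    then have "E \<in> sets (borel_on \<Omega>)" "\<Omega> - E \<in> sets (borel_on \<Omega>)" using Omega_sets by auto
    then show "c * dirac \<Omega> x E - c * dirac \<Omega> x (\<Omega> - E) \<le> \<bar>c\<bar>"
      by (auto simp: dirac_sets indicator_def)
  qed
  then have "\<alpha> * tv \<Omega> (\<lambda>A. c * dirac \<Omega> x A) \<Omega> \<le> 1" using c ab by (meson mult_left_mono order_trans)
  then have "ennreal (\<alpha> * tv \<Omega> (\<lambda>A. c * dirac \<Omega> x A) \<Omega>) \<le> 1" by (simp add: ennreal_le_1)
  then show ?thesis using KR_norm_le_tv[OF rad ab, of p] rad by (auto simp: KR_ball_def intro: order_trans)
qed

text \<open>
  Transporting one unit from \<open>x\<close> to \<open>y\<close> costs \<open>\<beta> + |x - y|^p\<close>, with nothing left to create or delete.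
\<close>

lemma dipole_in_ball:
  fixes \<Omega> :: "'a::euclidean_space set"
  assumes x: "x \<in> \<Omega>" and y: "y \<in> \<Omega>" and xy: "x \<noteq> y" and ab: "0 < \<alpha>" "0 < \<beta>"
  shows "(\<lambda>A. 1 / (\<beta> + norm (x - y) powr p) * (dirac \<Omega> x A - dirac \<Omega> y A)) \<in> KR_ball \<Omega> p \<alpha> \<beta>"
proof -
  let ?M = "borel_on \<Omega>"
  let ?u = "\<lambda>A. dirac \<Omega> x A - dirac \<Omega> y A"
  define D where "D = \<beta> + norm (x - y) powr p"
  have D: "0 < D" unfolding D_def using ab by (intro add_pos_nonneg) auto
  have rad: "?u \<in> radon_measures \<Omega>" using two_point_radon[OF x y, of 1 "-1"] by simp
  have sx: "{x} \<in> sets ?M" using x by (intro compact_in_borel_on) auto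
  have J: "is_jordan_decomposition \<Omega> ?u (return ?M x) (return ?M y)"
    unfolding is_jordan_decomposition_def
  proof (intro conjI ballI bexI[OF _ sx])
    have "\<Omega> - {x} \<in> sets ?M" using sx Omega_sets by auto
    then show "emeasure (return ?M x) (\<Omega> - {x}) = 0" by simp
    show "emeasure (return ?M y) {x} = 0" using sx xy by simp
  qed (use fin_meas_return[OF x] fin_meas_return[OF y] in \<open>auto simp: fin_meas_def dirac_def\<close>)
  let ?g = "return (?M \<Otimes>\<^sub>M ?M) (x, y)"
  have sp: "(x, y) \<in> space (?M \<Otimes>\<^sub>M ?M)" using x y by (simp add: space_pair_measure)
  have dm: "(\<lambda>z. norm (fst z - snd z) powr p) \<in> borel_measurable (?M \<Otimes>\<^sub>M ?M)" by (rule cost_measurable[OF refl])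
  have "subplan \<Omega> p (return ?M x) (return ?M y) ?g"
    unfolding subplan_def
  proof (intro conjI ballI)
    show "integrable ?g (\<lambda>z. norm (fst z - snd z) powr p)"
      unfolding integrable_iff_bounded
      using dm nn_integral_return[OF sp, of "\<lambda>z. ennreal (norm (norm (fst z - snd z) powr p))"] by simp
    fix B assume B: "B \<in> sets ?M"
    then have "B \<times> \<Omega> \<in> sets (?M \<Otimes>\<^sub>M ?M)" "\<Omega> \<times> B \<in> sets (?M \<Otimes>\<^sub>M ?M)" using Omega_sets by auto
    then show "emeasure ?g (B \<times> \<Omega>) \<le> emeasure (return ?M x) B" "emeasure ?g (\<Omega> \<times> B) \<le> emeasure (return ?M y) B"
      using B by (auto simp: indicator_def)
  qed simp
  moreover have "plan_cost \<Omega> p \<alpha> \<beta> (return ?M x) (return ?M y) ?g = D"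
  proof -
    have "\<Omega> \<times> \<Omega> \<in> sets (?M \<Otimes>\<^sub>M ?M)" using Omega_sets by auto
    then show ?thesis
      using x y integral_return[OF sp dm]
      by (simp add: plan_cost_def measure_return Omega_sets D_def)
  qed
  ultimately have "KR_norm \<Omega> p \<alpha> \<beta> ?u \<le> ennreal D"
    using KR_norm_le_plan_cost[OF rad J, of p ?g \<alpha> \<beta>] ab by simp
  from KR_norm_scale[OF rad _ _ _ this, of "1 / D"] have "KR_norm \<Omega> p \<alpha> \<beta> (\<lambda>A. 1 / D * ?u A) \<le> ennreal (1 / D * D)"
    using ab D by simp
  moreover have "(\<lambda>A. 1 / D * ?u A) \<in> radon_measures \<Omega>" by (rule radon_scale[OF rad])
  ultimately show ?thesis using D by (simp add: KR_ball_def D_def)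
qed

section \<open>Exposing test functions\<close>

lemma ball_sint_le:
  fixes \<Omega> :: "'a::euclidean_space set"
  assumes v: "v \<in> KR_ball \<Omega> p \<alpha> \<beta>" and ab: "0 < \<alpha>" "0 < \<beta>" and f: "test_fun \<Omega> p \<alpha> \<beta> f"
  shows "sint \<Omega> v f \<le> 1"
proof -
  have "ennreal (sint \<Omega> v f) \<le> KR_norm \<Omega> p \<alpha> \<beta> v"
    using v ab f by (intro KR_norm_dual) (auto simp: KR_ball_def radon_signed)
  also have "\<dots> \<le> 1" using v by (simp add: KR_ball_def)
  finally show ?thesis by (simp add: ennreal_le_1)
qed

text \<open>
  A \<open>p\<close>-Lipschitz function may be perturbed by any function of size \<open>\<beta>/2\<close>, however irregular: the fixed fee
  \<open>\<beta>\<close> absorbs the jumps. This freedom makes the extremal points exposed.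
\<close>

lemma test_fun_add:
  fixes \<Omega> :: "'a::euclidean_space set"
  assumes "f \<in> borel_measurable (borel_on \<Omega>)" "e \<in> borel_measurable (borel_on \<Omega>)"
    and "\<And>z. z \<in> \<Omega> \<Longrightarrow> \<bar>f z\<bar> \<le> \<alpha> - \<beta> / 2" "\<And>z. z \<in> \<Omega> \<Longrightarrow> \<bar>e z\<bar> \<le> \<beta> / 2"
    and "\<And>z w. z \<in> \<Omega> \<Longrightarrow> w \<in> \<Omega> \<Longrightarrow> f z - f w \<le> norm (z - w) powr p"
  shows "test_fun \<Omega> p \<alpha> \<beta> (\<lambda>z. f z + e z)"
  unfolding test_fun_def
proof (intro conjI ballI)
  show "(\<lambda>z. f z + e z) \<in> borel_measurable (borel_on \<Omega>)" using assms by simp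
  fix z assume z: "z \<in> \<Omega>"
  show "\<bar>f z + e z\<bar> \<le> \<alpha>" using assms(3)[OF z] assms(4)[OF z] by linarith
  fix w assume w: "w \<in> \<Omega>"
  show "f z + e z - (f w + e w) \<le> \<beta> + norm (z - w) powr p"
    using assms(4)[OF z] assms(4)[OF w] assms(5)[OF z w] by linarith
qed

text \<open>
  The linear functional given by \<open>g\<close> must vanish on the face where \<open>f\<close> attains \<open>1\<close> if \<open>f\<close> can be moved a little
  in both directions \<open>g\<close> and \<open>-g\<close>.
\<close>

lemma ball_exposed:
  fixes \<Omega> :: "'a::euclidean_space set"
  assumes v: "v \<in> KR_ball \<Omega> p \<alpha> \<beta>" and ab: "0 < \<alpha>" "0 < \<beta>" and f: "bdd_meas \<Omega> f" and one: "sint \<Omega> v f = 1"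
    and g: "bdd_meas \<Omega> g" and k: "0 < k"
    and t: "test_fun \<Omega> p \<alpha> \<beta> (\<lambda>z. f z + k * g z)" "test_fun \<Omega> p \<alpha> \<beta> (\<lambda>z. f z + (- k) * g z)"
  shows "sint \<Omega> v g = 0"
proof -
  have s: "v \<in> signed_measures \<Omega>" using v by (simp add: KR_ball_def radon_signed)
  have "k * sint \<Omega> v g \<le> 0" "- k * sint \<Omega> v g \<le> 0"
    using ball_sint_le[OF v ab t(1)] ball_sint_le[OF v ab t(2)]
    unfolding sint_fun_add[OF s f g] one by simp_all
  then have "k * sint \<Omega> v g = 0" by simp
  then show ?thesis using k by simp
qed

lemma extremalI_exposed:
  fixes \<Omega> :: "'a::euclidean_space set"
  assumes ab: "0 < \<alpha>" "0 < \<beta>" and u: "u \<in> KR_ball \<Omega> p \<alpha> \<beta>" and f: "test_fun \<Omega> p \<alpha> \<beta> f" and one: "sint \<Omega> u f = 1"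
    and uniq: "\<And>v. v \<in> KR_ball \<Omega> p \<alpha> \<beta> \<Longrightarrow> sint \<Omega> v f = 1 \<Longrightarrow> v = u"
  shows "u \<in> extremal_points (KR_ball \<Omega> p \<alpha> \<beta>)"
  unfolding extremal_points_def
proof (intro CollectI conjI u ballI allI impI)
  fix v1 v2 and t :: real
  assume v: "v1 \<in> KR_ball \<Omega> p \<alpha> \<beta>" "v2 \<in> KR_ball \<Omega> p \<alpha> \<beta>" and t: "0 < t" "t < 1"
    and eq: "u = (\<lambda>A. t * v1 A + (1 - t) * v2 A)"
  have s: "v1 \<in> signed_measures \<Omega>" "v2 \<in> signed_measures \<Omega>" using v by (simp_all add: KR_ball_def radon_signed)
  have e: "t * sint \<Omega> v1 f + (1 - t) * sint \<Omega> v2 f = 1"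
    using one unfolding eq sint_lincomb[OF s test_fun_bdd_meas[OF f]] .
  have l: "sint \<Omega> v1 f \<le> 1" "sint \<Omega> v2 f \<le> 1" using ball_sint_le[OF _ ab f] v by simp_all
  have "t * (1 - sint \<Omega> v1 f) + (1 - t) * (1 - sint \<Omega> v2 f) = 0" using e by (simp add: algebra_simps)
  moreover have "0 \<le> t * (1 - sint \<Omega> v1 f)" "0 \<le> (1 - t) * (1 - sint \<Omega> v2 f)" using l t by simp_all
  ultimately have "t * (1 - sint \<Omega> v1 f) = 0" "(1 - t) * (1 - sint \<Omega> v2 f) = 0" by linarith+
  then have "sint \<Omega> v1 f = 1" "sint \<Omega> v2 f = 1" using t by simp_all
  then show "u = v1" "u = v2" using uniq[OF v(1)] uniq[OF v(2)] by blast+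
qed

text \<open>
  The test function is \<open>\<alpha>\<close> at \<open>x\<close> and \<open>\<alpha> - \<beta>/2\<close> elsewhere. Away from \<open>x\<close> it can be varied by \<open>\<beta>/2\<close> in
  both directions, so a measure of the ball at which it attains \<open>1\<close> is carried by \<open>x\<close>.
\<close>

lemma point_mass_extremal:
  fixes \<Omega> :: "'a::euclidean_space set"
  assumes x: "x \<in> \<Omega>" and ab: "0 < \<alpha>" "0 < \<beta>" "\<beta> < 2 * \<alpha>"
  shows "(\<lambda>A. 1 / \<alpha> * dirac \<Omega> x A) \<in> extremal_points (KR_ball \<Omega> p \<alpha> \<beta>)"
proof -
  let ?M = "borel_on \<Omega>"
  have sx: "{x} \<in> sets ?M" using x by (intro compact_in_borel_on) auto
  define f where "f = (\<lambda>z. (\<alpha> - \<beta> / 2) + \<beta> / 2 * indicator {x} z)"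
  have tf: "test_fun \<Omega> p \<alpha> \<beta> (\<lambda>z. (\<alpha> - \<beta> / 2) + e z)"
    if "e \<in> borel_measurable ?M" "\<And>z. z \<in> \<Omega> \<Longrightarrow> \<bar>e z\<bar> \<le> \<beta> / 2" for e
    using that ab by (intro test_fun_add) auto
  have f: "test_fun \<Omega> p \<alpha> \<beta> f"
    unfolding f_def using sx ab by (intro tf) (auto simp: indicator_def)
  note fb = test_fun_bdd_meas[OF f]
  have fx: "f x = \<alpha>" by (simp add: f_def)
  show ?thesis
  proof (rule extremalI_exposed[OF ab(1,2) _ f])
    show "(\<lambda>A. 1 / \<alpha> * dirac \<Omega> x A) \<in> KR_ball \<Omega> p \<alpha> \<beta>" using x ab by (intro point_mass_in_ball) auto
    show "sint \<Omega> (\<lambda>A. 1 / \<alpha> * dirac \<Omega> x A) f = 1"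
      using sint_two_point[OF x x fb, of "1 / \<alpha>" 0] ab by (simp add: fx)
    fix v assume v: "v \<in> KR_ball \<Omega> p \<alpha> \<beta>" and one: "sint \<Omega> v f = 1"
    have sv: "v \<in> signed_measures \<Omega>" using v by (simp add: KR_ball_def radon_signed)
    have off: "v B = 0" if B: "B \<in> sets ?M" "x \<notin> B" for B
    proof -
      have t: "test_fun \<Omega> p \<alpha> \<beta> (\<lambda>z. f z + c * indicator B z)" if c: "\<bar>c\<bar> \<le> \<beta> / 2" for c
      proof -
        have "test_fun \<Omega> p \<alpha> \<beta> (\<lambda>z. (\<alpha> - \<beta> / 2) + (\<beta> / 2 * indicator {x} z + c * indicator B z))"
          using sx B c ab by (intro tf) (auto simp: indicator_def)
        then show ?thesis by (simp add: f_def add.assoc)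
      qed
      have "sint \<Omega> v (indicator B) = 0"
        using ab by (intro ball_exposed[OF v ab(1,2) fb one bdd_meas_indicator[OF B(1)], of "\<beta> / 2"] t) auto
      then show ?thesis by (simp add: sint_indicator[OF sv B(1)])
    qed
    have vA: "v A = v {x} * dirac \<Omega> x A" if A: "A \<in> sets ?M" for A
    proof (cases "x \<in> A")
      case True
      have "v A = v {x} + v (A - {x})"
        using True by (intro real_cadd_Diff[OF signed_measures_real_cadd[OF sv] A sx]) auto
      also have "v (A - {x}) = 0" using A sx by (intro off) auto
      finally show ?thesis using True A by (simp add: dirac_sets)
    next
      case False then show ?thesis using off[OF A] A by (simp add: dirac_sets)
    qed
    have ve: "v = (\<lambda>A. v {x} * dirac \<Omega> x A)"
      by (rule signed_measures_eqI[OF sv signed_measures_scale[OF dirac_signed[OF x]] vA])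
    have "1 = v {x} * \<alpha>"
      using one sint_two_point[OF x x fb, of "v {x}" 0] ve fx by simp
    then have "v {x} = 1 / \<alpha>" using ab by (simp add: field_simps)
    then show "v = (\<lambda>A. 1 / \<alpha> * dirac \<Omega> x A)" using ve by simp
  qed
qed

lemma norm_powr_borel:
  fixes \<Omega> :: "'a::euclidean_space set"
  shows "(\<lambda>z. norm (z - y) powr p) \<in> borel_measurable (borel_on \<Omega>)"
proof -
  have "(\<lambda>z. norm (z - y) powr p) \<in> borel_measurable (borel :: 'a measure)" by measurable
  then show ?thesis by (rule measurable_restrict_space1)
qed

text \<open>
  The test function is \<open>(|z - y|^p - |z - x|^p)/2\<close>, raised by \<open>\<beta>/2\<close> at \<open>x\<close> and lowered by \<open>\<beta>/2\<close> at \<open>y\<close>. Off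
  these points it may vary freely by \<open>\<beta>/2\<close>, which confines the exposed face to measures carried by \<open>{x, y}\<close>.
  Since \<open>|x - y|^p < 2 \<alpha> - \<beta>\<close>, its absolute value stays below \<open>\<alpha>\<close>, so that constants may be added as well; this
  forces total mass \<open>0\<close>.
\<close>

lemma dipole_extremal:
  fixes \<Omega> :: "'a::euclidean_space set"
  assumes x: "x \<in> \<Omega>" and y: "y \<in> \<Omega>" and xy: "x \<noteq> y" and p: "0 < p" "p \<le> 1"
    and ab: "0 < \<alpha>" "0 < \<beta>" and d: "norm (x - y) powr p < 2 * \<alpha> - \<beta>"
  shows "(\<lambda>A. 1 / (\<beta> + norm (x - y) powr p) * (dirac \<Omega> x A - dirac \<Omega> y A)) \<in> extremal_points (KR_ball \<Omega> p \<alpha> \<beta>)"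
proof -
  let ?M = "borel_on \<Omega>"
  let ?N = "\<lambda>u v. norm (u - v) powr p"
  have sx: "{x} \<in> sets ?M" "{y} \<in> sets ?M" using x y by (auto intro!: compact_in_borel_on)
  define D where "D = \<beta> + ?N x y"
  have D: "0 < D" unfolding D_def using ab by (intro add_pos_nonneg) auto
  \<comment> \<open>The slack in \<open>|f| \<le> \<alpha>\<close>, available for adding constants.\<close>
  define k where "k = \<alpha> - D / 2"
  have k: "0 < k" using d by (simp add: k_def D_def)
  define f0 where "f0 = (\<lambda>z. (?N z y - ?N z x) / 2)"
  define e0 where "e0 = (\<lambda>z. \<beta> / 2 * indicator {x} z - \<beta> / 2 * indicator {y} z)"
  have sym: "?N u v = ?N v u" for u v by (simp add: norm_minus_commute)
  note tri = norm_powr_triangle[OF p]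
  have tf: "test_fun \<Omega> p \<alpha> \<beta> (\<lambda>z. (f0 z + c) + e z)"
    if "e \<in> borel_measurable ?M" "\<And>z. z \<in> \<Omega> \<Longrightarrow> \<bar>e z\<bar> \<le> \<beta> / 2" "\<bar>c\<bar> \<le> k" for e c
  proof (rule test_fun_add)
    show "(\<lambda>z. f0 z + c) \<in> borel_measurable ?M" unfolding f0_def
      by (intro borel_measurable_add borel_measurable_divide borel_measurable_diff norm_powr_borel) auto
    fix z
    have "\<bar>f0 z\<bar> \<le> ?N x y / 2"
      using tri[of z y x] tri[of z x y] sym[of x y] unfolding f0_def by auto
    moreover have "\<bar>c\<bar> \<le> \<alpha> - \<beta> / 2 - ?N x y / 2"
      using that(3) by (simp add: k_def D_def add_divide_distrib)
    ultimately show "\<bar>f0 z + c\<bar> \<le> \<alpha> - \<beta> / 2" using abs_triangle_ineq[of "f0 z" c] by linarith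
    fix w
    show "f0 z + c - (f0 w + c) \<le> ?N z w"
      using tri[of z y w] tri[of w x z] sym[of w z] unfolding f0_def by (auto simp: field_simps)
  qed (use that in auto)
  have e0: "e0 \<in> borel_measurable ?M" "\<bar>e0 z\<bar> \<le> \<beta> / 2" for z
    unfolding e0_def using sx ab xy by (auto simp: indicator_def)
  define f where "f = (\<lambda>z. f0 z + e0 z)"
  have f: "test_fun \<Omega> p \<alpha> \<beta> f" unfolding f_def using tf[OF e0, of 0] k by simp
  note fb = test_fun_bdd_meas[OF f]
  have fxy: "f x = D / 2" "f y = - D / 2"
    using xy p sym[of x y] by (simp_all add: f_def f0_def e0_def D_def add_divide_distrib)
  show ?thesis
  proof (rule extremalI_exposed[OF ab _ f])
    show "(\<lambda>A. 1 / (\<beta> + ?N x y) * (dirac \<Omega> x A - dirac \<Omega> y A)) \<in> KR_ball \<Omega> p \<alpha> \<beta>"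
      by (rule dipole_in_ball[OF x y xy ab])
    have "(\<lambda>A. 1 / (\<beta> + ?N x y) * (dirac \<Omega> x A - dirac \<Omega> y A)) = (\<lambda>A. (1 / D) * dirac \<Omega> x A + (- 1 / D) * dirac \<Omega> y A)"
      by (simp add: D_def right_diff_distrib)
    then show "sint \<Omega> (\<lambda>A. 1 / (\<beta> + ?N x y) * (dirac \<Omega> x A - dirac \<Omega> y A)) f = 1"
      using sint_two_point[OF x y fb, of "1 / D" "- 1 / D"] D by (simp add: fxy)
    fix v assume v: "v \<in> KR_ball \<Omega> p \<alpha> \<beta>" and one: "sint \<Omega> v f = 1"
    have sv: "v \<in> signed_measures \<Omega>" using v by (simp add: KR_ball_def radon_signed)
    note ca = signed_measures_real_cadd[OF sv]
    have off: "v B = 0" if B: "B \<in> sets ?M" "x \<notin> B" "y \<notin> B" for B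
    proof -
      have t: "test_fun \<Omega> p \<alpha> \<beta> (\<lambda>z. f z + c * indicator B z)" if c: "\<bar>c\<bar> \<le> \<beta> / 2" for c
      proof -
        have "test_fun \<Omega> p \<alpha> \<beta> (\<lambda>z. (f0 z + 0) + (e0 z + c * indicator B z))"
        proof (rule tf)
          show "(\<lambda>z. e0 z + c * indicator B z) \<in> borel_measurable ?M" using e0 B by simp
          fix z show "\<bar>e0 z + c * indicator B z\<bar> \<le> \<beta> / 2"
            using e0(2)[of z] B c by (auto simp: e0_def indicator_def)
        qed (use k in simp)
        then show ?thesis by (simp add: f_def add.assoc)
      qed
      have "sint \<Omega> v (indicator B) = 0"
        using ab by (intro ball_exposed[OF v ab fb one bdd_meas_indicator[OF B(1)], of "\<beta> / 2"] t) auto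
      then show ?thesis by (simp add: sint_indicator[OF sv B(1)])
    qed
    have tot: "v \<Omega> = 0"
    proof -
      have t: "test_fun \<Omega> p \<alpha> \<beta> (\<lambda>z. f z + c * indicator \<Omega> z)" if c: "\<bar>c\<bar> \<le> k" for c
      proof -
        \<comment> \<open>Only the values on \<open>\<Omega>\<close> matter, where the indicator is \<open>1\<close>.\<close>
        have "test_fun \<Omega> p \<alpha> \<beta> (\<lambda>z. (f0 z + c) + e0 z)" by (rule tf[OF e0 c])
        then show ?thesis unfolding test_fun_def
          by (auto simp: f_def algebra_simps elim!: measurable_cong[THEN iffD1, rotated])
      qed
      have "sint \<Omega> v (indicator \<Omega>) = 0"
        using k by (intro ball_exposed[OF v ab fb one bdd_meas_indicator[OF Omega_sets], of k] t) auto
      then show ?thesis by (simp add: sint_indicator[OF sv Omega_sets])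
    qed
    have vA: "v A = v {x} * dirac \<Omega> x A + v {y} * dirac \<Omega> y A" if A: "A \<in> sets ?M" for A
    proof -
      have AA: "A \<inter> {x} \<in> sets ?M" "A - {x} \<in> sets ?M" using A sx by auto
      have "v A = v (A \<inter> {x}) + v (A - {x})" by (rule real_cadd_split[OF ca A sx(1)])
      moreover have "v (A - {x}) = v ((A - {x}) \<inter> {y}) + v (A - {x} - {y})"
        by (rule real_cadd_split[OF ca AA(2) sx(2)])
      moreover have "v (A - {x} - {y}) = 0" using A sx by (intro off) auto
      moreover have "v (A \<inter> {x}) = v {x} * dirac \<Omega> x A"
        using A real_cadd_empty[OF ca] by (cases "x \<in> A") (simp_all add: dirac_sets)
      moreover have "v ((A - {x}) \<inter> {y}) = v {y} * dirac \<Omega> y A"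
      proof (cases "y \<in> A")
        case True
        then have "(A - {x}) \<inter> {y} = {y}" using xy by auto
        then show ?thesis using True A by (simp add: dirac_sets)
      next
        case False
        then have "(A - {x}) \<inter> {y} = {}" by auto
        then show ?thesis using False A real_cadd_empty[OF ca] by (simp add: dirac_sets)
      qed
      ultimately show ?thesis by simp
    qed
    have ve: "v = (\<lambda>A. v {x} * dirac \<Omega> x A + v {y} * dirac \<Omega> y A)"
      by (rule signed_measures_eqI[OF sv signed_measures_lincomb[OF dirac_signed[OF x] dirac_signed[OF y]] vA])
    have "v {y} = - v {x}" using vA[OF Omega_sets] tot x y by (simp add: dirac_sets Omega_sets)
    moreover have "1 = v {x} * (D / 2) + v {y} * (- D / 2)"
      using one sint_two_point[OF x y fb, of "v {x}" "v {y}"] ve fxy by simp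
    ultimately have "v {x} = 1 / D" "v {y} = - 1 / D" using D by (simp_all add: field_simps)
    then show "v = (\<lambda>A. 1 / (\<beta> + ?N x y) * (dirac \<Omega> x A - dirac \<Omega> y A))"
      using ve by (simp add: D_def right_diff_distrib)
  qed
qed

section \<open>Extremal points are point masses or dipoles\<close>

text \<open>
  The least test function with the value \<open>\<alpha>\<close> at \<open>x\<close>. It measures the exact norm of \<open>a \<delta>\<^sub>x - b \<delta>\<^sub>y\<close> for \<open>0 \<le> b \<le> a\<close>.
\<close>

lemma cone_test_fun:
  fixes \<Omega> :: "'a::euclidean_space set"
  assumes x: "x \<in> \<Omega>" and p: "0 < p" "p \<le> 1" and ab: "0 < \<alpha>" "0 < \<beta>"
  shows "test_fun \<Omega> p \<alpha> \<beta> (\<lambda>z. if z = x then \<alpha> else max (- \<alpha>) (\<alpha> - \<beta> - norm (z - x) powr p))"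
  unfolding test_fun_def
proof (intro conjI ballI)
  have sx: "{x} \<in> sets (borel_on \<Omega>)" using x by (intro compact_in_borel_on) auto
  have "{z \<in> space (borel_on \<Omega>). z = x} = {x}" using x by auto
  then show "(\<lambda>z. if z = x then \<alpha> else max (- \<alpha>) (\<alpha> - \<beta> - norm (z - x) powr p)) \<in> borel_measurable (borel_on \<Omega>)"
    using sx norm_powr_borel[of x p \<Omega>] by (intro measurable_If borel_measurable_max borel_measurable_diff) auto
  fix z
  have nz: "0 \<le> norm (z - x) powr p" by (rule powr_ge_zero)
  show "\<bar>if z = x then \<alpha> else max (- \<alpha>) (\<alpha> - \<beta> - norm (z - x) powr p)\<bar> \<le> \<alpha>"
    using ab nz by (auto simp only: max_def split: if_splits)
  fix w
  have nw: "0 \<le> norm (w - x) powr p" "0 \<le> norm (z - w) powr p" by (rule powr_ge_zero)+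
  have t: "norm (w - x) powr p \<le> norm (z - w) powr p + norm (z - x) powr p"
    using norm_powr_triangle[OF p, of w x z] by (simp add: norm_minus_commute)
  have c: "norm (x - w) powr p = norm (w - x) powr p" by (simp add: norm_minus_commute)
  show "(if z = x then \<alpha> else max (- \<alpha>) (\<alpha> - \<beta> - norm (z - x) powr p)) - (if w = x then \<alpha> else max (- \<alpha>) (\<alpha> - \<beta> - norm (w - x) powr p))
     \<le> \<beta> + norm (z - w) powr p"
  proof (cases "z = x")
    case True
    then show ?thesis using ab nw(1) c by (cases "w = x") (simp_all add: le_max_iff_disj diff_le_eq)
  next
    case False
    then show ?thesis
    proof (cases "w = x")
      case True
      then show ?thesis using False ab nw nz by (simp add: max_def)
    next
      case w: False
      have "max (- \<alpha>) (\<alpha> - \<beta> - norm (z - x) powr p) \<le> max (- \<alpha>) (\<alpha> - \<beta> - norm (w - x) powr p) + norm (z - w) powr p"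
        using t nw by (auto simp only: max_def split: if_splits)
      then have "max (- \<alpha>) (\<alpha> - \<beta> - norm (z - x) powr p) - max (- \<alpha>) (\<alpha> - \<beta> - norm (w - x) powr p) \<le> \<beta> + norm (z - w) powr p"
        using ab by linarith
      then show ?thesis using False w by (simp only: if_False)
    qed
  qed
qed

lemma const_test_fun: "0 < \<alpha> \<Longrightarrow> 0 < \<beta> \<Longrightarrow> test_fun \<Omega> p \<alpha> \<beta> (\<lambda>_. \<alpha>)"
  by (simp add: test_fun_def)

text \<open>
  If \<open>\<beta> + |x - y|^p < 2 \<alpha>\<close>, then \<open>a \<delta>\<^sub>x - b \<delta>\<^sub>y\<close> is the sum of a multiple of the dipole and of \<open>(a - b) \<delta>\<^sub>x\<close>;
  otherwise it is split into \<open>a \<delta>\<^sub>x\<close> and \<open>-b \<delta>\<^sub>y\<close>. The cone function shows that the norms of the summands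
  add up to at most \<open>1\<close>, so extremality leaves only the first summand, rescaled.
\<close>

lemma extremal_two_point:
  fixes \<Omega> :: "'a::euclidean_space set"
  assumes x: "x \<in> \<Omega>" and y: "y \<in> \<Omega>" and xy: "x \<noteq> y" and p: "0 < p" "p \<le> 1"
    and ab: "0 < \<alpha>" "0 < \<beta>"
    and ex: "\<mu> \<in> extremal_points (KR_ball \<Omega> p \<alpha> \<beta>)"
    and mu: "\<And>A. \<mu> A = a * dirac \<Omega> x A - b * dirac \<Omega> y A" and b: "0 < b" "b \<le> a"
  shows "\<mu> = (\<lambda>A. 1 / \<alpha> * dirac \<Omega> x A) \<or>
    norm (x - y) powr p < 2 * \<alpha> - \<beta> \<and> \<mu> = (\<lambda>A. 1 / (\<beta> + norm (x - y) powr p) * (dirac \<Omega> x A - dirac \<Omega> y A))"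
proof -
  define D where "D = \<beta> + norm (x - y) powr p"
  have D: "0 < D" unfolding D_def using ab by (intro add_pos_nonneg) auto
  define f where "f = (\<lambda>z. if z = x then \<alpha> else max (- \<alpha>) (\<alpha> - \<beta> - norm (z - x) powr p))"
  have f: "test_fun \<Omega> p \<alpha> \<beta> f" unfolding f_def by (rule cone_test_fun[OF x p ab])
  have ball: "\<mu> \<in> KR_ball \<Omega> p \<alpha> \<beta>" using ex by (simp add: extremal_points_def)
  have m: "\<mu> = (\<lambda>A. a * dirac \<Omega> x A + (- b) * dirac \<Omega> y A)" using mu by (intro ext) simp
  have fxy: "f x = \<alpha>" "f y = max (- \<alpha>) (\<alpha> - D)"
    using xy by (auto simp: f_def D_def norm_minus_commute diff_diff_eq)
  have le: "a * \<alpha> - b * max (- \<alpha>) (\<alpha> - D) \<le> 1"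
    using ball_sint_le[OF ball ab f] sint_two_point[OF x y test_fun_bdd_meas[OF f], of a "-b"]
    unfolding m[symmetric] by (simp add: fxy)
  show ?thesis
  proof (cases "D < 2 * \<alpha>")
    case True
    have le': "(a - b) * \<alpha> + b * D \<le> 1" using le True by (simp add: max_def algebra_simps)
    have nn: "0 \<le> (a - b) * \<alpha>" using b ab by simp
    let ?dip = "\<lambda>A. 1 / (\<beta> + norm (x - y) powr p) * (dirac \<Omega> x A - dirac \<Omega> y A)"
    have dip: "?dip \<in> KR_ball \<Omega> p \<alpha> \<beta>" by (rule dipole_in_ball[OF x y xy ab])
    have dip': "b * D * ?dip A = b * (dirac \<Omega> x A - dirac \<Omega> y A)" for A using D by (simp add: D_def)
    have "\<mu> = ?dip"
    proof (cases "b * D = 1")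
      case True
      then have "(a - b) * \<alpha> = 0" using le' nn by simp
      then have "a = b" using ab by simp
      have "\<mu> A = ?dip A" for A
      proof -
        have "?dip A = b * (dirac \<Omega> x A - dirac \<Omega> y A)" using dip'[of A] unfolding True mult_1 .
        then show ?thesis using mu[of A] \<open>a = b\<close> by (simp only: right_diff_distrib)
      qed
      then show ?thesis by (rule ext)
    next
      case False
      then have s: "0 < b * D" "b * D < 1" using le' nn b D by auto
      define w where "w = (\<lambda>A. (a - b) / (1 - b * D) * dirac \<Omega> x A)"
      have w: "w \<in> KR_ball \<Omega> p \<alpha> \<beta>" unfolding w_def
      proof (rule point_mass_in_ball[OF x])
        have "\<bar>(a - b) / (1 - b * D)\<bar> = (a - b) / (1 - b * D)" using b s by simp
        then show "\<alpha> * \<bar>(a - b) / (1 - b * D)\<bar> \<le> 1"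
          using le' s by (simp only:) (simp add: divide_le_eq mult.commute)
      qed (use ab in auto)
      have "\<mu> A = b * D * ?dip A + (1 - b * D) * w A" for A
      proof -
        have "(1 - b * D) * w A = (a - b) * dirac \<Omega> x A" using s by (simp add: w_def)
        then show ?thesis unfolding dip' mu by (simp add: algebra_simps)
      qed
      then show ?thesis by (rule extremal_pointsD(1)[OF ex dip w s])
    qed
    then show ?thesis using True by (simp add: D_def)
  next
    case False
    have "max (- \<alpha>) (\<alpha> - D) = - \<alpha>" using False by (intro max_absorb1) simp
    then have le': "a * \<alpha> + b * \<alpha> \<le> 1" using le by simp
    have s: "0 < a * \<alpha>" "a * \<alpha> < 1" using b ab le' mult_pos_pos[of b \<alpha>] by (simp, linarith)
    let ?u = "\<lambda>A. 1 / \<alpha> * dirac \<Omega> x A"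
    define w where "w = (\<lambda>A. - (b / (1 - a * \<alpha>)) * dirac \<Omega> y A)"
    have u: "?u \<in> KR_ball \<Omega> p \<alpha> \<beta>" using ab by (intro point_mass_in_ball[OF x]) auto
    have w: "w \<in> KR_ball \<Omega> p \<alpha> \<beta>" unfolding w_def
    proof (rule point_mass_in_ball[OF y])
      have "0 \<le> b / (1 - a * \<alpha>)" using b s by simp
      then show "\<alpha> * \<bar>- (b / (1 - a * \<alpha>))\<bar> \<le> 1" using le' s b by (simp add: divide_le_eq algebra_simps)
    qed (use ab in auto)
    have "\<mu> A = a * \<alpha> * ?u A + (1 - a * \<alpha>) * w A" for A
    proof -
      have "(1 - a * \<alpha>) * w A = - b * dirac \<Omega> y A" using s by (simp add: w_def)
      then show ?thesis unfolding mu using ab by simp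
    qed
    then have "\<mu> = ?u" by (rule extremal_pointsD(1)[OF ex u w s])
    then show ?thesis by blast
  qed
qed

text \<open>
  Every \<open>a \<delta>\<^sub>x\<close> with \<open>0 \<le> a < 1/\<alpha>\<close>, including the zero measure, lies strictly between \<open>-\<delta>\<^sub>x/\<alpha>\<close> and \<open>\<delta>\<^sub>x/\<alpha>\<close>.
\<close>

lemma extremal_one_point:
  fixes \<Omega> :: "'a::euclidean_space set"
  assumes x: "x \<in> \<Omega>" and ab: "0 < \<alpha>" "0 < \<beta>"
    and ex: "\<mu> \<in> extremal_points (KR_ball \<Omega> p \<alpha> \<beta>)"
    and mu: "\<And>A. \<mu> A = a * dirac \<Omega> x A" and a: "0 \<le> a"
  shows "\<mu> = (\<lambda>A. 1 / \<alpha> * dirac \<Omega> x A)"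
proof -
  let ?u = "\<lambda>A. 1 / \<alpha> * dirac \<Omega> x A"
  have ball: "\<mu> \<in> KR_ball \<Omega> p \<alpha> \<beta>" using ex by (simp add: extremal_points_def)
  have m: "\<mu> = (\<lambda>A. a * dirac \<Omega> x A + 0 * dirac \<Omega> x A)" using mu by (intro ext) simp
  note f = const_test_fun[OF ab, of \<Omega> p]
  have le: "a * \<alpha> \<le> 1"
    using ball_sint_le[OF ball ab f] sint_two_point[OF x x test_fun_bdd_meas[OF f], of a 0]
    unfolding m[symmetric] by simp
  have u: "?u \<in> KR_ball \<Omega> p \<alpha> \<beta>" using ab by (intro point_mass_in_ball[OF x]) auto
  have u': "(\<lambda>A. - 1 / \<alpha> * dirac \<Omega> x A) \<in> KR_ball \<Omega> p \<alpha> \<beta>" using ab by (intro point_mass_in_ball[OF x]) auto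
  show ?thesis
  proof (cases "a * \<alpha> = 1")
    case True
    then have "a = 1 / \<alpha>" using ab by (simp add: field_simps)
    then show ?thesis using mu by (intro ext) simp
  next
    case False
    have "0 \<le> a * \<alpha>" using a ab by simp
    then have s: "0 < (1 + a * \<alpha>) / 2" "(1 + a * \<alpha>) / 2 < 1" using False le by auto
    have "\<mu> A = (1 + a * \<alpha>) / 2 * ?u A + (1 - (1 + a * \<alpha>) / 2) * (- 1 / \<alpha> * dirac \<Omega> x A)" for A
      unfolding mu using ab by (simp add: field_simps)
    then show ?thesis by (rule extremal_pointsD(1)[OF ex u u' s])
  qed
qed

lemma extremal_pos_part:
  fixes \<Omega> :: "'a::euclidean_space set"
  assumes ne: "\<Omega> \<noteq> {}" and ab: "0 < \<alpha>" "0 < \<beta>" "\<beta> < 2 * \<alpha>"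
    and ex: "\<mu> \<in> extremal_points (KR_ball \<Omega> p \<alpha> \<beta>)"
  shows "\<exists>x\<in>\<Omega>. \<forall>B. measure (pos_part \<Omega> \<mu>) B = measure (pos_part \<Omega> \<mu>) \<Omega> * dirac \<Omega> x B"
proof -
  let ?a = "pos_part \<Omega> \<mu>"
  have "\<mu> \<in> signed_measures \<Omega>" using ex by (simp add: extremal_points_def KR_ball_def radon_signed)
  note m = fin_meas_parts(1)[OF this]
  have "\<exists>x\<in>\<Omega>. \<forall>B\<in>sets (borel_on \<Omega>). measure ?a B = measure ?a \<Omega> * indicator B x"
  proof (cases "measure ?a \<Omega> = 0")
    case True
    interpret finite_measure ?a using m by (simp add: fin_meas_def)
    have "measure ?a B = 0" for B using True bounded_measure[of B] fin_measD(3)[OF m] by (simp add: measure_le_0_iff)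
    then show ?thesis using ne by auto
  next
    case False
    show ?thesis by (rule zero_one_measure_point[OF m extremal_zero_one[OF ab ex] False])
  qed
  then obtain x where x: "x \<in> \<Omega>" "\<And>B. B \<in> sets (borel_on \<Omega>) \<Longrightarrow> measure ?a B = measure ?a \<Omega> * indicator B x" by blast
  have "measure ?a B = measure ?a \<Omega> * dirac \<Omega> x B" for B
  proof (cases "B \<in> sets (borel_on \<Omega>)")
    case True then show ?thesis using x(2) by (simp add: dirac_sets)
  next
    case False then show ?thesis using m by (simp add: dirac_def measure_notin_sets fin_meas_def)
  qed
  then show ?thesis using x(1) by blast
qed

theorem theorem2p5:
  fixes \<Omega> :: "'a::euclidean_space set" and p \<alpha> \<beta> :: real
  assumes "convex \<Omega>" and "\<Omega> \<noteq> {}"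
    and "0 < p" and "p \<le> 1"
    and "\<alpha> > 0" and "\<beta> > 0" and "2 * \<alpha> - \<beta> > 0"
  shows "extremal_points (KR_ball \<Omega> p \<alpha> \<beta>) =
      {\<lambda>A. s * (1 / \<alpha>) * dirac \<Omega> x A | s x. s \<in> {1, -1} \<and> x \<in> \<Omega>} \<union>
      {\<lambda>A. 1 / (\<beta> + norm (x - y) powr p) * (dirac \<Omega> x A - dirac \<Omega> y A) | x y.
         x \<in> \<Omega> \<and> y \<in> \<Omega> \<and> 0 < norm (x - y) powr p \<and> norm (x - y) powr p < 2 * \<alpha> - \<beta>}"
    (is "?E = ?S \<union> ?T")
proof (intro equalityI subsetI)
  have ab: "0 < \<alpha>" "0 < \<beta>" "\<beta> < 2 * \<alpha>" using assms by auto
  fix u assume "u \<in> ?S \<union> ?T"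
  then show "u \<in> ?E"
  proof
    assume "u \<in> ?S"
    then obtain s x where s: "s = 1 \<or> s = - 1" and x: "x \<in> \<Omega>" and u: "u = (\<lambda>A. s * (1 / \<alpha>) * dirac \<Omega> x A)" by blast
    note e = point_mass_extremal[OF x ab, of p]
    from s show ?thesis
    proof
      assume "s = 1" then show ?thesis using e by (simp add: u)
    next
      assume "s = - 1" then show ?thesis using extremal_minus[OF ab(1,2) e] by (simp add: u)
    qed
  next
    assume "u \<in> ?T"
    then obtain x y where "x \<in> \<Omega>" "y \<in> \<Omega>" "0 < norm (x - y) powr p" "norm (x - y) powr p < 2 * \<alpha> - \<beta>"
      and u: "u = (\<lambda>A. 1 / (\<beta> + norm (x - y) powr p) * (dirac \<Omega> x A - dirac \<Omega> y A))" by blast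
    then show ?thesis unfolding u using assms ab by (intro dipole_extremal) auto
  qed
next
  have ab: "0 < \<alpha>" "0 < \<beta>" "\<beta> < 2 * \<alpha>" using assms by auto
  have neg: "u \<in> ?S \<union> ?T" if "(\<lambda>A. - u A) \<in> ?S \<union> ?T" for u
    using that
  proof
    assume "(\<lambda>A. - u A) \<in> ?S"
    then obtain s x where s: "s = 1 \<or> s = - 1" and x: "x \<in> \<Omega>" and e: "(\<lambda>A. - u A) = (\<lambda>A. s * (1 / \<alpha>) * dirac \<Omega> x A)" by blast
    have "u A = (- s) * (1 / \<alpha>) * dirac \<Omega> x A" for A using fun_cong[OF e, of A] by simp
    then have "u = (\<lambda>A. (- s) * (1 / \<alpha>) * dirac \<Omega> x A)" by (rule ext)
    moreover have "- s \<in> {1, - 1}" using s by auto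
    ultimately show ?thesis using x by blast
  next
    assume "(\<lambda>A. - u A) \<in> ?T"
    then obtain x y where xy: "x \<in> \<Omega>" "y \<in> \<Omega>" "0 < norm (x - y) powr p" "norm (x - y) powr p < 2 * \<alpha> - \<beta>"
      and e: "(\<lambda>A. - u A) = (\<lambda>A. 1 / (\<beta> + norm (x - y) powr p) * (dirac \<Omega> x A - dirac \<Omega> y A))" by blast
    have "u A = 1 / (\<beta> + norm (y - x) powr p) * (dirac \<Omega> y A - dirac \<Omega> x A)" for A
    proof -
      have "u A = - (1 / (\<beta> + norm (x - y) powr p) * (dirac \<Omega> x A - dirac \<Omega> y A))" using fun_cong[OF e, of A] by simp
      also have "\<dots> = 1 / (\<beta> + norm (y - x) powr p) * (dirac \<Omega> y A - dirac \<Omega> x A)"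
        unfolding norm_minus_commute[of x y] by (simp only: mult_minus_right[symmetric] minus_diff_eq)
      finally show ?thesis .
    qed
    then have "u = (\<lambda>A. 1 / (\<beta> + norm (y - x) powr p) * (dirac \<Omega> y A - dirac \<Omega> x A))" by (rule ext)
    moreover have "0 < norm (y - x) powr p" "norm (y - x) powr p < 2 * \<alpha> - \<beta>" using xy by (simp_all only: norm_minus_commute)
    ultimately show ?thesis using xy by blast
  qed
  fix \<mu> assume ex: "\<mu> \<in> ?E"
  note ex' = extremal_minus[OF ab(1,2) ex]
  have rad: "\<mu> \<in> radon_measures \<Omega>" using ex by (simp add: extremal_points_def KR_ball_def)
  note J = radon_jordan[OF rad]
  have np: "pos_part \<Omega> (\<lambda>A. - \<mu> A) = neg_part \<Omega> \<mu>" by (rule jordan_parts_eq(1)[OF jordan_minus[OF J]])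
  define a where "a = measure (pos_part \<Omega> \<mu>) \<Omega>"
  define b where "b = measure (neg_part \<Omega> \<mu>) \<Omega>"
  obtain x where x: "x \<in> \<Omega>" "\<And>B. measure (pos_part \<Omega> \<mu>) B = a * dirac \<Omega> x B"
    using extremal_pos_part[OF assms(2) ab ex] unfolding a_def by blast
  obtain y where y: "y \<in> \<Omega>" "\<And>B. measure (neg_part \<Omega> \<mu>) B = b * dirac \<Omega> y B"
    using extremal_pos_part[OF assms(2) ab ex'] unfolding np b_def by blast
  have mu: "\<mu> A = a * dirac \<Omega> x A - b * dirac \<Omega> y A" for A
    using parts_eq[OF radon_signed[OF rad], of A] x(2) y(2) by simp
  have mu': "- \<mu> A = b * dirac \<Omega> y A - a * dirac \<Omega> x A" for A using mu[of A] by simp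
  have a0: "0 \<le> a" and b0: "0 \<le> b" by (simp_all add: a_def b_def)
  have S1: "(\<lambda>A. 1 / \<alpha> * dirac \<Omega> z A) \<in> ?S \<union> ?T" if z: "z \<in> \<Omega>" for z
  proof -
    have "(\<lambda>A. 1 / \<alpha> * dirac \<Omega> z A) = (\<lambda>A. 1 * (1 / \<alpha>) * dirac \<Omega> z A)" by simp
    then show ?thesis using z by blast
  qed
  have T1: "(\<lambda>A. 1 / (\<beta> + norm (z - w) powr p) * (dirac \<Omega> z A - dirac \<Omega> w A)) \<in> ?S \<union> ?T"
    if z: "z \<in> \<Omega>" "w \<in> \<Omega>" "z \<noteq> w" "norm (z - w) powr p < 2 * \<alpha> - \<beta>" for z w
  proof -
    have "0 < norm (z - w) powr p" using z(3) by simp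
    then show ?thesis using z by blast
  qed
  show "\<mu> \<in> ?S \<union> ?T"
  proof (cases "b = 0")
    case True
    have "\<mu> = (\<lambda>A. 1 / \<alpha> * dirac \<Omega> x A)"
      using mu True by (intro extremal_one_point[OF x(1) ab(1,2) ex _ a0]) simp
    then show ?thesis by (simp only: S1[OF x(1)])
  next
    case b: False
    show ?thesis
    proof (cases "a = 0")
      case True
      have "(\<lambda>A. - \<mu> A) = (\<lambda>A. 1 / \<alpha> * dirac \<Omega> y A)"
        using mu' True by (intro extremal_one_point[OF y(1) ab(1,2) ex' _ b0]) simp
      then have "(\<lambda>A. - \<mu> A) \<in> ?S \<union> ?T" by (simp only: S1[OF y(1)])
      then show ?thesis by (rule neg)
    next
      case a: False
      have xy: "x \<noteq> y"
      proof
        \<comment> \<open>The two Jordan parts would charge the same point.\<close>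
        assume e: "x = y"
        obtain P where P: "P \<in> sets (borel_on \<Omega>)" "emeasure (pos_part \<Omega> \<mu>) (\<Omega> - P) = 0" "emeasure (neg_part \<Omega> \<mu>) P = 0"
          using J by (auto simp: is_jordan_decomposition_def)
        have OP: "\<Omega> - P \<in> sets (borel_on \<Omega>)" using P(1) Omega_sets by auto
        have "a * dirac \<Omega> x (\<Omega> - P) = 0" "b * dirac \<Omega> y P = 0"
          unfolding x(2)[symmetric] y(2)[symmetric] using P(2,3) by (simp_all add: measure_def)
        then show False using a b x(1) e P(1) OP by (auto simp: dirac_sets indicator_def split: if_splits)
      qed
      show ?thesis
      proof (cases "b \<le> a")
        case True
        have "0 < b" using b b0 by simp
        from extremal_two_point[OF x(1) y(1) xy assms(3,4) ab(1,2) ex mu this True] show ?thesis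
          by (elim disjE conjE, simp only: S1[OF x(1)], simp only: T1[OF x(1) y(1) xy])
      next
        case False
        have "0 < a" "a \<le> b" using a a0 False by simp_all
        from extremal_two_point[OF y(1) x(1) xy[symmetric] assms(3,4) ab(1,2) ex' mu' this]
        have "(\<lambda>A. - \<mu> A) \<in> ?S \<union> ?T"
          by (elim disjE conjE, simp only: S1[OF y(1)], simp only: T1[OF y(1) x(1) xy[symmetric]])
        then show ?thesis by (rule neg)
      qed
    qed
  qed
qed

end
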